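(* The factor $1/h$ in the following two estimates is asymptotically optimal as $h\to0$, in the following sense. (1) Let $n\ge2$, let $\omega\subset\mathbb R^{n-1}$ be an open bounded connected Lipschitz domain with a partition $\partial\omega=\Gamma_1\cup\Gamma_2$ such that $\Gamma_1$ is a $d$-dimensional simplex for some integer $0\le d\le n-1$ and, for any $x\in\Gamma_1$ and $y\in\omega$, the ray $l_x(y)$ starting from $x$ and going through $y$ meets $\partial\omega$ a second time at a point $z\in\Gamma_2$ such that the segment $(x,z)$ is the only common part of $l_x(y)$ and $\omega$. Let $k\in\mathbb N$, let $c_1,\dots,c_k\ge0$ be not all zero, and let $\alpha_1,\dots,\alpha_k\in[0,1/2)$; assume that either $\alpha_i\in[0,\beta]$ for all $i$, for some $\beta\in[0,1/2)$ with $1>\frac{4n\beta}{(1-2\beta)^2}$, or $n=2$ and $\omega=(a,b)$ for some $a<b$. For $h>0$ put $\Omega_h=(0,h)\times\omega$, $\delta(x)=\mathrm{dist}(x,(0,h)\times\Gamma_1)$ and $w=\sum_{i=1}^kc_i\delta^{\alpha_i}$ on $\Omega_h$. Then there do not exist $h_0>0$, a constant $C>0$ and a function $\varphi:(0,h_0)\to(0,\infty)$ with $h\varphi(h)\to0$ as $h\to0$ such that $$\|w\nabla u\|_{L^2(\Omega_h)}^2\le C\left(\varphi(h)\,\|wu\|_{L^2(\Omega_h)}\|wu_{x_1}\|_{L^2(\Omega_h)}+\|wu_{x_1}\|_{L^2(\Omega_h)}^2\right)$$ holds for all $h\in(0,h_0)$ and all $u\in C^2(\Omega_h)\cap C(\overline{\Omega_h})$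 with $\Delta u=0$ in $\Omega_h$ and $u=0$ on $(0,h)\times\partial\omega$. (2) Let $a>0$, $k\in\mathbb N$, $\alpha_i\in[0,1/2)$ and $c_i\ge0$ for $i=1,\dots,k$ with not all $c_i$ zero, and let $w(x,y)=\sum_{i=1}^kc_iy^{\alpha_i}$. For $h>0$ put $R_h=(0,h)\times(0,a)$. Then there do not exist $h_0>0$, a constant $C>0$ and a function $\varphi:(0,h_0)\to(0,\infty)$ with $h\varphi(h)\to0$ as $h\to0$ such that $$\|w\nabla U\|_{L^2(R_h)}^2\le C\left(\varphi(h)\,\|wu\|_{L^2(R_h)}\|we(U)\|_{L^2(R_h)}+\|we(U)\|_{L^2(R_h)}^2\right)$$ holds for all $h\in(0,h_0)$ and all $U=(u,v)\in H^1(R_h,\mathbb R^2)$ with $u(x,0)=u(x,a)$ for all $x\in(0,h)$ in the sense of traces.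
   Context: Points of $\Omega_h=(0,h)\times\omega$ are written $x=(x_1,x')$ with $x_1\in(0,h)$, $x'\in\omega$, and $u_{x_1}=\partial u/\partial x_1$. $e(U)=\frac12(\nabla U+\nabla U^T)$ is the symmetric part of the gradient. Points of $R_h$ are written $(x,y)$. The estimates whose sharpness is asserted are those with $\varphi(h)=1/h$: in (1) the weighted gradient separation estimate for harmonic functions $\|w\nabla u\|^2\le C\left(h^{-1}\|wu\|\,\|wu_{x_1}\|+\|wu_{x_1}\|^2\right)$, and in (2) the weighted Korn interpolation inequality $\|w\nabla U\|^2\le C\left(h^{-1}\|wu\|\,\|we(U)\|+\|we(U)\|^2\right)$, with $C$ independent of $h$ and of the function. Sharpness means that the power of $h$ in the constant is optimal as $h\to0$. *)

theory Defs
  imports "HOL-Analysis.Analysis"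
begin

section \<open>Classical partial derivatives\<close>

definition partial_deriv :: "'a::euclidean_space \<Rightarrow> ('a \<Rightarrow> real) \<Rightarrow> 'a \<Rightarrow> real"
  where "partial_deriv b u x = deriv (\<lambda>t. u (x + t *\<^sub>R b)) 0"

definition grad :: "('a::euclidean_space \<Rightarrow> real) \<Rightarrow> 'a \<Rightarrow> 'a"
  where "grad u x = (\<Sum>b\<in>Basis. partial_deriv b u x *\<^sub>R b)"

definition laplacian :: "('a::euclidean_space \<Rightarrow> real) \<Rightarrow> 'a \<Rightarrow> real"
  where "laplacian u x = (\<Sum>b\<in>Basis. partial_deriv b (partial_deriv b u) x)"

text \<open>Intended for open \<open>S\<close> only, since the difference quotients leave \<open>S\<close> otherwise.\<close>

fun C_on :: "nat \<Rightarrow> 'a::euclidean_space set \<Rightarrow> ('a \<Rightarrow> real) \<Rightarrow> bool"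
  where
    "C_on 0 S u \<longleftrightarrow> continuous_on S u"
  | "C_on (Suc k) S u \<longleftrightarrow> continuous_on S u \<and>
       (\<forall>b\<in>Basis. (\<forall>x\<in>S. (\<lambda>t. u (x + t *\<^sub>R b)) differentiable (at 0)) \<and>
                  C_on k S (partial_deriv b u))"

definition smooth :: "('a::euclidean_space \<Rightarrow> real) \<Rightarrow> bool"
  where "smooth u \<longleftrightarrow> (\<forall>k. C_on k UNIV u)"

definition test_function :: "'a::euclidean_space set \<Rightarrow> ('a \<Rightarrow> real) \<Rightarrow> bool"
  where "test_function S \<psi> \<longleftrightarrow>
    smooth \<psi> \<and> (\<exists>K. compact K \<and> K \<subseteq> S \<and> (\<forall>x. x \<notin> K \<longrightarrow> \<psi> x = 0))"

section \<open>\<open>L\<^sup>2\<close>, \<open>H\<^sup>1\<close> and traces\<close>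

text \<open>
  The norm takes the value \<open>\<infinity>\<close> when the integral diverges: a function in
  \<open>C\<^sup>2\<close> of an open set that is continuous up to the boundary need not have
  square integrable derivatives, and an estimate between such norms is read in \<open>[0, \<infinity>]\<close>.
  On matrices \<open>real ^ 'n ^ 'm\<close> the pointwise norm is the Frobenius norm.
\<close>

definition L2_norm :: "'a::euclidean_space set \<Rightarrow> ('a \<Rightarrow> 'b::real_normed_vector) \<Rightarrow> ennreal"
  where "L2_norm S f =
    (let I = \<integral>\<^sup>+x\<in>S. ennreal ((norm (f x))\<^sup>2) \<partial>lebesgue
     in if I = \<infinity> then \<infinity> else ennreal (sqrt (enn2real I)))"

definition in_L2 :: "'a::euclidean_space set \<Rightarrow> ('a \<Rightarrow> 'b::real_normed_vector) \<Rightarrow> bool"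
  where "in_L2 S f \<longleftrightarrow> set_borel_measurable lebesgue S f \<and> L2_norm S f < \<infinity>"

text \<open>\<open>u\<close> belongs to \<open>H\<^sup>1(S)\<close> and \<open>G\<close> is (a representative of) its weak gradient.\<close>

definition H1_grad :: "'a::euclidean_space set \<Rightarrow> ('a \<Rightarrow> real) \<Rightarrow> ('a \<Rightarrow> 'a) \<Rightarrow> bool"
  where "H1_grad S u G \<longleftrightarrow> in_L2 S u \<and> in_L2 S G \<and>
    (\<forall>\<psi>. test_function S \<psi> \<longrightarrow> (\<forall>b\<in>Basis.
       (LINT x:S|lebesgue. u x * partial_deriv b \<psi> x) = - (LINT x:S|lebesgue. (G x \<bullet> b) * \<psi> x)))"

text \<open>
  \<open>U\<close> belongs to \<open>H\<^sup>1(S, \<real>\<^sup>m)\<close> with weak gradient \<open>J\<close>, where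
  \<open>J x $ i $ j\<close> is the weak \<open>j\<close>-th partial derivative of the \<open>i\<close>-th component of \<open>U\<close>.
\<close>

definition H1_jacobian ::
    "(real ^ 'n) set \<Rightarrow> (real ^ 'n \<Rightarrow> real ^ 'm) \<Rightarrow> (real ^ 'n \<Rightarrow> real ^ 'n ^ 'm) \<Rightarrow> bool"
  where "H1_jacobian S U J \<longleftrightarrow> (\<forall>i. H1_grad S (\<lambda>x. U x $ i) (\<lambda>x. J x $ i))"

definition sym_part :: "real ^ 'n ^ 'n \<Rightarrow> real ^ 'n ^ 'n"
  where "sym_part M = (1/2) *\<^sub>R (M + transpose M)"

text \<open>
  \<open>g\<close> is the trace of \<open>u \<in> H\<^sup>1(S)\<close> on the boundary edge parametrized with unit speed by
  \<open>\<gamma>\<close> on the interval \<open>I\<close>: the trace operator is the continuous extension of the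
  restriction map from functions smooth up to the boundary, which are dense in \<open>H\<^sup>1(S)\<close>.
\<close>

definition has_trace ::
    "'a::euclidean_space set \<Rightarrow> ('a \<Rightarrow> real) \<Rightarrow> (real \<Rightarrow> 'a) \<Rightarrow> real set \<Rightarrow> (real \<Rightarrow> real) \<Rightarrow> bool"
  where "has_trace S u \<gamma> I g \<longleftrightarrow> in_L2 I g \<and>
    (\<exists>G v. H1_grad S u G \<and> (\<forall>j::nat. smooth (v j)) \<and>
       (\<lambda>j. L2_norm S (\<lambda>x. v j x - u x)) \<longlonglongrightarrow> 0 \<and>
       (\<lambda>j. L2_norm S (\<lambda>x. grad (v j) x - G x)) \<longlonglongrightarrow> 0 \<and>
       (\<lambda>j. L2_norm I (\<lambda>s. v j (\<gamma> s) - g s)) \<longlonglongrightarrow> 0)"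

section \<open>Domains and weights\<close>

text \<open>
  Near each boundary point \<open>\<omega>\<close> is the strict epigraph of a Lipschitz function over a
  hyperplane \<open>\<nu>\<^sup>\<bottom>\<close>; for intervals the hyperplane is \<open>{0}\<close>.
\<close>

definition lipschitz_domain :: "'a::euclidean_space set \<Rightarrow> bool"
  where "lipschitz_domain \<omega> \<longleftrightarrow> open \<omega> \<and> bounded \<omega> \<and> connected \<omega> \<and> \<omega> \<noteq> {} \<and>
    (\<forall>p\<in>frontier \<omega>. \<exists>N \<nu> L g. open N \<and> p \<in> N \<and> norm \<nu> = 1 \<and>
       L-lipschitz_on {z. z \<bullet> \<nu> = 0} g \<and>
       \<omega> \<inter> N = {y \<in> N. g (y - (y \<bullet> \<nu>) *\<^sub>R \<nu>) < y \<bullet> \<nu>})"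

definition ray :: "'a::real_vector \<Rightarrow> 'a \<Rightarrow> 'a set"
  where "ray x y = {x + t *\<^sub>R (y - x) |t. 0 \<le> t}"

definition ray_condition :: "'a::euclidean_space set \<Rightarrow> 'a set \<Rightarrow> 'a set \<Rightarrow> bool"
  where "ray_condition \<omega> \<Gamma>\<^sub>1 \<Gamma>\<^sub>2 \<longleftrightarrow>
    (\<forall>x\<in>\<Gamma>\<^sub>1. \<forall>y\<in>\<omega>. \<exists>z\<in>\<Gamma>\<^sub>2. z \<noteq> x \<and> z \<in> ray x y \<and> ray x y \<inter> \<omega> = open_segment x z)"

text \<open>
  Only evaluated at positive distances, so that the library's \<open>0 powr 0 = 0\<close> plays no role.
\<close>

definition weight :: "nat \<Rightarrow> (nat \<Rightarrow> real) \<Rightarrow> (nat \<Rightarrow> real) \<Rightarrow> real \<Rightarrow> real"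
  where "weight k c \<alpha> s = (\<Sum>i=1..k. c i * s powr \<alpha> i)"

definition cylinder :: "'a::euclidean_space set \<Rightarrow> real \<Rightarrow> (real \<times> 'a) set"
  where "cylinder \<omega> h = {0<..<h} \<times> \<omega>"

definition cylinder_weight :: "'a::euclidean_space set \<Rightarrow> nat \<Rightarrow> (nat \<Rightarrow> real) \<Rightarrow> (nat \<Rightarrow> real)
    \<Rightarrow> real \<Rightarrow> real \<times> 'a \<Rightarrow> real"
  where "cylinder_weight \<Gamma>\<^sub>1 k c \<alpha> h x = weight k c \<alpha> (infdist x ({0<..<h} \<times> \<Gamma>\<^sub>1))"

definition rectangle :: "real \<Rightarrow> real \<Rightarrow> (real ^ 2) set"
  where "rectangle h a = {p. 0 < p $ 1 \<and> p $ 1 < h \<and> 0 < p $ 2 \<and> p $ 2 < a}"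

definition rectangle_weight :: "nat \<Rightarrow> (nat \<Rightarrow> real) \<Rightarrow> (nat \<Rightarrow> real) \<Rightarrow> real ^ 2 \<Rightarrow> real"
  where "rectangle_weight k c \<alpha> p = weight k c \<alpha> (p $ 2)"

section \<open>The two estimates with factor \<open>f\<close> in place of \<open>1/h\<close>\<close>

definition gradient_separation_estimate :: "(real ^ 'm) set \<Rightarrow> (real ^ 'm) set
    \<Rightarrow> nat \<Rightarrow> (nat \<Rightarrow> real) \<Rightarrow> (nat \<Rightarrow> real) \<Rightarrow> real \<Rightarrow> real \<Rightarrow> real \<Rightarrow> bool"
  where "gradient_separation_estimate \<omega> \<Gamma>\<^sub>1 k c \<alpha> C f h \<longleftrightarrow>
    (let \<Omega> = cylinder \<omega> h; w = cylinder_weight \<Gamma>\<^sub>1 k c \<alpha> h in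
     \<forall>u :: real \<times> (real ^ 'm) \<Rightarrow> real.
       C_on 2 \<Omega> u \<and> continuous_on (closure \<Omega>) u \<and>
       (\<forall>x\<in>\<Omega>. laplacian u x = 0) \<and> (\<forall>x\<in>{0<..<h} \<times> frontier \<omega>. u x = 0) \<longrightarrow>
       (L2_norm \<Omega> (\<lambda>x. w x *\<^sub>R grad u x))\<^sup>2 \<le>
         ennreal C *
           (ennreal f * L2_norm \<Omega> (\<lambda>x. w x * u x)
                      * L2_norm \<Omega> (\<lambda>x. w x * partial_deriv (1, 0) u x)
            + (L2_norm \<Omega> (\<lambda>x. w x * partial_deriv (1, 0) u x))\<^sup>2))"

text \<open>
  The boundary condition and the factor \<open>\<parallel>wu\<parallel>\<close> concern the first component \<open>u\<close> of
  \<open>U = (u, v)\<close> only. Equality of the two traces is the existence of a common trace \<open>g\<close>.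
\<close>

definition korn_interpolation_estimate :: "real
    \<Rightarrow> nat \<Rightarrow> (nat \<Rightarrow> real) \<Rightarrow> (nat \<Rightarrow> real) \<Rightarrow> real \<Rightarrow> real \<Rightarrow> real \<Rightarrow> bool"
  where "korn_interpolation_estimate a k c \<alpha> C f h \<longleftrightarrow>
    (let R = rectangle h a; w = rectangle_weight k c \<alpha> in
     \<forall>(U :: real ^ 2 \<Rightarrow> real ^ 2) (J :: real ^ 2 \<Rightarrow> real ^ 2 ^ 2).
       H1_jacobian R U J \<and>
       (\<exists>g. has_trace R (\<lambda>p. U p $ 1) (\<lambda>s. vector [s, 0]) {0<..<h} g \<and>
            has_trace R (\<lambda>p. U p $ 1) (\<lambda>s. vector [s, a]) {0<..<h} g) \<longrightarrow>
       (L2_norm R (\<lambda>p. w p *\<^sub>R J p))\<^sup>2 \<le>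
         ennreal C *
           (ennreal f * L2_norm R (\<lambda>p. w p * U p $ 1)
                      * L2_norm R (\<lambda>p. w p *\<^sub>R sym_part (J p))
            + (L2_norm R (\<lambda>p. w p *\<^sub>R sym_part (J p)))\<^sup>2))"

end

theory Submission
  imports Defs
begin

text \<open>
  In both parts the estimate fails for functions that hardly vary, or hardly strain, across the
  thin direction: with \<open>\<parallel>w\<nabla>u\<parallel>\<^sup>2\<close> of order \<open>h\<close>, \<open>\<parallel>wu\<parallel>\<^sup>2\<close> of order \<open>h\<close> and the remaining norm
  squared of order \<open>h\<^sup>3\<close>, the estimate with factor \<open>\<phi>(h)\<close> gives, after division by \<open>h\<close>, a positive
  lower bound for \<open>h \<phi>(h) + h\<^sup>2\<close> (\<open>no_smaller_factor\<close>). The weight only enters through a positive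
  lower bound on a small set away from its zeros and an upper bound.

  For the Korn inequality such fields are explicit bendings, \<open>u = y (a - y)\<close> and
  \<open>v = -(x - h/2) (a - 2y)\<close>, whose only strain is \<open>v\<^sub>y = 2 (x - h/2)\<close> (\<open>korn_interpolation_sharp\<close>).

  For harmonic functions one function serves all \<open>h\<close>, shifted so that its plane of symmetry is
  in the middle of the thin cylinder: a nonzero \<open>U\<close>, harmonic on \<open>(-H, H) \<times> \<omega>\<close>, zero on the lateral
  boundary, even in the axial variable \<open>t\<close>, and with \<open>\<bar>\<partial>\<^sub>t U\<bar> \<le> K \<bar>t\<bar>\<close> up to the lateral boundary
  (\<open>flat_cylinder_solution\<close>). The model is \<open>U = cosh(\<surd>\<lambda> t) \<psi>(x')\<close> with a Dirichlet eigenfunction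
  \<open>\<psi>\<close> of \<open>\<omega>\<close>; here the maximum principle yields these properties directly.
  Comparing \<open>U(t\<^sub>0 + t, \<cdot>) - U(t\<^sub>0 - t, \<cdot>)\<close> with a linear function of \<open>t\<close> bounds it by a multiple of
  \<open>t\<close>; doing the same for \<open>U(t + \<sigma>, \<cdot>) - U(t - \<sigma>, \<cdot>)\<close>, which vanishes at \<open>t = 0\<close> by evenness, bounds
  \<open>\<partial>\<^sub>t U\<close> by a multiple of \<open>t\<close>, with no regularity at the lateral boundary beyond continuity.

  Existence of \<open>U\<close> is Perron's method (\<open>perron_harmonic\<close>), built without integration. The Dirichlet
  problem on a ball is solved for polynomials, because every polynomial agrees on a sphere with a
  harmonic one (\<open>polynomial_eq_harmonic_on_sphere\<close>), and then for continuous data by the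
  Stone-Weierstrass theorem. Compactness rests on an interior Lipschitz estimate
  (\<open>harmonic_Lipschitz\<close>) that follows from reflection and an explicit quadratic barrier. Continuity
  at the lateral boundary uses that a Lipschitz domain has exterior balls of comparable size at all
  scales (\<open>lipschitz_exterior_balls\<close>), which forces geometric decay (\<open>boundary_decay\<close>).
\<close>

section \<open>Calculus of classical partial derivatives\<close>

definition has_pd :: "'a::euclidean_space \<Rightarrow> ('a \<Rightarrow> real) \<Rightarrow> 'a \<Rightarrow> real \<Rightarrow> bool"
  where "has_pd b u x d \<longleftrightarrow> ((\<lambda>t. u (x + t *\<^sub>R b)) has_real_derivative d) (at 0)"

lemma partial_deriv_eqI: "has_pd b u x d \<Longrightarrow> partial_deriv b u x = d"
  unfolding has_pd_def partial_deriv_def by (rule DERIV_imp_deriv)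

lemma differentiable_has_pd:
  "(\<lambda>t. u (x + t *\<^sub>R b)) differentiable (at 0) \<longleftrightarrow> has_pd b u x (partial_deriv b u x)"
  unfolding has_pd_def partial_deriv_def
  by (metis DERIV_imp_deriv real_differentiable_def)

lemma has_pd_line:
  assumes "has_pd b u (x + s *\<^sub>R b) d"
  shows "((\<lambda>t. u (x + t *\<^sub>R b)) has_real_derivative d) (at s)"
proof -
  have "((\<lambda>t. (\<lambda>t. u (x + t *\<^sub>R b)) (t + s)) has_real_derivative d) (at 0)"
    using assms by (simp add: has_pd_def algebra_simps)
  then show ?thesis
    by (subst (asm) DERIV_shift [symmetric]) simp
qed

lemma has_pd_cong:
  assumes "open S" "x \<in> S" "\<And>y. y \<in> S \<Longrightarrow> u y = v y" "has_pd b u x d"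
  shows "has_pd b v x d"
proof -
  have "open ((\<lambda>t. x + t *\<^sub>R b) -` S)"
    by (intro open_vimage assms continuous_intros)
  then show ?thesis
    using assms unfolding has_pd_def
    by (auto intro: has_field_derivative_transform_within_open
        [where S = "(\<lambda>t. x + t *\<^sub>R b) -` S"])
qed

lemma has_pd_eqI: "has_pd b u x d \<Longrightarrow> d = e \<Longrightarrow> has_pd b u x e"
  by simp

lemma has_pd_const: "has_pd b (\<lambda>x. c) x 0"
  by (simp add: has_pd_def)

lemma has_pd_linear:
  assumes "bounded_linear f" shows "has_pd b f x (f b)"
proof -
  interpret bounded_linear f by fact
  show ?thesis
    unfolding has_pd_def add scaleR by (auto intro!: derivative_eq_intros)
qed

lemma has_pd_add:
  "has_pd b u x d \<Longrightarrow> has_pd b v x e \<Longrightarrow> has_pd b (\<lambda>x. u x + v x) x (d + e)"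
  unfolding has_pd_def by (rule DERIV_add)

lemma has_pd_cmult: "has_pd b u x d \<Longrightarrow> has_pd b (\<lambda>x. c * u x) x (c * d)"
  unfolding has_pd_def by (rule DERIV_cmult)

lemma has_pd_diff:
  "has_pd b u x d \<Longrightarrow> has_pd b v x e \<Longrightarrow> has_pd b (\<lambda>x. u x - v x) x (d - e)"
  unfolding has_pd_def by (rule DERIV_diff)

lemma has_pd_mult:
  "has_pd b u x d \<Longrightarrow> has_pd b v x e \<Longrightarrow> has_pd b (\<lambda>x. u x * v x) x (d * v x + u x * e)"
  unfolding has_pd_def by (auto intro!: derivative_eq_intros)

lemma has_pd_translate: "has_pd b u (x + z) d \<Longrightarrow> has_pd b (\<lambda>x. u (x + z)) x d"
  unfolding has_pd_def by (simp add: algebra_simps)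

text \<open>
  First and second partial derivatives given as explicit functions: unlike the total function
  \<^const>\<open>partial_deriv\<close>, such witnesses can be added, scaled, reflected and passed to limits
  without reproving differentiability each time.
\<close>

definition C2_with :: "'a::euclidean_space set \<Rightarrow> ('a \<Rightarrow> real) \<Rightarrow> ('a \<Rightarrow> 'a \<Rightarrow> real)
    \<Rightarrow> ('a \<Rightarrow> 'a \<Rightarrow> 'a \<Rightarrow> real) \<Rightarrow> bool"
  where "C2_with S u g k \<longleftrightarrow> continuous_on S u \<and>
    (\<forall>b\<in>Basis. continuous_on S (g b) \<and> (\<forall>x\<in>S. has_pd b u x (g b x)) \<and>
      (\<forall>c\<in>Basis. continuous_on S (k b c) \<and> (\<forall>x\<in>S. has_pd c (g b) x (k b c x))))"

lemma C2_withI: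
  assumes "continuous_on S u"
    and "\<And>b. b \<in> Basis \<Longrightarrow> continuous_on S (g b)"
    and "\<And>b x. b \<in> Basis \<Longrightarrow> x \<in> S \<Longrightarrow> has_pd b u x (g b x)"
    and "\<And>b c. b \<in> Basis \<Longrightarrow> c \<in> Basis \<Longrightarrow> continuous_on S (k b c)"
    and "\<And>b c x. b \<in> Basis \<Longrightarrow> c \<in> Basis \<Longrightarrow> x \<in> S \<Longrightarrow> has_pd c (g b) x (k b c x)"
  shows "C2_with S u g k"
  using assms unfolding C2_with_def by blast

lemma C2_withD:
  assumes "C2_with S u g k"
  shows "continuous_on S u"
    and "b \<in> Basis \<Longrightarrow> continuous_on S (g b)"
    and "b \<in> Basis \<Longrightarrow> x \<in> S \<Longrightarrow> has_pd b u x (g b x)"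
    and "b \<in> Basis \<Longrightarrow> c \<in> Basis \<Longrightarrow> continuous_on S (k b c)"
    and "b \<in> Basis \<Longrightarrow> c \<in> Basis \<Longrightarrow> x \<in> S \<Longrightarrow> has_pd c (g b) x (k b c x)"
  using assms unfolding C2_with_def by blast+

lemma C_on_2_C2_with:
  "C_on 2 S u \<longleftrightarrow>
     C2_with S u (\<lambda>b. partial_deriv b u) (\<lambda>b c. partial_deriv c (partial_deriv b u))"
  by (auto simp: numeral_2_eq_2 C2_with_def differentiable_has_pd)

lemma C2_with_pd:
  assumes "C2_with S u g k" "open S" "b \<in> Basis" "c \<in> Basis" "x \<in> S"
  shows "partial_deriv b u x = g b x" "has_pd c (partial_deriv b u) x (k b c x)"
proof -
  have pd: "partial_deriv b u y = g b y" if "y \<in> S" for y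
    using C2_withD(3)[OF assms(1,3)] that by (auto intro: partial_deriv_eqI)
  then show "partial_deriv b u x = g b x"
    using assms by blast
  show "has_pd c (partial_deriv b u) x (k b c x)"
    by (rule has_pd_cong[OF \<open>open S\<close> \<open>x \<in> S\<close> _ C2_withD(5)[OF assms(1,3,4,5)]]) (simp add: pd)
qed

lemma C2_with_imp_C_on:
  assumes "C2_with S u g k" "open S"
  shows "C_on 2 S u" "\<And>x. x \<in> S \<Longrightarrow> laplacian u x = (\<Sum>b\<in>Basis. k b b x)"
proof -
  have pd: "partial_deriv b u x = g b x" if "b \<in> Basis" "x \<in> S" for b x
    using C2_with_pd(1)[OF assms that(1) that(1) that(2)] .
  have pd2: "partial_deriv c (partial_deriv b u) x = k b c x"
    if "b \<in> Basis" "c \<in> Basis" "x \<in> S" for b c x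
    using C2_with_pd(2)[OF assms that] by (rule partial_deriv_eqI)
  show "C_on 2 S u"
    unfolding C_on_2_C2_with
  proof (rule C2_withI)
    show "continuous_on S (partial_deriv b u)" if "b \<in> Basis" for b
      using C2_withD(2)[OF assms(1) that] pd[OF that] by (simp cong: continuous_on_cong)
    show "continuous_on S (partial_deriv c (partial_deriv b u))" if "b \<in> Basis" "c \<in> Basis" for b c
      using C2_withD(4)[OF assms(1) that] pd2[OF that] by (simp cong: continuous_on_cong)
    show "has_pd b u x (partial_deriv b u x)" if "b \<in> Basis" "x \<in> S" for b x
      using C2_withD(3)[OF assms(1) that] pd[OF that] by simp
    show "has_pd c (partial_deriv b u) x (partial_deriv c (partial_deriv b u) x)"
      if "b \<in> Basis" "c \<in> Basis" "x \<in> S" for b c x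
      using C2_with_pd(2)[OF assms that] pd2[OF that] by simp
  qed (use C2_withD(1)[OF assms(1)] in auto)
  show "laplacian u x = (\<Sum>b\<in>Basis. k b b x)" if "x \<in> S" for x
    unfolding laplacian_def using pd2 that by (intro sum.cong) auto
qed

lemma C_on_2_has_pd:
  assumes "C_on 2 S u" "b \<in> Basis" "x \<in> S"
  shows "has_pd b u x (partial_deriv b u x)"
  using assms C2_withD(3) unfolding C_on_2_C2_with by blast

lemma C_on_2_continuous: "C_on 2 S u \<Longrightarrow> continuous_on S u"
  by (simp add: numeral_2_eq_2)

lemma C_on_2_subset: "C_on 2 T u \<Longrightarrow> S \<subseteq> T \<Longrightarrow> C_on 2 S u"
  unfolding C_on_2_C2_with C2_with_def by (meson continuous_on_subset subsetD)

lemma C2_with_cong: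
  assumes "C2_with S u g k" "open S" "\<And>x. x \<in> S \<Longrightarrow> u x = v x"
  shows "C2_with S v g k"
proof (rule C2_withI)
  show "continuous_on S v"
    using C2_withD(1)[OF assms(1)] assms(3) by (simp cong: continuous_on_cong)
  show "has_pd b v x (g b x)" if "b \<in> Basis" "x \<in> S" for b x
    by (rule has_pd_cong[OF assms(2) that(2) assms(3) C2_withD(3)[OF assms(1) that]])
qed (use C2_withD[OF assms(1)] in auto)

lemma C2_with_add:
  assumes "C2_with S u g k" "C2_with S v g' k'"
  shows "C2_with S (\<lambda>x. u x + v x) (\<lambda>b x. g b x + g' b x) (\<lambda>b c x. k b c x + k' b c x)"
  using assms unfolding C2_with_def by (simp add: continuous_on_add has_pd_add)

lemma C2_with_cmult:
  assumes "C2_with S u g k"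
  shows "C2_with S (\<lambda>x. a * u x) (\<lambda>b x. a * g b x) (\<lambda>b c x. a * k b c x)"
  using assms unfolding C2_with_def by (simp add: continuous_on_mult_left has_pd_cmult)

lemma C2_lincomb:
  assumes "C_on 2 S u" "C_on 2 S v" "open S"
  shows "C_on 2 S (\<lambda>x. a * u x + c * v x)"
    "x \<in> S \<Longrightarrow> laplacian (\<lambda>x. a * u x + c * v x) x = a * laplacian u x + c * laplacian v x"
proof -
  note C = C2_with_add[OF C2_with_cmult[OF assms(1)[unfolded C_on_2_C2_with], of a]
      C2_with_cmult[OF assms(2)[unfolded C_on_2_C2_with], of c]]
  show "C_on 2 S (\<lambda>x. a * u x + c * v x)"
    using C2_with_imp_C_on(1)[OF C assms(3)] .
  show "laplacian (\<lambda>x. a * u x + c * v x) x = a * laplacian u x + c * laplacian v x" if "x \<in> S"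
    using C2_with_imp_C_on(2)[OF C assms(3) that]
    by (simp add: laplacian_def sum.distrib sum_distrib_left)
qed

lemma C2_translate:
  assumes "C_on 2 S u"
  shows "C_on 2 ((\<lambda>x. x - z) ` S) (\<lambda>x. u (x + z))"
    "laplacian (\<lambda>x. u (x + z)) x = laplacian u (x + z)"
proof -
  have pd: "partial_deriv b (\<lambda>x. v (x + z)) = (\<lambda>x. partial_deriv b v (x + z))" for b v
    by (auto simp: partial_deriv_def algebra_simps)
  then show "laplacian (\<lambda>x. u (x + z)) x = laplacian u (x + z)"
    by (simp add: laplacian_def)
  have co: "continuous_on ((\<lambda>x. x - z) ` S) (\<lambda>x. f (x + z))" if "continuous_on S f"
    for f :: "'a \<Rightarrow> real"
    by (rule continuous_on_compose2[OF that]) (auto intro!: continuous_intros)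
  show "C_on 2 ((\<lambda>x. x - z) ` S) (\<lambda>x. u (x + z))"
    unfolding C_on_2_C2_with pd
    using C2_withD[OF assms[unfolded C_on_2_C2_with]]
    by (intro C2_withI) (auto intro!: co has_pd_translate)
qed

lemma C_on_2_local:
  assumes "\<And>x. x \<in> S \<Longrightarrow> \<exists>T. open T \<and> x \<in> T \<and> C_on 2 T u"
  shows "C_on 2 S u"
proof -
  have co: "continuous_on S f" if "\<And>T. C_on 2 T u \<Longrightarrow> continuous_on T f" for f :: "'a \<Rightarrow> real"
    unfolding continuous_on_eq_continuous_within
    by (metis assms that continuous_at_imp_continuous_within continuous_on_eq_continuous_at)
  show ?thesis
    unfolding C_on_2_C2_with
  proof (rule C2_withI)
    show "continuous_on S u"
      by (rule co) (rule C_on_2_continuous)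
    fix b c x :: 'a assume b: "b \<in> Basis"
    show "continuous_on S (partial_deriv b u)"
      by (rule co) (use b in \<open>auto simp: C_on_2_C2_with dest: C2_withD(2)\<close>)
    show "has_pd b u x (partial_deriv b u x)" if "x \<in> S"
      using assms[OF that] b C_on_2_has_pd by blast
    assume c: "c \<in> Basis"
    show "continuous_on S (partial_deriv c (partial_deriv b u))"
      by (rule co) (use b c in \<open>auto simp: C_on_2_C2_with dest: C2_withD(4)\<close>)
    show "has_pd c (partial_deriv b u) x (partial_deriv c (partial_deriv b u) x)" if "x \<in> S"
      using assms[OF that] b c C2_withD(5) unfolding C_on_2_C2_with by blast
  qed
qed

subsection \<open>Polynomials\<close>

lemma polynomial_has_pd:
  assumes "real_polynomial_function p"
  shows "\<exists>q. real_polynomial_function q \<and> (\<forall>x. has_pd b p x (q x))"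
  using assms
proof induction
  case (linear f)
  then show ?case
    by (auto intro!: exI[of _ "\<lambda>x. f b"] has_pd_linear)
next
  case (const c)
  then show ?case
    by (auto intro!: exI[of _ "\<lambda>x. 0"] has_pd_const)
next
  case (add f g)
  then show ?case
    by (blast intro: has_pd_add)
next
  case (mult f g)
  then obtain f' g' where "real_polynomial_function f'" "\<forall>x. has_pd b f x (f' x)"
    "real_polynomial_function g'" "\<forall>x. has_pd b g x (g' x)"
    by blast
  with mult.hyps show ?case
    by (intro exI[of _ "\<lambda>x. f' x * g x + f x * g' x"]) (auto intro!: has_pd_mult)
qed

lemma polynomial_partial_deriv:
  assumes "real_polynomial_function p"
  shows "real_polynomial_function (partial_deriv b p)" "has_pd b p x (partial_deriv b p x)"
proof -
  obtain q where q: "real_polynomial_function q" "\<And>x. has_pd b p x (q x)"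
    using polynomial_has_pd[OF assms] by blast
  have "partial_deriv b p = q"
    using q(2) partial_deriv_eqI by blast
  with q show "real_polynomial_function (partial_deriv b p)" "has_pd b p x (partial_deriv b p x)"
    by auto
qed

lemma partial_deriv_arith:
  assumes "real_polynomial_function p" "real_polynomial_function q"
  shows "partial_deriv b (\<lambda>x. p x + q x) = (\<lambda>x. partial_deriv b p x + partial_deriv b q x)"
    and "partial_deriv b (\<lambda>x. p x - q x) = (\<lambda>x. partial_deriv b p x - partial_deriv b q x)"
    and "partial_deriv b (\<lambda>x. p x * q x) = (\<lambda>x. partial_deriv b p x * q x + p x * partial_deriv b q x)"
proof -
  note P = polynomial_partial_deriv(2)[OF assms(1)] and Q = polynomial_partial_deriv(2)[OF assms(2)]
  show "partial_deriv b (\<lambda>x. p x + q x) = (\<lambda>x. partial_deriv b p x + partial_deriv b q x)"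
    by (rule ext, rule partial_deriv_eqI, rule has_pd_add[OF P Q])
  show "partial_deriv b (\<lambda>x. p x - q x) = (\<lambda>x. partial_deriv b p x - partial_deriv b q x)"
    by (rule ext, rule partial_deriv_eqI, rule has_pd_diff[OF P Q])
  show "partial_deriv b (\<lambda>x. p x * q x) = (\<lambda>x. partial_deriv b p x * q x + p x * partial_deriv b q x)"
    by (rule ext, rule partial_deriv_eqI, rule has_pd_mult[OF P Q])
qed

lemma partial_deriv_cmult:
  assumes "real_polynomial_function p"
  shows "partial_deriv b (\<lambda>x. a * p x) = (\<lambda>x. a * partial_deriv b p x)"
  by (rule ext, rule partial_deriv_eqI, rule has_pd_cmult[OF polynomial_partial_deriv(2)[OF assms]])

lemma partial_deriv_const: "partial_deriv b (\<lambda>x. c) = (\<lambda>x. 0)"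
  by (auto intro!: ext partial_deriv_eqI has_pd_const)

lemma partial_deriv_linear: "bounded_linear f \<Longrightarrow> partial_deriv b f = (\<lambda>x. f b)"
  by (auto intro!: ext partial_deriv_eqI has_pd_linear)

lemma partial_deriv_coord: "partial_deriv b (\<lambda>x. x \<bullet> c) = (\<lambda>x. b \<bullet> c)"
  by (intro partial_deriv_linear bounded_linear_inner_left)

lemma has_pd_shifted_coord: "has_pd b (\<lambda>x. x \<bullet> c - k) x (b \<bullet> c)"
  using has_pd_diff[OF has_pd_linear[OF bounded_linear_inner_left] has_pd_const] by simp

lemma has_pd_shifted_coord': "has_pd b (\<lambda>x. (x - z) \<bullet> c) x (b \<bullet> c)"
  using has_pd_shifted_coord[of b c "z \<bullet> c" x] by (simp add: inner_diff_left)

lemma polynomial_coord: "real_polynomial_function (\<lambda>x. x \<bullet> c)"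
  by (intro real_polynomial_function.intros(1) bounded_linear_inner_left)

lemma partial_deriv_sum:
  assumes "\<And>i. i \<in> I \<Longrightarrow> real_polynomial_function (p i)"
  shows "partial_deriv b (\<lambda>x. \<Sum>i\<in>I. p i x) = (\<lambda>x. \<Sum>i\<in>I. partial_deriv b (p i) x)"
proof (rule ext, rule partial_deriv_eqI)
  fix x
  show "has_pd b (\<lambda>x. \<Sum>i\<in>I. p i x) x (\<Sum>i\<in>I. partial_deriv b (p i) x)"
    using polynomial_partial_deriv(2)[OF assms] unfolding has_pd_def by (auto intro: DERIV_sum)
qed

lemma polynomial_continuous: "real_polynomial_function p \<Longrightarrow> continuous_on S p"
  by (simp add: continuous_on_polymonial_function real_polynomial_function_eq)

lemma polynomial_C_on: "real_polynomial_function p \<Longrightarrow> C_on k S p"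
  by (induction k arbitrary: p)
    (simp_all add: polynomial_continuous polynomial_partial_deriv differentiable_has_pd)

lemma partial_deriv_commute:
  assumes "real_polynomial_function p"
  shows "partial_deriv b (partial_deriv c p) = partial_deriv c (partial_deriv b p)"
  using assms
proof induction
  case (linear f)
  then show ?case
    by (simp add: partial_deriv_linear partial_deriv_const)
next
  case (const c)
  then show ?case
    by (simp add: partial_deriv_const)
next
  case (add f g)
  then show ?case
    by (simp add: partial_deriv_arith polynomial_partial_deriv)
next
  case (mult f g)
  then show ?case
    by (simp add: partial_deriv_arith polynomial_partial_deriv real_polynomial_function.intros(4) algebra_simps)
qed

lemma partial_deriv_norm_power2:
  "partial_deriv b (\<lambda>x. (norm (x - z))\<^sup>2) = (\<lambda>x. 2 * ((x - z) \<bullet> b))"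
proof -
  have "((\<lambda>t. ((x - z) + t *\<^sub>R b) \<bullet> ((x - z) + t *\<^sub>R b)) has_real_derivative 2 * ((x - z) \<bullet> b)) (at 0)"
    for x
    by (auto simp: inner_simps intro!: derivative_eq_intros) (simp add: inner_commute)
  then show ?thesis
    by (auto intro!: ext partial_deriv_eqI simp: has_pd_def power2_norm_eq_inner algebra_simps)
qed

lemma polynomial_norm_power2: "real_polynomial_function (\<lambda>x. (norm (x - z :: 'a::euclidean_space))\<^sup>2)"
proof -
  have "(norm (x - z))\<^sup>2 = (\<Sum>b\<in>Basis. (x \<bullet> b - z \<bullet> b) * (x \<bullet> b - z \<bullet> b))" for x :: 'a
    unfolding power2_norm_eq_inner by (subst euclidean_inner) (simp add: inner_simps)
  then show ?thesis
    by (auto intro!: real_polynomial_function_sum real_polynomial_function_diff polynomial_coord)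
qed

lemma has_pd_norm_power2: "has_pd b (\<lambda>x. (norm (x - z))\<^sup>2) x (2 * ((x - z) \<bullet> b))"
  using polynomial_partial_deriv(2)[OF polynomial_norm_power2] by (simp add: partial_deriv_norm_power2)

lemma partial_deriv_shifted_coord: "partial_deriv b (\<lambda>x. 2 * ((x - z) \<bullet> c)) = (\<lambda>x. 2 * (b \<bullet> c))"
proof -
  have "(\<lambda>x. 2 * ((x - z) \<bullet> c)) = (\<lambda>x. 2 * (x \<bullet> c) + -2 * (z \<bullet> c))"
    by (simp add: inner_simps algebra_simps)
  then show ?thesis
    by (simp only: partial_deriv_arith real_polynomial_function.intros polynomial_coord partial_deriv_coord partial_deriv_const) simp
qed

lemma laplacian_norm_power2:
  "laplacian (\<lambda>x::'a::euclidean_space. (norm (x - z))\<^sup>2) x = 2 * real DIM('a)"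
  by (simp add: laplacian_def partial_deriv_norm_power2 partial_deriv_shifted_coord)

section \<open>The maximum principle and a gradient estimate\<close>

definition harmonic_on :: "'a::euclidean_space set \<Rightarrow> ('a \<Rightarrow> real) \<Rightarrow> bool"
  where "harmonic_on S u \<longleftrightarrow> C_on 2 S u \<and> (\<forall>x\<in>S. laplacian u x = 0)"

lemma harmonic_on_subset: "harmonic_on T u \<Longrightarrow> S \<subseteq> T \<Longrightarrow> harmonic_on S u"
  unfolding harmonic_on_def using C_on_2_subset by blast

lemma harmonic_on_lincomb:
  assumes "harmonic_on S u" "harmonic_on S v" "open S"
  shows "harmonic_on S (\<lambda>x. a * u x + c * v x)"
  using assms C2_lincomb[where u=u and v=v and S=S and a=a and c=c] unfolding harmonic_on_def by simp

lemma harmonic_on_diff: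
  assumes "harmonic_on S u" "harmonic_on S v" "open S"
  shows "harmonic_on S (\<lambda>x. u x - v x)"
  using harmonic_on_lincomb[OF assms, of 1 "-1"] by simp

lemma harmonic_on_const: "harmonic_on S (\<lambda>x. c)"
  unfolding harmonic_on_def
  by (auto simp: laplacian_def partial_deriv_const intro!: polynomial_C_on real_polynomial_function.intros(2))

lemma harmonic_on_cmult:
  assumes "harmonic_on S u" "open S"
  shows "harmonic_on S (\<lambda>x. a * u x)"
  using harmonic_on_lincomb[OF assms(1) harmonic_on_const[of S 0] assms(2), of a 0] by simp

lemma harmonic_on_cong:
  assumes "harmonic_on S u" "open S" "\<And>x. x \<in> S \<Longrightarrow> u x = v x"
  shows "harmonic_on S v"
proof -
  have "C2_with S v (\<lambda>b. partial_deriv b u) (\<lambda>b c. partial_deriv c (partial_deriv b u))"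
    by (rule C2_with_cong[OF _ assms(2) assms(3)])
      (use assms(1) in \<open>auto simp: harmonic_on_def C_on_2_C2_with\<close>)
  from C2_with_imp_C_on[OF this assms(2)] show ?thesis
    using assms(1) by (simp add: harmonic_on_def laplacian_def)
qed

lemma harmonic_on_local:
  assumes "\<And>x. x \<in> S \<Longrightarrow> \<exists>T. open T \<and> x \<in> T \<and> harmonic_on T u"
  shows "harmonic_on S u"
  using assms C_on_2_local[of S u] unfolding harmonic_on_def by meson

lemma harmonic_on_translate:
  assumes "harmonic_on S u" "\<And>x. x \<in> T \<Longrightarrow> x + z \<in> S"
  shows "harmonic_on T (\<lambda>x. u (x + z))"
proof -
  have "T \<subseteq> (\<lambda>x. x - z) ` S"
    using assms(2) by (force simp: image_iff)
  then show ?thesis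
    using assms C2_translate[of S u z] C_on_2_subset unfolding harmonic_on_def by metis
qed

lemma second_derivative_at_max:
  fixes g :: "real \<Rightarrow> real"
  assumes "0 < \<delta>" "\<And>t. \<bar>t\<bar> < \<delta> \<Longrightarrow> (g has_real_derivative g' t) (at t)"
    and "(g' has_real_derivative l) (at 0)" "\<And>t. \<bar>t\<bar> < \<delta> \<Longrightarrow> g t \<le> g 0"
  shows "l \<le> 0"
proof (rule ccontr)
  assume "\<not> l \<le> 0"
  then obtain d where d: "0 < d" "\<And>h. 0 < h \<Longrightarrow> h < d \<Longrightarrow> g' 0 < g' (0 + h)"
    using DERIV_pos_inc_right[OF assms(3)] by auto
  have "g' 0 = 0"
    using DERIV_local_max[of g "g' 0" 0 \<delta>] assms by auto
  define h where "h = min d \<delta> / 2"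
  have h: "0 < h" "h < d" "h < \<delta>"
    using d(1) assms(1) by (auto simp: h_def)
  obtain \<xi> where \<xi>: "0 < \<xi>" "\<xi> < h" "g h - g 0 = (h - 0) * g' \<xi>"
    using MVT2[of 0 h g g'] assms(2) h by (metis abs_of_nonneg order_le_less_trans)
  moreover have "0 < g' \<xi>"
    using d(2)[of \<xi>] \<xi> h \<open>g' 0 = 0\<close> by simp
  moreover have "g h \<le> g 0"
    using assms(4)[of h] h by simp
  ultimately show False
    using h by (smt (verit) mult_pos_pos)
qed

lemma laplacian_at_max:
  assumes "C_on 2 S u" "open S" "z \<in> S" "\<And>x. x \<in> S \<Longrightarrow> u x \<le> u z"
  shows "laplacian u z \<le> 0"
proof -
  have "partial_deriv b (partial_deriv b u) z \<le> 0" if b: "b \<in> Basis" for b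
  proof -
    obtain \<delta> where \<delta>: "0 < \<delta>" "ball z \<delta> \<subseteq> S"
      using assms open_contains_ball by blast
    have in_S: "z + t *\<^sub>R b \<in> S" if "\<bar>t\<bar> < \<delta>" for t
      using that \<delta> b by (auto simp: dist_norm)
    note C2 = C2_withD[OF assms(1)[unfolded C_on_2_C2_with]]
    show ?thesis
    proof (rule second_derivative_at_max[OF \<delta>(1)])
      show "((\<lambda>t. u (z + t *\<^sub>R b)) has_real_derivative partial_deriv b u (z + t *\<^sub>R b)) (at t)"
        if "\<bar>t\<bar> < \<delta>" for t
        using C2(3)[OF b in_S[OF that]] by (rule has_pd_line)
      show "((\<lambda>t. partial_deriv b u (z + t *\<^sub>R b)) has_real_derivative
          partial_deriv b (partial_deriv b u) z) (at 0)"
        using C2(5)[OF b b assms(3)] by (simp add: has_pd_def)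
    qed (use assms(4) in_S in auto)
  qed
  then show ?thesis
    unfolding laplacian_def by (rule sum_nonpos)
qed

text \<open>
  Adding a small multiple of \<open>\<bar>x\<bar>\<^sup>2\<close> makes the Laplacian strictly
  positive, which is incompatible with an interior maximum.
\<close>

lemma maximum_principle:
  fixes u :: "'a::euclidean_space \<Rightarrow> real"
  assumes "open S" "bounded S" "continuous_on (closure S) u" "C_on 2 S u"
    and "\<And>x. x \<in> S \<Longrightarrow> 0 \<le> laplacian u x" and "\<And>x. x \<in> frontier S \<Longrightarrow> u x \<le> M"
    and "x \<in> S"
  shows "u x \<le> M"
proof (rule ccontr)
  assume "\<not> u x \<le> M"
  obtain R where R: "0 < R" "\<And>y. y \<in> closure S \<Longrightarrow> norm y \<le> R"
    using assms(2) bounded_closure bounded_pos by metis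
  define \<epsilon> where "\<epsilon> = (u x - M) / (2 * R\<^sup>2)"
  have \<epsilon>: "0 < \<epsilon>" "\<epsilon> * R\<^sup>2 < u x - M"
    using \<open>\<not> u x \<le> M\<close> R(1) by (auto simp: \<epsilon>_def)
  define f where "f = (\<lambda>y. 1 * u y + \<epsilon> * (norm (y - 0))\<^sup>2)"
  have "continuous_on (closure S) f"
    unfolding f_def by (intro continuous_intros assms)
  moreover have "compact (closure S)" "closure S \<noteq> {}"
    using assms by (auto simp: compact_closure)
  ultimately obtain z where z: "z \<in> closure S" "\<And>y. y \<in> closure S \<Longrightarrow> f y \<le> f z"
    using continuous_attains_sup by metis
  have "M + \<epsilon> * R\<^sup>2 < f x"
    using \<epsilon> by (simp add: f_def add.commute pos_add_strict) (smt (verit) \<epsilon> zero_le_mult_iff zero_le_power2)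
  also have "f x \<le> f z"
    using z(2) assms(7) closure_subset by blast
  finally have fz: "M + \<epsilon> * R\<^sup>2 < f z" .
  have "z \<in> S"
  proof (rule ccontr)
    assume "z \<notin> S"
    then have "z \<in> frontier S"
      using z(1) assms(1) by (simp add: frontier_def interior_open)
    then have "u z \<le> M"
      using assms(6) by blast
    moreover have "\<epsilon> * (norm z)\<^sup>2 \<le> \<epsilon> * R\<^sup>2"
      using R(2)[OF z(1)] \<epsilon>(1) by (simp add: power_mono)
    ultimately show False
      using fz by (simp add: f_def)
  qed
  have P: "C_on 2 S (\<lambda>y::'a. (norm (y - 0))\<^sup>2)"
    by (rule polynomial_C_on[OF polynomial_norm_power2])
  have "C_on 2 S f"
    unfolding f_def by (rule C2_lincomb(1)[OF assms(4) P assms(1)])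
  then have "laplacian f z \<le> 0"
    using laplacian_at_max[OF _ assms(1) \<open>z \<in> S\<close>] z(2) closure_subset by blast
  moreover have "laplacian f z = 1 * laplacian u z + \<epsilon> * (2 * real DIM('a))"
    unfolding f_def using C2_lincomb(2)[OF assms(4) P assms(1) \<open>z \<in> S\<close>, of 1 \<epsilon>]
      laplacian_norm_power2[of 0 z] by simp
  moreover have "0 < \<epsilon> * (2 * real DIM('a))"
    using \<epsilon>(1) by simp
  ultimately show False
    using assms(5)[OF \<open>z \<in> S\<close>] by simp
qed

lemma comparison_principle:
  assumes "open S" "bounded S" "continuous_on (closure S) u" "continuous_on (closure S) \<psi>"
    and "harmonic_on S u" "C_on 2 S \<psi>" "\<And>x. x \<in> S \<Longrightarrow> laplacian \<psi> x \<le> 0"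
    and "\<And>x. x \<in> frontier S \<Longrightarrow> u x \<le> \<psi> x" and "x \<in> S"
  shows "u x \<le> \<psi> x"
proof -
  have "C_on 2 S u" "\<And>x. x \<in> S \<Longrightarrow> laplacian u x = 0"
    using assms(5) by (auto simp: harmonic_on_def)
  note u = this
  have "1 * u x + (-1) * \<psi> x \<le> 0"
  proof (rule maximum_principle[OF assms(1,2) _ _ _ _ assms(9)])
    show "continuous_on (closure S) (\<lambda>x. 1 * u x + (-1) * \<psi> x)"
      by (intro continuous_on_add continuous_on_mult_left assms)
    show "C_on 2 S (\<lambda>x. 1 * u x + (-1) * \<psi> x)"
      by (rule C2_lincomb(1)[OF u(1) assms(6,1)])
    show "0 \<le> laplacian (\<lambda>x. 1 * u x + (-1) * \<psi> x) x" if "x \<in> S" for x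
      using C2_lincomb(2)[OF u(1) assms(6,1) that, where a=1 and c="-1"] u(2)[OF that] assms(7)[OF that] by simp
  qed (use assms(8) in auto)
  then show ?thesis by simp
qed

lemma harmonic_bound:
  assumes "open S" "bounded S" "continuous_on (closure S) u" "harmonic_on S u"
    and "\<And>x. x \<in> frontier S \<Longrightarrow> \<bar>u x\<bar> \<le> M" "x \<in> closure S"
  shows "\<bar>u x\<bar> \<le> M"
proof (cases "x \<in> S")
  case True
  have "u x \<le> M"
    using assms(5) by (intro maximum_principle[OF assms(1-3) _ _ _ True])
      (use assms(4) in \<open>auto simp: harmonic_on_def abs_le_iff\<close>)
  moreover have H: "harmonic_on S (\<lambda>x. (-1) * u x)"
    by (rule harmonic_on_cmult[OF assms(4,1)])
  have "(-1) * u x \<le> M"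
    by (rule maximum_principle[OF assms(1,2) _ _ _ _ True])
      (use assms(3,5) H in \<open>auto simp: harmonic_on_def abs_le_iff intro!: continuous_intros\<close>)
  ultimately show ?thesis by auto
next
  case False
  then show ?thesis
    using assms by (auto simp: frontier_def interior_open)
qed

definition reflect :: "'a::euclidean_space \<Rightarrow> 'a \<Rightarrow> 'a \<Rightarrow> 'a"
  where "reflect b z x = x - (2 * ((x - z) \<bullet> b)) *\<^sub>R b"

lemma continuous_reflect: "continuous_on S (reflect b z)"
  unfolding reflect_def by (intro continuous_intros)

lemma has_pd_reflect:
  assumes "b \<in> Basis" "c \<in> Basis" "has_pd c u (reflect b z x) d"
  shows "has_pd c (\<lambda>x. u (reflect b z x)) x ((if c = b then - 1 else 1) * d)"
proof -
  have "reflect b z (x + t *\<^sub>R c) = reflect b z x + ((if c = b then - 1 else 1) * t) *\<^sub>R c" for t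
    using assms(1,2) by (auto simp: reflect_def inner_simps inner_Basis algebra_simps scaleR_2 simp flip: scaleR_scaleR)
  moreover have "((\<lambda>t. u (reflect b z x + (- t) *\<^sub>R c)) has_real_derivative - d) (at 0)"
    using assms(3) DERIV_mirror[of "\<lambda>t. u (reflect b z x + t *\<^sub>R c)" d 0]
    by (simp add: has_pd_def)
  ultimately show ?thesis
    using assms(3) by (auto simp: has_pd_def)
qed

lemma harmonic_on_reflect:
  assumes "harmonic_on S u" "b \<in> Basis" "open T" "\<And>x. x \<in> T \<Longrightarrow> reflect b z x \<in> S"
  shows "harmonic_on T (\<lambda>x. u (reflect b z x))"
proof -
  define s where "s = (\<lambda>c. if c = b then - 1 else 1 :: real)"
  have ss: "s c * (s c * a) = a" for c a
    by (simp add: s_def)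
  note C2 = C2_withD[OF assms(1)[unfolded harmonic_on_def C_on_2_C2_with, THEN conjunct1]]
  have co: "continuous_on T (\<lambda>x. a * f (reflect b z x))" if "continuous_on S f" for a and f :: "'a \<Rightarrow> real"
    by (intro continuous_on_mult_left continuous_on_compose2[OF that continuous_reflect])
      (use assms(4) in auto)
  have "C2_with T (\<lambda>x. u (reflect b z x)) (\<lambda>c x. s c * partial_deriv c u (reflect b z x))
      (\<lambda>c c' x. s c * (s c' * partial_deriv c' (partial_deriv c u) (reflect b z x)))"
  proof (rule C2_withI)
    show "continuous_on T (\<lambda>x. u (reflect b z x))"
      using co[OF C2(1), of 1] by simp
    fix c :: 'a assume c: "c \<in> Basis"
    show "continuous_on T (\<lambda>x. s c * partial_deriv c u (reflect b z x))"
      by (rule co[OF C2(2)[OF c]])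
    show "has_pd c (\<lambda>x. u (reflect b z x)) x (s c * partial_deriv c u (reflect b z x))"
      if "x \<in> T" for x
      unfolding s_def by (rule has_pd_reflect[OF assms(2) c C2(3)[OF c assms(4)[OF that]]])
    fix c' :: 'a assume c': "c' \<in> Basis"
    show "continuous_on T (\<lambda>x. s c * (s c' * partial_deriv c' (partial_deriv c u) (reflect b z x)))"
      by (intro continuous_on_mult_left co[OF C2(4)[OF c c']])
    show "has_pd c' (\<lambda>x. s c * partial_deriv c u (reflect b z x)) x
        (s c * (s c' * partial_deriv c' (partial_deriv c u) (reflect b z x)))" if "x \<in> T" for x
      by (rule has_pd_cmult)
        (unfold s_def, rule has_pd_reflect[OF assms(2) c' C2(5)[OF c c' assms(4)[OF that]]])
  qed
  from C2_with_imp_C_on[OF this assms(3)] show ?thesis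
    using assms(1,4) by (auto simp: harmonic_on_def laplacian_def ss)
qed

definition cube :: "'a::euclidean_space \<Rightarrow> real \<Rightarrow> 'a set"
  where "cube z d = {x. \<forall>c\<in>Basis. \<bar>(x - z) \<bullet> c\<bar> \<le> d}"

lemma cube_subset_cball: "cube z d \<subseteq> cball (z::'a::euclidean_space) (real DIM('a) * d)"
proof
  fix x assume "x \<in> cube z d"
  then have "(\<Sum>c\<in>Basis. \<bar>(x - z) \<bullet> c\<bar>) \<le> real DIM('a) * d"
    by (intro sum_bounded_above) (auto simp: cube_def)
  then show "x \<in> cball z (real DIM('a) * d)"
    using norm_le_l1[of "x - z"] by (simp add: dist_norm norm_minus_commute)
qed

text \<open>
  A harmonic function minus its reflection vanishes on the hyperplane of reflection. On the half
  cube above it this difference is dominated by \<open>2M/d\<^sup>2 (\<bar>x - z\<bar>\<^sup>2 + N d y - N y\<^sup>2)\<close>, where \<open>y\<close>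
  is the distance to the hyperplane: this function is harmonic in dimension \<open>N\<close>, is nonnegative
  where \<open>y = 0\<close> and at least \<open>2M\<close> on the other faces, and on the normal through \<open>z\<close>
  it is at most linear in \<open>y\<close>.
\<close>

lemma symmetric_difference_upper:
  fixes u :: "'a::euclidean_space \<Rightarrow> real"
  assumes u: "harmonic_on S u" "open S" "cube z d \<subseteq> S" and M: "\<And>x. x \<in> cube z d \<Longrightarrow> \<bar>u x\<bar> \<le> M"
    and b: "b \<in> Basis" and t: "0 \<le> t" "t \<le> d" and d: "0 < d"
  shows "u (z + t *\<^sub>R b) - u (z - t *\<^sub>R b) \<le> 2 * M * real DIM('a) * t / d"
proof -
  define N where "N = real DIM('a)"
  have N: "1 \<le> N"
    unfolding N_def using DIM_positive[where 'a='a] by linarith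
  have "z \<in> cube z d"
    using d by (auto simp: cube_def)
  then have M0: "0 \<le> M"
    using M by force
  have line: "z + s *\<^sub>R b \<in> cube z d" if "\<bar>s\<bar> \<le> d" for s
    using that d b by (auto simp: cube_def inner_Basis)
  consider "t = 0" | "t = d" | "0 < t" "t < d"
    using t by linarith
  then show ?thesis
  proof cases
    case 1
    then show ?thesis by simp
  next
    case 2
    have "u (z + t *\<^sub>R b) - u (z - t *\<^sub>R b) \<le> 2 * M * 1"
      using M[OF line[of t]] M[OF line[of "-t"]] t by auto
    also have "\<dots> \<le> 2 * M * N"
      using M0 N by (intro mult_left_mono) auto
    finally show ?thesis
      using 2 d by (simp add: N_def)
  next
    case 3
    define G where "G = {x. \<forall>c\<in>Basis. \<bar>(x - z) \<bullet> c\<bar> < d} \<inter> {x. 0 < (x - z) \<bullet> b}"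
    define Q where "Q = cube z d \<inter> {x. 0 \<le> (x - z) \<bullet> b}"
    have "G = (\<Inter>c\<in>Basis. {x. \<bar>(x - z) \<bullet> c\<bar> < d}) \<inter> {x. 0 < (x - z) \<bullet> b}"
      by (auto simp: G_def)
    then have "open G"
      by (auto intro!: open_INT open_Collect_less continuous_intros)
    have "closed Q"
    proof -
      have "Q = (\<Inter>c\<in>Basis. {x. \<bar>(x - z) \<bullet> c\<bar> \<le> d}) \<inter> {x. 0 \<le> (x - z) \<bullet> b}"
        by (auto simp: Q_def cube_def)
      then show ?thesis
        by (auto intro!: closed_INT closed_Collect_le continuous_intros)
    qed
    moreover have GQ: "G \<subseteq> Q"
      by (auto simp: G_def Q_def cube_def less_imp_le)
    ultimately have clG: "closure G \<subseteq> Q"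
      by (rule closure_minimal[rotated])
    have QS: "Q \<subseteq> S"
      using u(3) by (auto simp: Q_def)
    have refl_cube: "reflect b z x \<in> cube z d" if "x \<in> cube z d" for x
      using that b by (auto simp: reflect_def cube_def inner_simps inner_Basis algebra_simps)
    have refl_line: "reflect b z (z + t *\<^sub>R b) = z - t *\<^sub>R b"
    proof -
      have "(2 * ((z + t *\<^sub>R b - z) \<bullet> b)) *\<^sub>R b = t *\<^sub>R b + t *\<^sub>R b"
        using b by (simp flip: scaleR_left.add)
      then show ?thesis
        by (simp add: reflect_def)
    qed
    have "bounded G"
      using GQ cube_subset_cball[of z d] bounded_cball bounded_subset by (metis Q_def inf_le1 order_trans)
    have "continuous_on S u"
      using u(1) C_on_2_continuous by (auto simp: harmonic_on_def)
    define \<phi> where "\<phi> = (\<lambda>x. u x - u (reflect b z x))"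
    define \<psi> where "\<psi> = (\<lambda>x. (2 * M / d\<^sup>2) * ((norm (x - z))\<^sup>2
        + N * (d * (x \<bullet> b - z \<bullet> b) - (x \<bullet> b - z \<bullet> b) * (x \<bullet> b - z \<bullet> b))))"
    have poly: "real_polynomial_function (\<lambda>x. N * (d * (x \<bullet> b - z \<bullet> b) - (x \<bullet> b - z \<bullet> b) * (x \<bullet> b - z \<bullet> b)))"
      by (intro real_polynomial_function.intros real_polynomial_function_diff polynomial_coord)
    have "real_polynomial_function \<psi>"
      unfolding \<psi>_def by (intro real_polynomial_function.intros polynomial_norm_power2 poly)
    have "laplacian \<psi> x = 0" for x
    proof -
      have "partial_deriv c (partial_deriv c \<psi>) x = (2 * M / d\<^sup>2) * (2 - N * (2 * (c \<bullet> b)\<^sup>2))"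
        if "c \<in> Basis" for c
      proof -
        have 1: "partial_deriv c \<psi> = (\<lambda>x. (2 * M / d\<^sup>2) * (2 * ((x - z) \<bullet> c)
            + N * (d * (c \<bullet> b) - 2 * (c \<bullet> b) * (x \<bullet> b - z \<bullet> b))))"
          unfolding \<psi>_def
          by (rule ext, rule partial_deriv_eqI[OF has_pd_cmult], rule has_pd_add[OF has_pd_norm_power2 has_pd_cmult])
            (rule has_pd_eqI[OF has_pd_diff[OF has_pd_cmult[OF has_pd_shifted_coord]
              has_pd_mult[OF has_pd_shifted_coord has_pd_shifted_coord]]], simp add: algebra_simps)
        show ?thesis
          unfolding 1 using that
          by (intro partial_deriv_eqI has_pd_eqI[OF has_pd_cmult[OF has_pd_add[OF
              has_pd_cmult[OF has_pd_shifted_coord'] has_pd_cmult[OF has_pd_diff[OF has_pd_const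
              has_pd_cmult[OF has_pd_shifted_coord]]]]]])
            (auto simp: power2_eq_square)
      qed
      then have "laplacian \<psi> x = (\<Sum>c\<in>Basis. (2 * M / d\<^sup>2) * (2 - N * (2 * (c \<bullet> b)\<^sup>2)))"
        unfolding laplacian_def by (intro sum.cong) auto
      also have "\<dots> = (2 * M / d\<^sup>2) * (2 * N - N * (2 * (\<Sum>c\<in>Basis. (c \<bullet> b)\<^sup>2)))"
        by (simp only: sum_distrib_left[symmetric] sum_subtractf sum_constant N_def) (simp add: mult.commute)
      also have "(\<Sum>c\<in>Basis. (c \<bullet> b)\<^sup>2) = 1"
      proof -
        have "(\<Sum>c\<in>Basis. (c \<bullet> b)\<^sup>2) = (\<Sum>c\<in>Basis. if c = b then 1 else 0)"
          using b by (intro sum.cong) (auto simp: inner_Basis)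
        then show ?thesis
          using b by simp
      qed
      finally show ?thesis by simp
    qed
    have "\<phi> (z + t *\<^sub>R b) \<le> \<psi> (z + t *\<^sub>R b)"
    proof (rule comparison_principle[OF \<open>open G\<close> \<open>bounded G\<close>])
      show "continuous_on (closure G) \<phi>"
        unfolding \<phi>_def using clG QS u(3) refl_cube
        by (intro continuous_on_diff continuous_on_subset[OF \<open>continuous_on S u\<close>]
            continuous_on_compose2[OF \<open>continuous_on S u\<close> continuous_reflect]) (auto simp: Q_def)
      show "harmonic_on G \<phi>"
        unfolding \<phi>_def using GQ QS u(3) refl_cube
        by (intro harmonic_on_diff harmonic_on_reflect[OF u(1) b] harmonic_on_subset[OF u(1)] \<open>open G\<close>)
          (auto simp: Q_def)
      show "\<phi> x \<le> \<psi> x" if "x \<in> frontier G" for x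
      proof -
        define y where "y = x \<bullet> b - z \<bullet> b"
        have x: "x \<in> Q" "x \<notin> G"
          using that clG \<open>open G\<close> by (auto simp: frontier_def interior_open)
        have y: "0 \<le> y" "y \<le> d"
          using x(1) b by (auto simp: Q_def cube_def y_def inner_simps)
        have \<psi>x: "\<psi> x = (2 * M / d\<^sup>2) * ((norm (x - z))\<^sup>2 + N * (y * (d - y)))"
          by (simp add: \<psi>_def y_def algebra_simps)
        have Ny: "0 \<le> N * (y * (d - y))"
          using y N by simp
        show ?thesis
        proof (cases "y = 0")
          case True
          then have "reflect b z x = x"
            by (simp add: reflect_def y_def inner_simps)
          then show ?thesis
            using Ny M0 by (simp add: \<phi>_def \<psi>x)
        next
          case False
          then obtain c where c: "c \<in> Basis" "\<bar>(x - z) \<bullet> c\<bar> = d"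
            using x y unfolding Q_def G_def cube_def y_def
            by (auto simp: inner_simps)
          then have "d\<^sup>2 \<le> (norm (x - z))\<^sup>2"
            using Basis_le_norm[OF c(1), of "x - z"] d by (simp add: power_mono)
          then have "2 * M / d\<^sup>2 * d\<^sup>2 \<le> \<psi> x"
            unfolding \<psi>x using Ny M0 by (intro mult_left_mono) auto
          moreover have "\<phi> x \<le> 2 * M"
            using M[of x] M[OF refl_cube[of x]] x(1) by (auto simp: \<phi>_def Q_def)
          ultimately show ?thesis
            using d by simp
        qed
      qed
      show "z + t *\<^sub>R b \<in> G"
        using 3 b d by (auto simp: G_def inner_Basis)
    qed (use \<open>real_polynomial_function \<psi>\<close> \<open>\<And>x. laplacian \<psi> x = 0\<close>
        in \<open>auto intro: polynomial_C_on polynomial_continuous\<close>)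
    also have "\<psi> (z + t *\<^sub>R b) = (2 * M / d\<^sup>2) * (N * d * t - (N - 1) * t\<^sup>2)"
    proof -
      have "(z + t *\<^sub>R b) \<bullet> b - z \<bullet> b = t" "(norm ((z + t *\<^sub>R b) - z))\<^sup>2 = t\<^sup>2"
        using b by (simp_all add: inner_simps)
      then have "\<psi> (z + t *\<^sub>R b) = (2 * M / d\<^sup>2) * (t\<^sup>2 + N * (d * t - t * t))"
        unfolding \<psi>_def by (simp only:)
      moreover have "t\<^sup>2 + N * (d * t - t * t) = N * d * t - (N - 1) * t\<^sup>2"
        by (simp add: algebra_simps power2_eq_square)
      ultimately show ?thesis
        by (simp only:)
    qed
    also have "\<dots> \<le> (2 * M / d\<^sup>2) * (N * d * t)"
      using M0 N by (intro mult_left_mono) auto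
    also have "\<dots> = 2 * M * N * t / d"
      using d by (simp add: power2_eq_square)
    finally show ?thesis
      unfolding \<phi>_def refl_line N_def .
  qed
qed

lemma symmetric_difference_bound:
  fixes u :: "'a::euclidean_space \<Rightarrow> real"
  assumes u: "harmonic_on S u" "open S" "cube z d \<subseteq> S" and M: "\<And>x. x \<in> cube z d \<Longrightarrow> \<bar>u x\<bar> \<le> M"
    and b: "b \<in> Basis" and t: "\<bar>t\<bar> \<le> d" and d: "0 < d"
  shows "\<bar>u (z + t *\<^sub>R b) - u (z - t *\<^sub>R b)\<bar> \<le> 2 * M * real DIM('a) * \<bar>t\<bar> / d"
proof -
  have "u (z + \<bar>t\<bar> *\<^sub>R b) - u (z - \<bar>t\<bar> *\<^sub>R b) \<le> 2 * M * real DIM('a) * \<bar>t\<bar> / d"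
    by (rule symmetric_difference_upper[OF u M b _ t d]) auto
  moreover have "(-1) * u (z + \<bar>t\<bar> *\<^sub>R b) - (-1) * u (z - \<bar>t\<bar> *\<^sub>R b) \<le> 2 * M * real DIM('a) * \<bar>t\<bar> / d"
    by (rule symmetric_difference_upper[OF harmonic_on_cmult[OF u(1,2)] u(2,3) _ b _ t d])
      (use M in auto)
  ultimately show ?thesis
    by (cases "0 \<le> t") (auto simp: abs_if)
qed

lemma has_pd_symmetric_bound:
  fixes d :: real
  assumes D: "has_pd b u z D" and d: "0 < d"
    and le: "\<And>t. \<bar>t\<bar> < d \<Longrightarrow> \<bar>u (z + t *\<^sub>R b) - u (z - t *\<^sub>R b)\<bar> \<le> 2 * K * \<bar>t\<bar>"
  shows "\<bar>D\<bar> \<le> K"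
proof -
  define g where "g = (\<lambda>t. u (z + t *\<^sub>R b) - u (z + (- t) *\<^sub>R b))"
  have "(g has_real_derivative D - - D) (at 0)"
    unfolding g_def using D[unfolded has_pd_def] DERIV_mirror[of "\<lambda>t. u (z + t *\<^sub>R b)" D 0]
    by (intro DERIV_diff) auto
  then have "((\<lambda>t. \<bar>g t / t\<bar>) \<longlongrightarrow> \<bar>2 * D\<bar>) (at 0)"
    by (intro tendsto_rabs) (auto simp: DERIV_def g_def)
  moreover have "\<forall>\<^sub>F t in at 0. \<bar>g t / t\<bar> \<le> 2 * K"
    unfolding eventually_at
  proof (intro exI conjI ballI impI)
    fix t :: real assume t: "t \<noteq> 0 \<and> dist t 0 < d"
    then show "\<bar>g t / t\<bar> \<le> 2 * K"
      using le[of t] by (simp add: g_def field_simps)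
  qed (rule d)
  ultimately have "\<bar>2 * D\<bar> \<le> 2 * K"
    by (rule tendsto_upperbound) simp
  then show ?thesis
    by simp
qed

lemma harmonic_partial_deriv_bound:
  fixes u :: "'a::euclidean_space \<Rightarrow> real"
  assumes u: "harmonic_on S u" "open S" "cube z d \<subseteq> S" and M: "\<And>x. x \<in> cube z d \<Longrightarrow> \<bar>u x\<bar> \<le> M"
    and b: "b \<in> Basis" and d: "0 < d"
  shows "\<bar>partial_deriv b u z\<bar> \<le> M * real DIM('a) / d"
proof (rule has_pd_symmetric_bound[OF _ d])
  have "z \<in> S"
    using u(3) d by (auto simp: cube_def)
  then show "has_pd b u z (partial_deriv b u z)"
    using C_on_2_has_pd u(1) b unfolding harmonic_on_def by blast
  show "\<bar>u (z + t *\<^sub>R b) - u (z - t *\<^sub>R b)\<bar> \<le> 2 * (M * real DIM('a) / d) * \<bar>t\<bar>" if "\<bar>t\<bar> < d" for t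
    using symmetric_difference_bound[OF u M b _ d, of t] that by simp
qed

text \<open>
  Two points are joined by segments parallel to the axes; on each segment the symmetric difference
  estimate applies about its midpoint. The factor \<open>8\<close> keeps the cubes involved inside the ball.
\<close>

lemma harmonic_Lipschitz:
  fixes u :: "'a::euclidean_space \<Rightarrow> real"
  assumes u: "harmonic_on (ball z r) u" and M: "\<And>x. x \<in> ball z r \<Longrightarrow> \<bar>u x\<bar> \<le> M" and r: "0 < r"
    and xy: "x \<in> cball z (r/4)" "y \<in> cball z (r/4)" "norm (x - y) \<le> r / (8 * real DIM('a))"
  shows "\<bar>u x - u y\<bar> \<le> 8 * M * real DIM('a) ^ 3 / r * norm (x - y)"
proof -
  define N where "N = real DIM('a)"
  have N: "1 \<le> N"
    unfolding N_def using DIM_positive[where 'a='a] by linarith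
  have M0: "0 \<le> M"
    using M[of z] r by force
  define P where "P = (\<lambda>A. y + (\<Sum>c\<in>A. ((x - y) \<bullet> c) *\<^sub>R c))"
  define L where "L = 8 * M * N\<^sup>2 / r"
  have step: "\<bar>u (P (insert b A)) - u (P A)\<bar> \<le> L * norm (x - y)"
    if "A \<subseteq> Basis" "b \<in> Basis" "b \<notin> A" for A b
  proof -
    define s where "s = (x - y) \<bullet> b"
    define m where "m = P A + (s/2) *\<^sub>R b"
    have s: "\<bar>s\<bar> \<le> norm (x - y)"
      unfolding s_def using that(2) by (rule Basis_le_norm)
    have fin: "finite A"
      by (rule finite_subset[OF that(1) finite_Basis])
    have "P (insert b A) = P A + s *\<^sub>R b"
      unfolding P_def s_def sum.insert[OF fin that(3)] by (simp only: ac_simps)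
    moreover have "s *\<^sub>R b = (s/2) *\<^sub>R b + (s/2) *\<^sub>R b"
      by (simp flip: scaleR_left.add)
    ultimately have ends: "P (insert b A) = m + (s/2) *\<^sub>R b" "P A = m - (s/2) *\<^sub>R b"
      by (simp_all add: m_def)
    have "m - y = (\<Sum>c\<in>A. ((x - y) \<bullet> c) *\<^sub>R c) + (s/2) *\<^sub>R b"
      by (simp add: m_def P_def)
    then have "norm (m - y) \<le> norm (\<Sum>c\<in>A. ((x - y) \<bullet> c) *\<^sub>R c) + norm ((s/2) *\<^sub>R b)"
      by (simp only: norm_triangle_ineq)
    also have "\<dots> \<le> (\<Sum>c\<in>A. norm (((x - y) \<bullet> c) *\<^sub>R c)) + norm ((s/2) *\<^sub>R b)"
      by (intro add_right_mono norm_sum)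
    also have "(\<Sum>c\<in>A. norm (((x - y) \<bullet> c) *\<^sub>R c)) \<le> (\<Sum>c\<in>A. norm (x - y))"
      using that(1) by (intro sum_mono) (auto simp: Basis_le_norm subset_iff)
    also have "(\<Sum>c\<in>A. norm (x - y)) + norm ((s/2) *\<^sub>R b) \<le> (\<Sum>c\<in>insert b A. norm (x - y))"
      using fin that s by (simp add: algebra_simps)
    also have "\<dots> \<le> N * norm (x - y)"
      unfolding N_def using that
      by (simp add: mult_right_mono card_mono del: card_insert_disjoint)
    also have "\<dots> \<le> N * (r / (8 * N))"
      using xy(3) N by (intro mult_left_mono) (auto simp: N_def)
    finally have my: "norm (m - y) \<le> r / 8"
      using N by simp
    have "cube m (r / (8 * N)) \<subseteq> cball m (N * (r / (8 * N)))"
      unfolding N_def by (rule cube_subset_cball)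
    also have "\<dots> = cball m (r/8)"
      using N by simp
    also have "\<dots> \<subseteq> ball z r"
    proof
      fix p assume "p \<in> cball m (r/8)"
      then have "dist z p \<le> r/4 + r/8 + r/8"
        using my xy(2) dist_triangle[of z p m] dist_triangle[of z m y]
        by (auto simp: dist_norm norm_minus_commute)
      then show "p \<in> ball z r"
        using r by simp
    qed
    finally have Q: "cube m (r / (8 * N)) \<subseteq> ball z r" .
    have "\<bar>u (P (insert b A)) - u (P A)\<bar> \<le> 2 * M * real DIM('a) * \<bar>s/2\<bar> / (r / (8 * N))"
      unfolding ends
    proof (rule symmetric_difference_bound[OF u open_ball Q _ that(2)])
      show "\<bar>s / 2\<bar> \<le> r / (8 * N)"
        using s xy(3) by (auto simp: N_def)
    qed (use M Q r N in auto)
    also have "\<dots> = L * \<bar>s\<bar>"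
      using N r by (simp add: L_def N_def power2_eq_square)
    also have "\<dots> \<le> L * norm (x - y)"
      using s M0 r N by (intro mult_left_mono) (auto simp: L_def)
    finally show ?thesis .
  qed
  have "\<bar>u (P A) - u y\<bar> \<le> card A * (L * norm (x - y))" if "A \<subseteq> Basis" for A
  proof -
    have "finite A"
      by (rule finite_subset[OF that finite_Basis])
    then show ?thesis
      using that
    proof (induction A)
      case empty
      then show ?case by (simp add: P_def)
    next
      case (insert b A)
      then show ?case
        using step[of A b] by (simp add: algebra_simps)
    qed
  qed
  from this[of Basis] have "\<bar>u (P Basis) - u y\<bar> \<le> N * (L * norm (x - y))"
    by (simp add: N_def)
  moreover have "P Basis = x"
    by (simp add: P_def euclidean_representation)
  ultimately show ?thesis
    by (simp add: L_def N_def power2_eq_square power3_eq_cube mult_ac)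
qed

section \<open>The Dirichlet problem on a ball\<close>

subsection \<open>Homogeneous harmonic polynomials\<close>

definition harmonic_poly :: "('a::euclidean_space \<Rightarrow> real) \<Rightarrow> bool"
  where "harmonic_poly p \<longleftrightarrow> real_polynomial_function p \<and> (\<forall>x. laplacian p x = 0)"

text \<open>
  Homogeneity of degree \<open>m\<close> expressed by Euler's identity. In this form it is inherited by products
  and derivatives through the product rule and the symmetry of second derivatives. The degree is
  real because the derivative of a constant formally has degree \<open>- 1\<close>.
\<close>

definition euler_degree :: "real \<Rightarrow> ('a::euclidean_space \<Rightarrow> real) \<Rightarrow> bool"
  where "euler_degree m p \<longleftrightarrow> (\<forall>x. (\<Sum>c\<in>Basis. (x \<bullet> c) * partial_deriv c p x) = m * p x)"

lemma harmonic_poly_harmonic_on: "harmonic_poly p \<Longrightarrow> harmonic_on S p"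
  by (simp add: harmonic_poly_def harmonic_on_def polynomial_C_on)

lemma laplacian_add:
  assumes "real_polynomial_function p" "real_polynomial_function q"
  shows "laplacian (\<lambda>x. p x + q x) x = laplacian p x + laplacian q x"
  using assms by (simp add: laplacian_def partial_deriv_arith polynomial_partial_deriv sum.distrib)

lemma laplacian_cmult:
  assumes "real_polynomial_function p"
  shows "laplacian (\<lambda>x. a * p x) x = a * laplacian p x"
  using assms
  by (simp add: laplacian_def partial_deriv_cmult polynomial_partial_deriv sum_distrib_left)

lemma laplacian_const: "laplacian (\<lambda>x. c) x = 0"
  by (simp add: laplacian_def partial_deriv_const)

lemma laplacian_mult:
  assumes "real_polynomial_function p" "real_polynomial_function q"
  shows "laplacian (\<lambda>x. p x * q x) x =
    laplacian p x * q x + 2 * (\<Sum>c\<in>Basis. partial_deriv c p x * partial_deriv c q x) + p x * laplacian q x"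
proof -
  have "partial_deriv c (partial_deriv c (\<lambda>x. p x * q x)) x =
      partial_deriv c (partial_deriv c p) x * q x + 2 * (partial_deriv c p x * partial_deriv c q x)
        + p x * partial_deriv c (partial_deriv c q) x" for c
    using assms by (simp add: partial_deriv_arith polynomial_partial_deriv real_polynomial_function.intros)
  then show ?thesis
    by (simp add: laplacian_def sum.distrib sum_distrib_left sum_distrib_right)
qed

lemma harmonic_poly_add:
  "harmonic_poly p \<Longrightarrow> harmonic_poly q \<Longrightarrow> harmonic_poly (\<lambda>x. p x + q x)"
  by (auto simp: harmonic_poly_def laplacian_add)

lemma harmonic_poly_cmult: "harmonic_poly p \<Longrightarrow> harmonic_poly (\<lambda>x. a * p x)"
  by (auto simp: harmonic_poly_def laplacian_cmult)

lemma harmonic_poly_partial_deriv: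
  assumes "harmonic_poly p" shows "harmonic_poly (partial_deriv b p)"
proof -
  have p: "real_polynomial_function p" "laplacian p = (\<lambda>x. 0)"
    using assms by (auto simp: harmonic_poly_def)
  have "partial_deriv c (partial_deriv c (partial_deriv b p)) =
      partial_deriv b (partial_deriv c (partial_deriv c p))" for c
    by (simp add: partial_deriv_commute p(1) polynomial_partial_deriv)
  then have "laplacian (partial_deriv b p) = partial_deriv b (laplacian p)"
    using p(1) by (simp add: laplacian_def[abs_def] partial_deriv_sum polynomial_partial_deriv)
  then show ?thesis
    using p by (simp add: harmonic_poly_def polynomial_partial_deriv partial_deriv_const)
qed

lemma euler_degree_mult:
  assumes "real_polynomial_function p" "real_polynomial_function q" "euler_degree k p" "euler_degree m q"
  shows "euler_degree (k + m) (\<lambda>x. p x * q x)"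
  unfolding euler_degree_def
proof
  fix x
  have "(\<Sum>c\<in>Basis. (x \<bullet> c) * partial_deriv c (\<lambda>x. p x * q x) x) =
      (\<Sum>c\<in>Basis. (x \<bullet> c) * partial_deriv c p x) * q x + p x * (\<Sum>c\<in>Basis. (x \<bullet> c) * partial_deriv c q x)"
    using assms by (simp add: partial_deriv_arith sum.distrib sum_distrib_left sum_distrib_right algebra_simps)
  then show "(\<Sum>c\<in>Basis. (x \<bullet> c) * partial_deriv c (\<lambda>x. p x * q x) x) = (k + m) * (p x * q x)"
    using assms(3,4) by (simp add: euler_degree_def algebra_simps)
qed

lemma euler_degree_lincomb:
  assumes "real_polynomial_function p" "real_polynomial_function q" "euler_degree m p" "euler_degree m q"
  shows "euler_degree m (\<lambda>x. p x + a * q x)"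
  unfolding euler_degree_def
proof
  fix x
  have "(\<Sum>c\<in>Basis. (x \<bullet> c) * partial_deriv c (\<lambda>x. p x + a * q x) x) =
      (\<Sum>c\<in>Basis. (x \<bullet> c) * partial_deriv c p x) + a * (\<Sum>c\<in>Basis. (x \<bullet> c) * partial_deriv c q x)"
    using assms(1,2) real_polynomial_function.intros(4)[OF real_polynomial_function.intros(2) assms(2), of a]
    by (simp add: partial_deriv_arith(1) partial_deriv_cmult sum.distrib sum_distrib_left algebra_simps)
  then show "(\<Sum>c\<in>Basis. (x \<bullet> c) * partial_deriv c (\<lambda>x. p x + a * q x) x) = m * (p x + a * q x)"
    using assms(3,4) by (simp add: euler_degree_def algebra_simps)
qed

lemma euler_degree_coord:
  assumes "b \<in> Basis" shows "euler_degree 1 (\<lambda>x. x \<bullet> b)"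
  using assms by (simp add: euler_degree_def partial_deriv_coord inner_Basis if_distrib cong: if_cong)

lemma euler_degree_norm_power2: "euler_degree 2 (\<lambda>x. (norm (x - 0))\<^sup>2)"
proof -
  have "(\<Sum>c\<in>Basis. (x \<bullet> c) * (2 * ((x - 0) \<bullet> c))) = 2 * (norm (x - 0))\<^sup>2" for x :: 'a
    unfolding power2_norm_eq_inner by (subst (3) euclidean_inner) (simp add: sum_distrib_left algebra_simps)
  then show ?thesis
    unfolding euler_degree_def partial_deriv_norm_power2 by blast
qed

lemma euler_degree_partial_deriv:
  assumes "real_polynomial_function p" "euler_degree m p" "b \<in> Basis"
  shows "euler_degree (m - 1) (partial_deriv b p)"
  unfolding euler_degree_def
proof
  fix x
  have poly: "real_polynomial_function (\<lambda>x. (x \<bullet> c) * partial_deriv c p x)" for c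
    by (intro real_polynomial_function.intros(4) polynomial_coord polynomial_partial_deriv assms)
  have "(\<lambda>x. \<Sum>c\<in>Basis. (x \<bullet> c) * partial_deriv c p x) = (\<lambda>x. m * p x)"
    using assms(2) by (auto simp: euler_degree_def)
  then have "partial_deriv b (\<lambda>x. \<Sum>c\<in>Basis. (x \<bullet> c) * partial_deriv c p x) x = m * partial_deriv b p x"
    by (simp only: partial_deriv_cmult[OF assms(1)])
  moreover have "partial_deriv b (\<lambda>x. \<Sum>c\<in>Basis. (x \<bullet> c) * partial_deriv c p x) x =
      (\<Sum>c\<in>Basis. (b \<bullet> c) * partial_deriv c p x) + (\<Sum>c\<in>Basis. (x \<bullet> c) * partial_deriv c (partial_deriv b p) x)"
    using poly by (simp add: partial_deriv_sum partial_deriv_arith(3) polynomial_coord polynomial_partial_deriv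
        assms(1) partial_deriv_coord sum.distrib partial_deriv_commute[OF assms(1), of b])
  moreover have "(\<Sum>c\<in>Basis. (b \<bullet> c) * partial_deriv c p x) = partial_deriv b p x"
    using assms(3) by (simp add: inner_Basis if_distrib if_distribR cong: if_cong)
  ultimately show "(\<Sum>c\<in>Basis. (x \<bullet> c) * partial_deriv c (partial_deriv b p) x) = (m - 1) * partial_deriv b p x"
    by (simp add: algebra_simps)
qed

lemma polynomial_ray_derivative:
  assumes "real_polynomial_function p"
  shows "((\<lambda>t. p (t *\<^sub>R x)) has_real_derivative (\<Sum>c\<in>Basis. (x \<bullet> c) * partial_deriv c p (t *\<^sub>R x))) (at t)"
  using assms
proof induction
  case (linear f)
  then interpret bounded_linear f by simp
  have "(\<Sum>c\<in>Basis. (x \<bullet> c) * f c) = f (\<Sum>c\<in>Basis. (x \<bullet> c) *\<^sub>R c)"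
    by (simp only: sum scaleR real_scaleR_def)
  then show ?case
    unfolding partial_deriv_linear[OF bounded_linear_axioms] euclidean_representation scaleR
    by (auto intro!: derivative_eq_intros)
next
  case (const c)
  then show ?case
    by (simp add: partial_deriv_const)
next
  case (add f g)
  from DERIV_add[OF add.IH] show ?case
    by (simp add: partial_deriv_arith add.hyps sum.distrib distrib_left)
next
  case (mult f g)
  from DERIV_mult[OF mult.IH] show ?case
    by (simp add: partial_deriv_arith mult.hyps sum.distrib distrib_left sum_distrib_left
        sum_distrib_right mult_ac)
qed

lemma euler_degree_0_const:
  assumes "real_polynomial_function p" "euler_degree 0 p" shows "p = (\<lambda>x. p 0)"
proof
  fix x
  have "p (1 *\<^sub>R x) = p (0 *\<^sub>R x)"
  proof (rule DERIV_isconst_end[of 0 1 "\<lambda>t. p (t *\<^sub>R x)"])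
    note D = polynomial_ray_derivative[OF assms(1), of x]
    show "continuous_on {0..1} (\<lambda>t. p (t *\<^sub>R x))"
      by (intro DERIV_atLeastAtMost_imp_continuous_on) (use D in blast)
    fix t :: real assume "0 < t"
    have "t * (\<Sum>c\<in>Basis. (x \<bullet> c) * partial_deriv c p (t *\<^sub>R x)) = 0"
      using assms(2)[unfolded euler_degree_def, rule_format, of "t *\<^sub>R x"]
      by (simp add: sum_distrib_left mult_ac)
    with \<open>0 < t\<close> show "((\<lambda>t. p (t *\<^sub>R x)) has_real_derivative 0) (at t)"
      using D[of t] by simp
  qed simp
  then show "p x = p 0" by simp
qed

text \<open>
  Harmonic polynomials together with a decomposition into homogeneous harmonic parts, so that
  statements about homogeneous polynomials extend by induction.
\<close>

inductive harmonic_sum :: "('a::euclidean_space \<Rightarrow> real) \<Rightarrow> bool" where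
  homogeneous: "harmonic_poly p \<Longrightarrow> euler_degree (real k) p \<Longrightarrow> harmonic_sum p"
| add: "harmonic_sum p \<Longrightarrow> harmonic_sum q \<Longrightarrow> harmonic_sum (\<lambda>x. p x + q x)"

lemma harmonic_sum_harmonic_poly: "harmonic_sum p \<Longrightarrow> harmonic_poly p"
  by (induction rule: harmonic_sum.induct) (auto intro: harmonic_poly_add)

lemma harmonic_sum_const: "harmonic_sum (\<lambda>x. c)"
  by (rule harmonic_sum.homogeneous[of _ 0])
    (auto simp: harmonic_poly_def euler_degree_def laplacian_def partial_deriv_const
      intro: real_polynomial_function.intros)

lemma harmonic_sum_cmult: "harmonic_sum p \<Longrightarrow> harmonic_sum (\<lambda>x. a * p x)"
proof (induction rule: harmonic_sum.induct)
  case (homogeneous p k)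
  have "partial_deriv c (\<lambda>x. a * p x) = (\<lambda>x. a * partial_deriv c p x)" for c
    using homogeneous(1) by (simp add: harmonic_poly_def partial_deriv_cmult)
  then have "(\<Sum>c\<in>Basis. (x \<bullet> c) * partial_deriv c (\<lambda>x. a * p x) x) =
      a * (\<Sum>c\<in>Basis. (x \<bullet> c) * partial_deriv c p x)" for x
    by (simp add: sum_distrib_left mult_ac)
  then have "euler_degree (real k) (\<lambda>x. a * p x)"
    using homogeneous(2) by (simp add: euler_degree_def)
  with homogeneous(1) show ?case
    by (blast intro: harmonic_sum.homogeneous harmonic_poly_cmult)
next
  case (add p q)
  then show ?case
    unfolding distrib_left by (rule_tac harmonic_sum.add)
qed

text \<open>
  If \<open>p\<close> is harmonic and homogeneous of degree \<open>k\<close> in dimension \<open>N\<close>, then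
  \<open>\<Delta>(x\<^sub>b p) = 2 \<partial>\<^sub>b p\<close> and \<open>\<Delta>(\<bar>x\<bar>\<^sup>2 \<partial>\<^sub>b p) = 2 (N + 2k - 2) \<partial>\<^sub>b p\<close>. Hence
  \<open>x\<^sub>b p - \<bar>x\<bar>\<^sup>2 \<partial>\<^sub>b p / (N + 2k - 2)\<close> is harmonic and homogeneous, and on a sphere it differs from
  \<open>x\<^sub>b p\<close> by a multiple of the harmonic homogeneous polynomial \<open>\<partial>\<^sub>b p\<close>. For \<open>N = 2\<close> and \<open>k = 0\<close> the
  denominator vanishes, but then so does \<open>\<partial>\<^sub>b p\<close>.
\<close>

lemma homogeneous_times_coord:
  fixes p :: "'a::euclidean_space \<Rightarrow> real"
  assumes p: "harmonic_poly p" "euler_degree (real k) p" and b: "b \<in> Basis"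
  shows "\<exists>q. harmonic_sum q \<and> (\<forall>x. norm x = r \<longrightarrow> (x \<bullet> b) * p x = q x)"
proof -
  define N where "N = real DIM('a)"
  have N: "1 \<le> N"
    unfolding N_def using DIM_positive[where 'a='a] by linarith
  define g where "g = partial_deriv b p"
  define D where "D = N + 2 * real k - 2"
  have poly: "real_polynomial_function p" "real_polynomial_function g"
    using p(1) by (auto simp: harmonic_poly_def g_def polynomial_partial_deriv)
  have g: "harmonic_poly g" "euler_degree (real k - 1) g"
    unfolding g_def using harmonic_poly_partial_deriv[OF p(1)] euler_degree_partial_deriv[OF poly(1) p(2) b] by auto
  have g0: "g = (\<lambda>x. 0)" if "k = 0"
  proof -
    have "p = (\<lambda>x. p 0)"
      using euler_degree_0_const[OF poly(1)] p(2) that by simp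
    then have "partial_deriv b p = partial_deriv b (\<lambda>x. p 0)"
      by (rule arg_cong)
    then show ?thesis
      by (simp add: g_def partial_deriv_const)
  qed
  define q1 where "q1 = (\<lambda>x. (x \<bullet> b) * p x + (- 1 / D) * ((norm (x - 0))\<^sup>2 * g x))"
  define q2 where "q2 = (\<lambda>x. (r\<^sup>2 / D) * g x)"
  have polys: "real_polynomial_function (\<lambda>x. (x \<bullet> b) * p x)"
      "real_polynomial_function (\<lambda>x. (norm (x - 0))\<^sup>2 * g x)"
    by (intro real_polynomial_function.intros(4) polynomial_coord polynomial_norm_power2 poly)+
  have "harmonic_sum q2"
  proof (cases k)
    case 0
    then show ?thesis
      using harmonic_sum_const[of 0] by (simp add: q2_def g0)
  next
    case (Suc j)
    then have "harmonic_sum g"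
      using g by (intro harmonic_sum.homogeneous[of _ j]) auto
    then show ?thesis
      unfolding q2_def by (rule harmonic_sum_cmult)
  qed
  moreover have "harmonic_sum q1"
  proof (rule harmonic_sum.homogeneous)
    have e1: "euler_degree (1 + real k) (\<lambda>x. (x \<bullet> b) * p x)"
      by (intro euler_degree_mult polynomial_coord poly euler_degree_coord b p)
    have "2 + (real k - 1) = 1 + real k"
      by simp
    then have e2: "euler_degree (1 + real k) (\<lambda>x. (norm (x - 0))\<^sup>2 * g x)"
      using euler_degree_mult[OF polynomial_norm_power2 poly(2) euler_degree_norm_power2 g(2)]
      by (simp only:)
    show "euler_degree (real (Suc k)) q1"
      unfolding q1_def of_nat_Suc by (rule euler_degree_lincomb[OF polys e1 e2])
    have "laplacian (\<lambda>x. (x \<bullet> b) * p x) x = 2 * g x" for x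
    proof -
      have "laplacian (\<lambda>x. x \<bullet> b) x = 0"
        by (simp add: laplacian_def partial_deriv_coord partial_deriv_const)
      moreover have "(\<Sum>c\<in>Basis. partial_deriv c (\<lambda>x. x \<bullet> b) x * partial_deriv c p x) = g x"
        using b by (simp add: partial_deriv_coord g_def inner_Basis if_distrib if_distribR cong: if_cong)
      ultimately show ?thesis
        using p(1) by (simp add: laplacian_mult polynomial_coord poly harmonic_poly_def)
    qed
    moreover have "laplacian (\<lambda>x. (norm (x - 0))\<^sup>2 * g x) x = 2 * D * g x" for x
    proof -
      have "(\<Sum>c\<in>Basis. partial_deriv c (\<lambda>x. (norm (x - 0))\<^sup>2) x * partial_deriv c g x)
          = 2 * (\<Sum>c\<in>Basis. (x \<bullet> c) * partial_deriv c g x)"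
        unfolding partial_deriv_norm_power2 by (simp add: sum_distrib_left mult_ac)
      also have "\<dots> = 2 * ((real k - 1) * g x)"
        using g(2) by (simp add: euler_degree_def)
      finally show ?thesis
        using g(1) laplacian_mult[OF polynomial_norm_power2 poly(2), of 0 x] laplacian_norm_power2[of 0 x]
        by (simp add: harmonic_poly_def D_def N_def algebra_simps)
    qed
    ultimately have "laplacian q1 x = 2 * g x - (1 / D) * (2 * D * g x)" for x
      unfolding q1_def
      using laplacian_add[OF polys(1) real_polynomial_function.intros(4)[OF real_polynomial_function.intros(2) polys(2)],
          of "- 1 / D" x] laplacian_cmult[OF polys(2), of "- 1 / D" x]
      by simp
    moreover have "D \<noteq> 0 \<or> g x = 0" for x
      using g0 N by (cases k) (auto simp: D_def)
    ultimately have "laplacian q1 x = 0" for x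
      by (cases "D = 0") auto
    moreover have "real_polynomial_function q1"
      unfolding q1_def by (intro real_polynomial_function.intros polys)
    ultimately show "harmonic_poly q1"
      by (simp add: harmonic_poly_def)
  qed
  ultimately have "harmonic_sum (\<lambda>x. q1 x + q2 x)"
    by (rule harmonic_sum.add[rotated])
  moreover have "(x \<bullet> b) * p x = q1 x + q2 x" if "norm x = r" for x
    using that by (simp add: q1_def q2_def)
  ultimately show ?thesis
    by blast
qed

lemma harmonic_sum_times_coord:
  assumes "harmonic_sum p" "b \<in> Basis"
  shows "\<exists>q. harmonic_sum q \<and> (\<forall>x. norm x = r \<longrightarrow> (x \<bullet> b) * p x = q x)"
  using assms(1)
proof induction
  case (homogeneous p k)
  then show ?case
    using homogeneous_times_coord assms(2) by blast
next
  case (add p q)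
  then obtain p' q' where "harmonic_sum p'" "\<forall>x. norm x = r \<longrightarrow> (x \<bullet> b) * p x = p' x"
    "harmonic_sum q'" "\<forall>x. norm x = r \<longrightarrow> (x \<bullet> b) * q x = q' x"
    by blast
  then show ?case
    by (intro exI[of _ "\<lambda>x. p' x + q' x"]) (auto simp: distrib_left intro: harmonic_sum.add)
qed

text \<open>
  The induction over \<open>f\<close> works because the class of restrictions to the sphere is closed under
  multiplication by coordinates, so \<open>p\<close> must stay arbitrary; the case of interest is \<open>p = 1\<close>.
\<close>

lemma polynomial_times_harmonic_sum:
  assumes "real_polynomial_function f" "harmonic_sum p"
  shows "\<exists>q. harmonic_sum q \<and> (\<forall>x. norm x = r \<longrightarrow> f x * p x = q x)"
  using assms
proof (induction arbitrary: p)
  case (linear f)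
  have *: "\<exists>q. harmonic_sum q \<and> (\<forall>x. norm x = r \<longrightarrow> (\<Sum>b\<in>A. (x \<bullet> b) * f b) * p x = q x)"
    if "finite A" "A \<subseteq> Basis" for A
    using that
  proof (induction A)
    case empty
    then show ?case
      using harmonic_sum_const[of 0] by auto
  next
    case (insert b A)
    obtain q where q: "harmonic_sum q" "\<And>x. norm x = r \<Longrightarrow> (\<Sum>b\<in>A. (x \<bullet> b) * f b) * p x = q x"
      using insert by blast
    obtain q' where q': "harmonic_sum q'" "\<And>x. norm x = r \<Longrightarrow> (x \<bullet> b) * p x = q' x"
      using harmonic_sum_times_coord[OF linear(2)] insert.prems by blast
    have "harmonic_sum (\<lambda>x. f b * q' x + q x)"
      by (intro harmonic_sum.add harmonic_sum_cmult q q')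
    moreover have "(\<Sum>b\<in>insert b A. (x \<bullet> b) * f b) * p x = f b * q' x + q x" if "norm x = r" for x
      using insert.hyps q(2)[OF that] q'(2)[OF that, symmetric] by (simp add: algebra_simps)
    ultimately show ?case
      by blast
  qed
  have "(\<Sum>b\<in>Basis. (x \<bullet> b) * f b) = f x" for x
  proof -
    interpret bounded_linear f by fact
    have "(\<Sum>b\<in>Basis. (x \<bullet> b) * f b) = f (\<Sum>b\<in>Basis. (x \<bullet> b) *\<^sub>R b)"
      by (simp only: sum scaleR real_scaleR_def)
    then show ?thesis
      by (simp add: euclidean_representation)
  qed
  with *[OF finite_Basis] show ?case
    by simp
next
  case (const c)
  then show ?case
    by (intro exI[of _ "\<lambda>x. c * p x"]) (auto intro: harmonic_sum_cmult)
next
  case (add f g)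
  obtain q where "harmonic_sum q" "\<forall>x. norm x = r \<longrightarrow> f x * p x = q x"
    using add.IH(1)[OF add.prems] by blast
  moreover obtain q' where "harmonic_sum q'" "\<forall>x. norm x = r \<longrightarrow> g x * p x = q' x"
    using add.IH(2)[OF add.prems] by blast
  ultimately show ?case
    by (intro exI[of _ "\<lambda>x. q x + q' x"]) (auto simp: distrib_right intro: harmonic_sum.add)
next
  case (mult f g)
  obtain q where "harmonic_sum q" "\<forall>x. norm x = r \<longrightarrow> g x * p x = q x"
    using mult.IH(2)[OF mult.prems] by blast
  moreover obtain q' where "harmonic_sum q'" "\<forall>x. norm x = r \<longrightarrow> f x * q x = q' x"
    using mult.IH(1)[OF calculation(1)] by blast
  ultimately show ?case
    by (metis mult.assoc)
qed

lemma polynomial_eq_harmonic_on_sphere: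
  assumes "real_polynomial_function f"
  shows "\<exists>q. harmonic_poly q \<and> (\<forall>x. norm x = r \<longrightarrow> f x = q x)"
  using polynomial_times_harmonic_sum[OF assms harmonic_sum_const[of 1], of r] harmonic_sum_harmonic_poly by auto

subsection \<open>Uniform limits of harmonic polynomials\<close>

lemma harmonic_poly_diff: "harmonic_poly p \<Longrightarrow> harmonic_poly q \<Longrightarrow> harmonic_poly (\<lambda>x. p x - q x)"
  using harmonic_poly_add[OF _ harmonic_poly_cmult[of _ "-1"], of p q] by simp

text \<open>
  For polynomials the derivative is again harmonic, so the gradient estimate can be iterated and
  uniform convergence passes to the derivatives of every order on smaller balls.
\<close>

lemma harmonic_poly_deriv_Cauchy:
  fixes p :: "nat \<Rightarrow> 'a::euclidean_space \<Rightarrow> real"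
  assumes p: "\<And>n. harmonic_poly (p n)" and C: "uniformly_Cauchy_on (ball z R) p"
    and \<rho>: "\<rho> < R" and b: "b \<in> Basis"
  shows "uniformly_Cauchy_on (ball z \<rho>) (\<lambda>n. partial_deriv b (p n))"
  unfolding uniformly_Cauchy_on_def
proof (intro allI impI)
  fix e :: real assume e: "0 < e"
  define N where "N = real DIM('a)"
  have N: "1 \<le> N"
    unfolding N_def using DIM_positive[where 'a='a] by linarith
  define d where "d = (R - \<rho>) / (2 * N)"
  have d: "0 < d" "N * d = (R - \<rho>) / 2"
    using N \<rho> by (auto simp: d_def)
  define \<epsilon> where "\<epsilon> = e * d / (2 * N)"
  have \<epsilon>: "0 < \<epsilon>"
    using e d N by (simp add: \<epsilon>_def)
  obtain M where M: "\<And>x m n. x \<in> ball z R \<Longrightarrow> M \<le> m \<Longrightarrow> M \<le> n \<Longrightarrow> dist (p m x) (p n x) < \<epsilon>"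
    using C \<epsilon> unfolding uniformly_Cauchy_on_def by metis
  show "\<exists>M. \<forall>x\<in>ball z \<rho>. \<forall>m\<ge>M. \<forall>n\<ge>M. dist (partial_deriv b (p m) x) (partial_deriv b (p n) x) < e"
  proof (intro exI[of _ M] ballI allI impI)
    fix x m n assume x: "x \<in> ball z \<rho>" and mn: "M \<le> m" "M \<le> n"
    have "cube x d \<subseteq> cball x (N * d)"
      unfolding N_def by (rule cube_subset_cball)
    also have "\<dots> \<subseteq> ball z R"
    proof
      fix y assume "y \<in> cball x (N * d)"
      then have "dist x y \<le> (R - \<rho>) / 2" "dist z x < \<rho>"
        using x d(2) by auto
      then have "dist z y < \<rho> + (R - \<rho>) / 2"
        using dist_triangle[of z y x] by linarith
      then show "y \<in> ball z R"
        using \<rho> by (simp add: field_simps)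
    qed
    finally have cube: "cube x d \<subseteq> ball z R" .
    have H: "harmonic_poly (\<lambda>x. p m x - p n x)"
      by (rule harmonic_poly_diff[OF p p])
    have "\<bar>partial_deriv b (\<lambda>x. p m x - p n x) x\<bar> \<le> \<epsilon> * real DIM('a) / d"
      by (rule harmonic_partial_deriv_bound[OF harmonic_poly_harmonic_on[OF H] open_UNIV _ _ b d(1)])
        (use M[OF _ mn] cube in \<open>auto simp: dist_real_def less_imp_le subset_iff\<close>)
    also have "\<dots> = e / 2"
      using d N by (simp add: \<epsilon>_def N_def)
    also have "\<dots> < e"
      using e by simp
    finally show "dist (partial_deriv b (p m) x) (partial_deriv b (p n) x) < e"
      using p by (simp add: partial_deriv_arith harmonic_poly_def dist_real_def)
  qed
qed

lemma has_pd_uniform_limit: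
  fixes p :: "nat \<Rightarrow> 'a::euclidean_space \<Rightarrow> real"
  assumes p: "\<And>n y. y \<in> ball z \<rho> \<Longrightarrow> has_pd b (p n) y (p' n y)"
    and lim: "\<And>y. y \<in> ball z \<rho> \<Longrightarrow> (\<lambda>n. p n y) \<longlonglongrightarrow> h y"
    and u: "uniform_limit (ball z \<rho>) p' g sequentially" and x: "x \<in> ball z \<rho>"
  shows "has_pd b h x (g x)"
proof -
  define S where "S = (\<lambda>t. x + t *\<^sub>R b) -` ball z \<rho>"
  have S: "open S" "0 \<in> S"
    unfolding S_def using x by (auto intro!: open_vimage continuous_intros)
  have "convex S"
    unfolding convex_alt
  proof (intro ballI allI impI)
    fix s t u :: real assume st: "s \<in> S" "t \<in> S" "0 \<le> u \<and> u \<le> 1"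
    have "x + ((1 - u) *\<^sub>R s + u *\<^sub>R t) *\<^sub>R b = (1 - u) *\<^sub>R (x + s *\<^sub>R b) + u *\<^sub>R (x + t *\<^sub>R b)"
      by (simp add: algebra_simps)
    moreover have "\<dots> \<in> ball z \<rho>"
      using convex_ball[of z \<rho>] st unfolding convex_alt S_def by blast
    ultimately show "(1 - u) *\<^sub>R s + u *\<^sub>R t \<in> S"
      by (simp add: S_def)
  qed
  then have "\<exists>G. \<forall>t\<in>S. (\<lambda>n. p n (x + t *\<^sub>R b)) \<longlonglongrightarrow> G t \<and>
      (G has_derivative (\<lambda>s. g (x + t *\<^sub>R b) * s)) (at t within S)"
  proof (rule has_derivative_sequence[where f' = "\<lambda>n t s. p' n (x + t *\<^sub>R b) * s"])
    show "((\<lambda>t. p n (x + t *\<^sub>R b)) has_derivative (\<lambda>s. p' n (x + t *\<^sub>R b) * s)) (at t within S)"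
      if "t \<in> S" for n t
    proof -
      have "((\<lambda>t. p n (x + t *\<^sub>R b)) has_real_derivative p' n (x + t *\<^sub>R b)) (at t)"
        using p that by (intro has_pd_line) (auto simp: S_def)
      then show ?thesis
        by (auto simp: has_field_derivative_def intro: has_derivative_at_withinI)
    qed
    show "\<forall>\<^sub>F n in sequentially. \<forall>t\<in>S. \<forall>s. norm (p' n (x + t *\<^sub>R b) * s - g (x + t *\<^sub>R b) * s) \<le> e * norm s"
      if "0 < e" for e
    proof -
      have "\<forall>\<^sub>F n in sequentially. \<forall>y\<in>ball z \<rho>. dist (p' n y) (g y) < e"
        using u that by (rule uniform_limitD)
      then show ?thesis
      proof eventually_elim
        case (elim n)
        show ?case
        proof (intro ballI allI)
          fix t s assume "t \<in> S"
          then have "\<bar>p' n (x + t *\<^sub>R b) - g (x + t *\<^sub>R b)\<bar> \<le> e"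
            using elim by (force simp: S_def dist_real_def)
          then show "norm (p' n (x + t *\<^sub>R b) * s - g (x + t *\<^sub>R b) * s) \<le> e * norm s"
            by (simp add: left_diff_distrib[symmetric] abs_mult mult_right_mono)
        qed
      qed
    qed
    show "(\<lambda>n. p n (x + 0 *\<^sub>R b)) \<longlonglongrightarrow> h x"
      using lim[OF x] by simp
  qed (rule S)
  then obtain G where G: "\<And>t. t \<in> S \<Longrightarrow> (\<lambda>n. p n (x + t *\<^sub>R b)) \<longlonglongrightarrow> G t"
    "\<And>t. t \<in> S \<Longrightarrow> (G has_derivative (\<lambda>s. g (x + t *\<^sub>R b) * s)) (at t within S)"
    by blast
  have "(G has_real_derivative g x) (at 0)"
    using G(2)[OF S(2)] at_within_open[OF S(2,1)] by (simp add: has_field_derivative_def)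
  then show ?thesis
    unfolding has_pd_def
  proof (rule has_field_derivative_transform_within_open[OF _ S])
    show "G t = h (x + t *\<^sub>R b)" if "t \<in> S" for t
      using G(1)[OF that] lim that by (auto simp: S_def intro: LIMSEQ_unique)
  qed
qed

lemma harmonic_poly_uniform_limit:
  fixes p :: "nat \<Rightarrow> 'a::euclidean_space \<Rightarrow> real"
  assumes p: "\<And>n. harmonic_poly (p n)" and u: "uniform_limit (ball z R) p h sequentially"
  shows "harmonic_on (ball z R) h"
proof (rule harmonic_on_local)
  fix x assume x: "x \<in> ball z R"
  define R1 where "R1 = (2 * dist z x + R) / 3"
  define R2 where "R2 = (dist z x + 2 * R) / 3"
  have R: "dist z x < R1" "R1 < R2" "R2 < R"
    using x by (auto simp: R1_def R2_def)
  have poly: "real_polynomial_function (p n)" for n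
    using p by (auto simp: harmonic_poly_def)
  have "uniformly_Cauchy_on (ball z R) p"
    using uniformly_convergent_Cauchy u unfolding uniformly_convergent_on_def by blast
  then have C1: "uniformly_Cauchy_on (ball z R2) (\<lambda>n. partial_deriv b (p n))" if "b \<in> Basis" for b
    by (rule harmonic_poly_deriv_Cauchy[OF p _ R(3) that])
  have C2: "uniformly_Cauchy_on (ball z R1) (\<lambda>n. partial_deriv c (partial_deriv b (p n)))"
    if "b \<in> Basis" "c \<in> Basis" for b c
    by (rule harmonic_poly_deriv_Cauchy[OF harmonic_poly_partial_deriv[OF p] C1[OF that(1)] R(2) that(2)])
  define g where "g = (\<lambda>b x. lim (\<lambda>n. partial_deriv b (p n) x))"
  define k where "k = (\<lambda>b c x. lim (\<lambda>n. partial_deriv c (partial_deriv b (p n)) x))"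
  have U1: "uniform_limit (ball z R1) (\<lambda>n. partial_deriv b (p n)) (g b) sequentially" if "b \<in> Basis" for b
    using Cauchy_uniformly_convergent[OF C1[OF that]] R
    unfolding g_def uniformly_convergent_uniform_limit_iff by (auto intro: uniform_limit_on_subset)
  have U2: "uniform_limit (ball z R1) (\<lambda>n. partial_deriv c (partial_deriv b (p n))) (k b c) sequentially"
    if "b \<in> Basis" "c \<in> Basis" for b c
    using Cauchy_uniformly_convergent[OF C2[OF that]]
    unfolding k_def uniformly_convergent_uniform_limit_iff .
  have U0: "uniform_limit (ball z R1) p h sequentially"
    by (rule uniform_limit_on_subset[OF u]) (use R in auto)
  have "C2_with (ball z R1) h g k"
  proof (rule C2_withI)
    show "continuous_on (ball z R1) h"
      by (rule uniform_limit_theorem[OF _ U0]) (auto intro!: always_eventually polynomial_continuous poly)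
    fix b :: 'a assume b: "b \<in> Basis"
    show "continuous_on (ball z R1) (g b)"
      by (rule uniform_limit_theorem[OF _ U1[OF b]]) (auto intro!: always_eventually polynomial_continuous polynomial_partial_deriv poly)
    show "has_pd b h y (g b y)" if "y \<in> ball z R1" for y
      by (rule has_pd_uniform_limit[OF polynomial_partial_deriv(2)[OF poly] tendsto_uniform_limitI[OF U0] U1[OF b] that])
    fix c :: 'a assume c: "c \<in> Basis"
    show "continuous_on (ball z R1) (k b c)"
      by (rule uniform_limit_theorem[OF _ U2[OF b c]]) (auto intro!: always_eventually polynomial_continuous polynomial_partial_deriv poly)
    show "has_pd c (g b) y (k b c y)" if "y \<in> ball z R1" for y
      by (rule has_pd_uniform_limit[OF polynomial_partial_deriv(2)[OF polynomial_partial_deriv(1)[OF poly]]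
            tendsto_uniform_limitI[OF U1[OF b]] U2[OF b c] that])
  qed
  note C = C2_with_imp_C_on[OF this open_ball]
  have "(\<Sum>b\<in>Basis. k b b y) = 0" if "y \<in> ball z R1" for y
  proof -
    have "(\<lambda>n. \<Sum>b\<in>Basis. partial_deriv b (partial_deriv b (p n)) y) \<longlonglongrightarrow> (\<Sum>b\<in>Basis. k b b y)"
      by (intro tendsto_sum tendsto_uniform_limitI[OF U2] that)
    moreover have "(\<Sum>b\<in>Basis. partial_deriv b (partial_deriv b (p n)) y) = 0" for n
      using p by (simp add: harmonic_poly_def laplacian_def)
    ultimately show ?thesis
      by (simp add: LIMSEQ_const_iff)
  qed
  with C have "harmonic_on (ball z R1) h"
    by (simp add: harmonic_on_def)
  with R show "\<exists>T. open T \<and> x \<in> T \<and> harmonic_on T h"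
    by (intro exI[of _ "ball z R1"]) auto
qed

text \<open>
  Polynomials are dense in the continuous functions on a sphere and have harmonic extensions; by the
  maximum principle, approximating the boundary values uniformly approximates the solution uniformly.
\<close>

lemma dirichlet_centered_ball:
  fixes f :: "'a::euclidean_space \<Rightarrow> real"
  assumes r: "0 < r" and f: "continuous_on (sphere 0 r) f"
  shows "\<exists>h. continuous_on (cball 0 r) h \<and> harmonic_on (ball 0 r) h \<and> (\<forall>x\<in>sphere 0 r. h x = f x)"
proof -
  have "\<exists>q. harmonic_poly q \<and> (\<forall>x\<in>sphere 0 r. \<bar>f x - q x\<bar> < 1 / real (Suc n))" for n
  proof -
    obtain g where g: "real_polynomial_function g" "\<And>x. x \<in> sphere 0 r \<Longrightarrow> \<bar>f x - g x\<bar> < 1 / real (Suc n)"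
      using Stone_Weierstrass_real_polynomial_function[OF compact_sphere f, of "1 / real (Suc n)"] by auto
    then show ?thesis
      using polynomial_eq_harmonic_on_sphere[OF g(1), of r] by fastforce
  qed
  then obtain q where q: "\<And>n. harmonic_poly (q n)"
    "\<And>n x. x \<in> sphere 0 r \<Longrightarrow> \<bar>f x - q n x\<bar> < 1 / real (Suc n)"
    by metis
  have cont: "continuous_on S (q n)" for n S
    using q(1) by (auto simp: harmonic_poly_def polynomial_continuous)
  have diff: "\<bar>q m x - q n x\<bar> \<le> 1 / real (Suc m) + 1 / real (Suc n)" if "x \<in> cball 0 r" for m n x
  proof (rule harmonic_bound[where S = "ball 0 r" and u = "\<lambda>x. q m x - q n x"])
    show "harmonic_on (ball 0 r) (\<lambda>x. q m x - q n x)"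
      by (intro harmonic_on_diff harmonic_poly_harmonic_on q open_ball)
    show "\<bar>q m x - q n x\<bar> \<le> 1 / real (Suc m) + 1 / real (Suc n)" if "x \<in> frontier (ball 0 r)" for x
      using q(2)[of x m] q(2)[of x n] that r by (simp add: frontier_ball)
  qed (use that r in \<open>auto intro!: continuous_on_diff cont\<close>)
  have "uniformly_Cauchy_on (cball 0 r) q"
  proof (rule uniformly_Cauchy_onI')
    fix e :: real assume "0 < e"
    then obtain M :: nat where M: "inverse (real (Suc M)) < e / 2"
      using reals_Archimedean[of "e/2"] by auto
    have *: "1 / real (Suc m) < e / 2" if "M \<le> m" for m
    proof -
      have "1 / real (Suc m) \<le> 1 / real (Suc M)"
        using that by (intro divide_left_mono) auto
      then show ?thesis
        using M by (simp add: inverse_eq_divide)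
    qed
    show "\<exists>M. \<forall>x\<in>cball 0 r. \<forall>m\<ge>M. \<forall>n>m. dist (q m x) (q n x) < e"
    proof (intro exI[of _ M] ballI allI impI)
      fix x :: 'a and m n :: nat assume x: "x \<in> cball 0 r" and m: "M \<le> m" and n: "m < n"
      have "\<bar>q m x - q n x\<bar> \<le> 1 / real (Suc m) + 1 / real (Suc n)"
        by (rule diff[OF x])
      also have "\<dots> < e / 2 + e / 2"
        using m n by (intro add_strict_mono *) auto
      finally show "dist (q m x) (q n x) < e"
        by (simp add: dist_real_def)
    qed
  qed
  then obtain h where h: "uniform_limit (cball 0 r) q h sequentially"
    using Cauchy_uniformly_convergent unfolding uniformly_convergent_on_def by blast
  show ?thesis
  proof (intro exI conjI ballI)
    show "continuous_on (cball 0 r) h"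
      by (rule uniform_limit_theorem[OF _ h]) (auto intro!: always_eventually cont)
    show "harmonic_on (ball 0 r) h"
      by (rule harmonic_poly_uniform_limit[OF q(1) uniform_limit_on_subset[OF h ball_subset_cball]])
    fix x :: 'a assume x: "x \<in> sphere 0 r"
    have "(\<lambda>n. q n x) \<longlonglongrightarrow> h x"
      using x by (intro tendsto_uniform_limitI[OF h]) auto
    moreover have "(\<lambda>n. q n x) \<longlonglongrightarrow> f x"
    proof (rule LIMSEQ_norm_0[of "\<lambda>n. q n x - f x", THEN LIM_zero_cancel])
      show "norm (q n x - f x) < 1 / real (Suc n)" for n
        using q(2)[OF x, of n] by (simp add: abs_minus_commute)
    qed
    ultimately show "h x = f x"
      by (rule LIMSEQ_unique)
  qed
qed

lemma dirichlet_ball: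
  fixes f :: "'a::euclidean_space \<Rightarrow> real"
  assumes r: "0 < r" and f: "continuous_on (sphere z r) f"
  obtains h where "continuous_on (cball z r) h" "harmonic_on (ball z r) h" "\<And>x. x \<in> sphere z r \<Longrightarrow> h x = f x"
proof -
  have "continuous_on (sphere 0 r) (\<lambda>x. f (x + z))"
    by (rule continuous_on_compose2[OF f]) (auto intro!: continuous_intros simp: dist_norm)
  from dirichlet_centered_ball[OF r this] obtain h where
    h: "continuous_on (cball 0 r) h" "harmonic_on (ball 0 r) h" "\<And>x. x \<in> sphere 0 r \<Longrightarrow> h x = f (x + z)"
    by blast
  show ?thesis
  proof (rule that[of "\<lambda>x. h (x + (- z))"])
    show "continuous_on (cball z r) (\<lambda>x. h (x + (- z)))"
      by (rule continuous_on_compose2[OF h(1)]) (auto intro!: continuous_intros simp: dist_norm norm_minus_commute)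
    show "harmonic_on (ball z r) (\<lambda>x. h (x + (- z)))"
      by (rule harmonic_on_translate[OF h(2)]) (auto simp: dist_norm norm_minus_commute)
    show "h (x + (- z)) = f x" if "x \<in> sphere z r" for x
      using h(3)[of "x - z"] that by (auto simp: dist_norm norm_minus_commute)
  qed
qed

section \<open>Perron's method\<close>

text \<open>
  Subharmonicity by comparison on every open subset, rather than on balls only: with
  superharmonic functions admitted for comparison, this turns the behaviour of a whole family
  near the boundary into a property of one explicit barrier.
\<close>

definition subharmonic_on :: "'a::euclidean_space set \<Rightarrow> ('a \<Rightarrow> real) \<Rightarrow> bool"
  where "subharmonic_on D v \<longleftrightarrow> continuous_on (closure D) v \<and>
    (\<forall>G \<psi>. open G \<and> G \<subseteq> D \<and> continuous_on (closure G) \<psi> \<and> C_on 2 G \<psi> \<and>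
       (\<forall>x\<in>G. laplacian \<psi> x \<le> 0) \<and> (\<forall>x\<in>frontier G. v x \<le> \<psi> x) \<longrightarrow> (\<forall>x\<in>G. v x \<le> \<psi> x))"

lemma subharmonic_onD:
  assumes "subharmonic_on D v" "open G" "G \<subseteq> D" "continuous_on (closure G) \<psi>" "C_on 2 G \<psi>"
    "\<And>x. x \<in> G \<Longrightarrow> laplacian \<psi> x \<le> 0" "\<And>x. x \<in> frontier G \<Longrightarrow> v x \<le> \<psi> x" "x \<in> G"
  shows "v x \<le> \<psi> x"
  using assms unfolding subharmonic_on_def by blast

lemma subharmonic_on_max:
  assumes "subharmonic_on D v" "subharmonic_on D w"
  shows "subharmonic_on D (\<lambda>x. max (v x) (w x))"
proof -
  have "continuous_on (closure D) (\<lambda>x. max (v x) (w x))"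
    using assms by (auto simp: subharmonic_on_def intro: continuous_on_max)
  moreover have "max (v x) (w x) \<le> \<psi> x"
    if "open G" "G \<subseteq> D" "continuous_on (closure G) \<psi>" "C_on 2 G \<psi>"
      "\<And>x. x \<in> G \<Longrightarrow> laplacian \<psi> x \<le> 0" "\<And>x. x \<in> frontier G \<Longrightarrow> max (v x) (w x) \<le> \<psi> x" "x \<in> G"
    for G \<psi> x
    using subharmonic_onD[OF assms(1) that(1-5) _ that(7)] subharmonic_onD[OF assms(2) that(1-5) _ that(7)] that(6)
    by (metis max.bounded_iff)
  ultimately show ?thesis
    unfolding subharmonic_on_def by blast
qed

lemma harmonic_imp_subharmonic:
  assumes "bounded D" "continuous_on (closure D) u" "harmonic_on D u"
  shows "subharmonic_on D u"
  unfolding subharmonic_on_def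
proof (intro conjI allI impI ballI)
  fix G \<psi> x
  assume G: "open G \<and> G \<subseteq> D \<and> continuous_on (closure G) \<psi> \<and> C_on 2 G \<psi> \<and>
       (\<forall>x\<in>G. laplacian \<psi> x \<le> 0) \<and> (\<forall>x\<in>frontier G. u x \<le> \<psi> x)" and x: "x \<in> G"
  show "u x \<le> \<psi> x"
  proof (rule comparison_principle[where S = G])
    show "continuous_on (closure G) u"
      by (rule continuous_on_subset[OF assms(2) closure_mono]) (use G in auto)
    show "bounded G"
      by (rule bounded_subset[OF assms(1)]) (use G in auto)
    show "harmonic_on G u"
      by (rule harmonic_on_subset[OF assms(3)]) (use G in auto)
  qed (use G x in auto)
qed (rule assms)

text \<open>
  Solving the Dirichlet problem on one ball preserves subharmonicity because the modified function
  lies above the original one, so that it inherits comparison outside the ball from the latter.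
\<close>

lemma harmonic_lift:
  assumes v: "subharmonic_on D v" and D: "open D" "bounded D" and r: "0 < r" "cball z r \<subseteq> D"
    and h: "continuous_on (cball z r) h" "harmonic_on (ball z r) h" "\<And>x. x \<in> sphere z r \<Longrightarrow> h x = v x"
  shows "subharmonic_on D (\<lambda>x. if x \<in> ball z r then h x else v x)"
    and "\<And>x. x \<in> ball z r \<Longrightarrow> v x \<le> h x"
proof -
  let ?V = "\<lambda>x. if x \<in> ball z r then h x else v x"
  have h2: "C_on 2 (ball z r) h" "\<And>x. x \<in> ball z r \<Longrightarrow> laplacian h x = 0"
    using h(2) by (auto simp: harmonic_on_def)
  show vh: "v x \<le> h x" if "x \<in> ball z r" for x
    by (rule subharmonic_onD[OF v open_ball _ _ h2(1) _ _ that])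
      (use r h h2 ball_subset_cball[of z r] in \<open>auto simp: frontier_ball\<close>)
  have vc: "continuous_on (closure D) v"
    using v by (simp add: subharmonic_on_def)
  have "continuous_on (cball z r \<union> (closure D - ball z r)) ?V"
    using h(3) by (intro continuous_on_cases closed_Diff h continuous_on_subset[OF vc]) auto
  moreover have "cball z r \<union> (closure D - ball z r) = closure D"
    using r(2) closure_subset[of D] ball_subset_cball[of z r] by blast
  ultimately have Vc: "continuous_on (closure D) ?V"
    by simp
  have "?V x \<le> \<psi> x"
    if G: "open G" "G \<subseteq> D" "continuous_on (closure G) \<psi>" "C_on 2 G \<psi>"
      "\<And>x. x \<in> G \<Longrightarrow> laplacian \<psi> x \<le> 0" and le: "\<And>x. x \<in> frontier G \<Longrightarrow> ?V x \<le> \<psi> x" and x: "x \<in> G"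
    for G \<psi> x
  proof -
    have vV: "v y \<le> ?V y" for y
      using vh by auto
    have v\<psi>: "v y \<le> \<psi> y" if "y \<in> G" for y
      by (rule subharmonic_onD[OF v G _ that]) (use vV le order_trans in blast)+
    show ?thesis
    proof (cases "x \<in> ball z r")
      case False
      then show ?thesis
        using v\<psi>[OF x] by simp
    next
      case True
      have sub: "closure (G \<inter> ball z r) \<subseteq> closure G \<inter> cball z r"
        using closure_mono[of "G \<inter> ball z r" G] closure_mono[of "G \<inter> ball z r" "ball z r"] r by auto
      have "h x \<le> \<psi> x"
      proof (rule comparison_principle[where S = "G \<inter> ball z r"])
        show "open (G \<inter> ball z r)" "bounded (G \<inter> ball z r)"
          using G(1) by (auto intro: bounded_Int)
        show "continuous_on (closure (G \<inter> ball z r)) h" "continuous_on (closure (G \<inter> ball z r)) \<psi>"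
          using sub by (auto intro: continuous_on_subset[OF h(1)] continuous_on_subset[OF G(3)])
        show "harmonic_on (G \<inter> ball z r) h" "C_on 2 (G \<inter> ball z r) \<psi>"
          by (auto intro: harmonic_on_subset[OF h(2)] C_on_2_subset[OF G(4)])
        fix y assume "y \<in> frontier (G \<inter> ball z r)"
        then have y: "y \<in> closure G" "y \<in> cball z r" "y \<notin> G \<or> y \<notin> ball z r"
          using sub G(1) by (auto simp: frontier_def interior_open)
        then have fr: "y \<notin> G \<Longrightarrow> y \<in> frontier G"
          using G(1) by (simp add: frontier_def interior_open)
        show "h y \<le> \<psi> y"
        proof (cases "y \<in> ball z r")
          case True
          then show ?thesis
            using y fr le[of y] by auto
        next
          case False
          then have "h y = v y"
            using y h(3) by (auto simp: dist_commute)
          then show ?thesis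
            using False v\<psi>[of y] fr le[of y] by (cases "y \<in> G") auto
        qed
      qed (use G x True in auto)
      with True show ?thesis by simp
    qed
  qed
  with Vc show "subharmonic_on D ?V"
    unfolding subharmonic_on_def by blast
qed

definition perron_family :: "'a::euclidean_space set \<Rightarrow> ('a \<Rightarrow> real) set \<Rightarrow> bool"
  where "perron_family D F \<longleftrightarrow> F \<noteq> {} \<and> (\<forall>v\<in>F. subharmonic_on D v \<and> (\<forall>x\<in>D. 0 \<le> v x \<and> v x \<le> 1)) \<and>
    (\<forall>v\<in>F. \<forall>w\<in>F. (\<lambda>x. max (v x) (w x)) \<in> F) \<and>
    (\<forall>v\<in>F. \<forall>z r h. 0 < r \<and> cball z r \<subseteq> D \<and> continuous_on (cball z r) h \<and> harmonic_on (ball z r) h \<and>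
       (\<forall>x\<in>sphere z r. h x = v x) \<longrightarrow> (\<lambda>x. if x \<in> ball z r then h x else v x) \<in> F)"

text \<open>
  On a ball \<open>B\<close> inside the domain the supremum equals that of the harmonic lifts in \<open>B\<close>, which form
  an upward directed family with a common local Lipschitz constant. Hence the supremum is a locally
  uniform limit of harmonic functions, and so equals the solution of the Dirichlet problem with its
  own boundary values.
\<close>

theorem perron_harmonic:
  fixes D :: "'a::euclidean_space set"
  assumes D: "open D" "bounded D" and F: "perron_family D F"
  shows "harmonic_on D (\<lambda>x. SUP v\<in>F. v x)"
proof (rule harmonic_on_local)
  fix z assume "z \<in> D"
  then obtain r where r: "0 < r" "cball z r \<subseteq> D"
    using D(1) open_contains_cball by blast
  define u where "u = (\<lambda>x. SUP v\<in>F. v x)"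
  define K where "K = cball z (r/4)"
  have ballD: "ball z r \<subseteq> D"
    using r(2) ball_subset_cball[of z r] by blast
  have KD: "K \<subseteq> ball z r" "K \<subseteq> D"
    using r ballD by (auto simp: K_def)
  have Fne: "F \<noteq> {}" and Fsub: "\<And>v. v \<in> F \<Longrightarrow> subharmonic_on D v"
    and F01: "\<And>v x. v \<in> F \<Longrightarrow> x \<in> D \<Longrightarrow> 0 \<le> v x \<and> v x \<le> 1"
    and Fmax: "\<And>v w. v \<in> F \<Longrightarrow> w \<in> F \<Longrightarrow> (\<lambda>x. max (v x) (w x)) \<in> F"
    and Flift: "\<And>v z r h. \<lbrakk>v \<in> F; 0 < r; cball z r \<subseteq> D; continuous_on (cball z r) h; harmonic_on (ball z r) h;
       \<And>x. x \<in> sphere z r \<Longrightarrow> h x = v x\<rbrakk> \<Longrightarrow> (\<lambda>x. if x \<in> ball z r then h x else v x) \<in> F"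
    using F unfolding perron_family_def by blast+
  have bdd: "bdd_above ((\<lambda>v. v x) ` F)" if "x \<in> D" for x
    using F01 that by (auto intro!: bdd_aboveI[of _ 1])
  have upper: "v x \<le> u x" if "v \<in> F" "x \<in> D" for v x
    unfolding u_def by (rule cSUP_upper[OF that(1) bdd[OF that(2)]])
  have lift: "\<exists>V\<in>F. (\<forall>x\<in>D. v x \<le> V x) \<and> harmonic_on (ball z r) V" if v: "v \<in> F" for v
  proof -
    have "continuous_on (sphere z r) v"
      using Fsub[OF v] r(2) closure_subset[of D] sphere_cball[of z r]
      unfolding subharmonic_on_def by (metis continuous_on_subset order_trans)
    then obtain h where h: "continuous_on (cball z r) h" "harmonic_on (ball z r) h" "\<And>x. x \<in> sphere z r \<Longrightarrow> h x = v x"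
      using dirichlet_ball[OF r(1)] by metis
    have "harmonic_on (ball z r) (\<lambda>x. if x \<in> ball z r then h x else v x)"
      by (rule harmonic_on_cong[OF h(2)]) auto
    moreover have "v x \<le> (if x \<in> ball z r then h x else v x)" for x
      using harmonic_lift(2)[OF Fsub[OF v] D r h] by auto
    ultimately show ?thesis
      using Flift[OF v r h(1,2,3)] by (intro bexI[of _ "\<lambda>x. if x \<in> ball z r then h x else v x"]) auto
  qed
  define N where "N = real DIM('a)"
  have N: "1 \<le> N"
    unfolding N_def using DIM_positive[where 'a='a] by linarith
  define L where "L = 8 * 1 * N ^ 3 / r"
  have L: "0 < L"
    using N r by (simp add: L_def)
  define \<eta>\<^sub>0 where "\<eta>\<^sub>0 = r / (8 * N)"
  have \<eta>\<^sub>0: "0 < \<eta>\<^sub>0"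
    using N r by (simp add: \<eta>\<^sub>0_def)
  have Lip: "V x \<le> V y + L * norm (x - y)"
    if "V \<in> F" "harmonic_on (ball z r) V" "x \<in> K" "y \<in> K" "norm (x - y) \<le> \<eta>\<^sub>0" for V x y
  proof -
    have "\<bar>V x - V y\<bar> \<le> L * norm (x - y)"
      unfolding L_def N_def
      by (rule harmonic_Lipschitz[OF that(2) _ r(1)])
        (use that F01[OF that(1)] ballD in \<open>auto simp: K_def \<eta>\<^sub>0_def N_def\<close>)
    then show ?thesis by linarith
  qed
  have uLip: "u x \<le> u y + L * norm (x - y)" if "x \<in> K" "y \<in> K" "norm (x - y) \<le> \<eta>\<^sub>0" for x y
    unfolding u_def
  proof (rule cSUP_least[OF Fne])
    fix v assume "v \<in> F"
    then obtain V where V: "V \<in> F" "\<forall>x\<in>D. v x \<le> V x" "harmonic_on (ball z r) V"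
      using lift by blast
    have "v x \<le> V x"
      using V(2) that(1) KD by blast
    also have "\<dots> \<le> V y + L * norm (x - y)"
      by (rule Lip[OF V(1,3) that])
    also have "V y \<le> u y"
      using upper[OF V(1)] that(2) KD by blast
    finally show "v x \<le> (SUP v\<in>F. v y) + L * norm (x - y)"
      by (simp add: u_def)
  qed
  have ucont: "continuous_on K u"
  proof (rule continuous_onI)
    fix x e assume x: "x \<in> K" and e: "0 < (e::real)"
    show "\<exists>d>0. \<forall>y\<in>K. dist y x < d \<longrightarrow> dist (u y) (u x) \<le> e"
    proof (intro exI[of _ "min \<eta>\<^sub>0 (e / L)"] conjI ballI impI)
      fix y assume y: "y \<in> K" "dist y x < min \<eta>\<^sub>0 (e / L)"
      then have "norm (x - y) \<le> \<eta>\<^sub>0" "norm (y - x) \<le> \<eta>\<^sub>0" "L * norm (x - y) \<le> e"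
        using L by (auto simp: dist_norm norm_minus_commute field_simps)
      then show "dist (u y) (u x) \<le> e"
        using uLip[OF x y(1)] uLip[OF y(1) x] by (auto simp: dist_real_def norm_minus_commute)
    qed (use \<eta>\<^sub>0 e L in auto)
  qed
  have fin_max: "\<exists>v\<in>F. \<forall>y\<in>Y. \<forall>x. w y x \<le> v x"
    if "finite Y" "\<And>y. y \<in> Y \<Longrightarrow> w y \<in> F" for Y :: "'a set" and w
    using that
  proof (induction Y)
    case empty
    then show ?case using Fne by blast
  next
    case (insert y Y)
    then obtain v where "v \<in> F" "\<forall>y\<in>Y. \<forall>x. w y x \<le> v x"
      by blast
    then show ?case
      using Fmax[of v "w y"] insert.prems by (intro bexI[of _ "\<lambda>x. max (v x) (w y x)"]) (auto simp: le_max_iff_disj)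
  qed
  have approx: "\<exists>V\<in>F. harmonic_on (ball z r) V \<and> (\<forall>x\<in>K. u x \<le> V x + 3 * \<epsilon>)" if \<epsilon>: "0 < \<epsilon>" for \<epsilon>
  proof -
    define \<eta> where "\<eta> = min \<eta>\<^sub>0 (\<epsilon> / L)"
    have \<eta>: "0 < \<eta>" "\<eta> \<le> \<eta>\<^sub>0" "L * \<eta> \<le> \<epsilon>"
      using \<eta>\<^sub>0 \<epsilon> L by (auto simp: \<eta>_def min_def field_simps)
    have "K \<subseteq> (\<Union>y\<in>K. ball y \<eta>)"
      using \<eta>(1) by auto
    then obtain Y where Y: "Y \<subseteq> K" "finite Y" "K \<subseteq> (\<Union>y\<in>Y. ball y \<eta>)"
      using compactE_image[of K K "\<lambda>y. ball y \<eta>"] by (auto simp: K_def)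
    have "\<exists>v\<in>F. u y - \<epsilon> < v y" if "y \<in> Y" for y
      using less_cSUP_iff[OF Fne bdd, of y "u y - \<epsilon>"] that Y(1) KD \<epsilon> unfolding u_def by auto
    then obtain w where w: "\<And>y. y \<in> Y \<Longrightarrow> w y \<in> F" "\<And>y. y \<in> Y \<Longrightarrow> u y - \<epsilon> < w y y"
      by metis
    then obtain v where v: "v \<in> F" "\<And>y x. y \<in> Y \<Longrightarrow> w y x \<le> v x"
      using fin_max[OF Y(2), of w] by blast
    obtain V where V: "V \<in> F" "\<forall>x\<in>D. v x \<le> V x" "harmonic_on (ball z r) V"
      using lift[OF v(1)] by blast
    have "u x \<le> V x + 3 * \<epsilon>" if x: "x \<in> K" for x
    proof -
      obtain y where y: "y \<in> Y" "dist y x < \<eta>"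
        using x Y(3) by auto
      have yK: "y \<in> K" "y \<in> D"
        using y(1) Y(1) KD by auto
      have d: "norm (x - y) \<le> \<eta>\<^sub>0" "norm (y - x) \<le> \<eta>\<^sub>0"
        using y(2) \<eta>(2) by (auto simp: dist_norm norm_minus_commute)
      have "L * norm (x - y) \<le> L * \<eta>"
        using y(2) L by (simp add: dist_norm norm_minus_commute)
      then have Ld: "L * norm (x - y) \<le> \<epsilon>" "L * norm (y - x) \<le> \<epsilon>"
        using \<eta>(3) by (auto simp: norm_minus_commute)
      have "u x \<le> u y + \<epsilon>"
        using uLip[OF x yK(1) d(1)] Ld by linarith
      also have "\<dots> \<le> w y y + 2 * \<epsilon>"
        using w(2)[OF y(1)] by linarith
      also have "\<dots> \<le> V y + 2 * \<epsilon>"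
        using v(2)[OF y(1), of y] V(2) yK by force
      also have "\<dots> \<le> V x + 3 * \<epsilon>"
        using Lip[OF V(1,3) yK(1) x d(2)] Ld by linarith
      finally show ?thesis .
    qed
    with V show ?thesis by blast
  qed
  have "0 < r/4"
    using r by simp
  moreover have "continuous_on (sphere z (r/4)) u"
    by (rule continuous_on_subset[OF ucont]) (auto simp: K_def)
  ultimately obtain g where g: "continuous_on (cball z (r/4)) g" "harmonic_on (ball z (r/4)) g"
    "\<And>x. x \<in> sphere z (r/4) \<Longrightarrow> g x = u x"
    using dirichlet_ball by metis
  have "g x = u x" if x: "x \<in> ball z (r/4)" for x
  proof (rule ccontr)
    assume "g x \<noteq> u x"
    \<comment> \<open>both \<open>g\<close> and \<open>u\<close> are within \<open>3\<epsilon>\<close> of \<open>V\<close>, and \<open>7 > 6\<close>\<close>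
    define \<epsilon> where "\<epsilon> = \<bar>g x - u x\<bar> / 7"
    have "0 < \<epsilon>"
      using \<open>g x \<noteq> u x\<close> by (simp add: \<epsilon>_def)
    then obtain V where V: "V \<in> F" "harmonic_on (ball z r) V" "\<And>x. x \<in> K \<Longrightarrow> u x \<le> V x + 3 * \<epsilon>"
      using approx by blast
    have close: "\<bar>u y - V y\<bar> \<le> 3 * \<epsilon>" if "y \<in> K" for y
      using V(3)[OF that] upper[OF V(1), of y] that KD \<open>0 < \<epsilon>\<close> by auto
    have "\<bar>g x - V x\<bar> \<le> 3 * \<epsilon>"
    proof (rule harmonic_bound[where S = "ball z (r/4)" and u = "\<lambda>x. g x - V x"])
      have "continuous_on (ball z r) V"
        using V(2) C_on_2_continuous by (auto simp: harmonic_on_def)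
      then show "continuous_on (closure (ball z (r/4))) (\<lambda>x. g x - V x)"
        using r KD g(1) by (auto simp: K_def intro!: continuous_on_diff elim: continuous_on_subset)
      show "harmonic_on (ball z (r/4)) (\<lambda>x. g x - V x)"
        using r by (intro harmonic_on_diff g harmonic_on_subset[OF V(2)]) auto
      show "\<bar>g y - V y\<bar> \<le> 3 * \<epsilon>" if "y \<in> frontier (ball z (r/4))" for y
        using that r g(3)[of y] close[of y] by (auto simp: K_def frontier_ball)
    qed (use x r in auto)
    moreover have "\<bar>u x - V x\<bar> \<le> 3 * \<epsilon>"
      using close x by (auto simp: K_def)
    ultimately have "\<bar>g x - u x\<bar> \<le> 6 * \<epsilon>"
      by linarith
    then show False
      using \<open>0 < \<epsilon>\<close> by (simp add: \<epsilon>_def)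
  qed
  then have "harmonic_on (ball z (r/4)) u"
    by (rule harmonic_on_cong[OF g(2) open_ball])
  then show "\<exists>T. open T \<and> z \<in> T \<and> harmonic_on T (\<lambda>x. SUP v\<in>F. v x)"
    using r unfolding u_def by (intro exI[of _ "ball z (r/4)"]) auto
qed

subsection \<open>Decay at boundary points with exterior balls at all scales\<close>

lemma has_pd_inverse_power:
  assumes "has_pd b \<rho> x d" "\<rho> x \<noteq> 0"
  shows "has_pd b (\<lambda>x. inverse (\<rho> x) ^ Suc j) x (- real (Suc j) * inverse (\<rho> x) ^ Suc (Suc j) * d)"
  using assms unfolding has_pd_def
  by (auto intro!: derivative_eq_intros simp: power2_eq_square divide_inverse algebra_simps simp flip: power_Suc)

lemma inverse_power_subharmonic:
  fixes q :: "'a::euclidean_space"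
  assumes S: "open S" "q \<notin> S" and j: "real DIM('a) \<le> 2 * real j + 4"
  shows "C_on 2 S (\<lambda>x. inverse ((norm (x - q))\<^sup>2) ^ Suc j)"
    and "\<And>x. x \<in> S \<Longrightarrow> 0 \<le> laplacian (\<lambda>x. inverse ((norm (x - q))\<^sup>2) ^ Suc j) x"
proof -
  define \<rho> where "\<rho> = (\<lambda>x. (norm (x - q))\<^sup>2)"
  have \<rho>0: "\<rho> x \<noteq> 0" if "x \<in> S" for x
    using that S by (auto simp: \<rho>_def)
  have \<rho>c: "continuous_on S \<rho>"
    unfolding \<rho>_def by (intro continuous_intros)
  have pd\<rho>: "has_pd b \<rho> x (2 * ((x - q) \<bullet> b))" for b x
    unfolding \<rho>_def by (rule has_pd_norm_power2)
  let ?g = "\<lambda>b x. - real (Suc j) * inverse (\<rho> x) ^ Suc (Suc j) * (2 * ((x - q) \<bullet> b))"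
  let ?k = "\<lambda>b c x. - real (Suc j) * ((- real (Suc (Suc j)) * inverse (\<rho> x) ^ Suc (Suc (Suc j)) * (2 * ((x - q) \<bullet> c)))
      * (2 * ((x - q) \<bullet> b)) + inverse (\<rho> x) ^ Suc (Suc j) * (2 * (c \<bullet> b)))"
  have "C2_with S (\<lambda>x. inverse (\<rho> x) ^ Suc j) ?g ?k"
  proof (rule C2_withI)
    show "has_pd b (\<lambda>x. inverse (\<rho> x) ^ Suc j) x (?g b x)" if "x \<in> S" for b x
      by (rule has_pd_inverse_power[OF pd\<rho> \<rho>0[OF that]])
    show "has_pd c (?g b) x (?k b c x)" if "x \<in> S" for b c x
      unfolding mult.assoc[of "- real (Suc j)"]
      by (intro has_pd_cmult has_pd_mult has_pd_inverse_power pd\<rho> \<rho>0 that has_pd_shifted_coord')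
  qed (auto intro!: continuous_intros \<rho>c simp: \<rho>0)
  note C = C2_with_imp_C_on[OF this S(1)]
  show "C_on 2 S (\<lambda>x. inverse ((norm (x - q))\<^sup>2) ^ Suc j)"
    using C(1) by (simp add: \<rho>_def)
  show "0 \<le> laplacian (\<lambda>x. inverse ((norm (x - q))\<^sup>2) ^ Suc j) x" if x: "x \<in> S" for x
  proof -
    define a where "a = real (Suc j)"
    define I where "I = inverse (\<rho> x) ^ Suc (Suc j)"
    have I: "0 \<le> I"
      by (simp add: I_def \<rho>_def)
    have "?k b b x = 4 * a * (a + 1) * (inverse (\<rho> x) * I) * (((x - q) \<bullet> b) * ((x - q) \<bullet> b)) - 2 * a * I"
      if "b \<in> Basis" for b
      using that by (simp add: a_def I_def algebra_simps)
    then have "(\<Sum>b\<in>Basis. ?k b b x) = (\<Sum>b\<in>Basis. 4 * a * (a + 1) * (inverse (\<rho> x) * I) * (((x - q) \<bullet> b) * ((x - q) \<bullet> b)) - 2 * a * I)"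
      by (intro sum.cong) auto
    also have "\<dots> = 4 * a * (a + 1) * (inverse (\<rho> x) * I) * \<rho> x - real DIM('a) * (2 * a * I)"
      by (simp only: sum_subtractf sum_distrib_left[symmetric] sum_constant euclidean_inner[symmetric] \<rho>_def
          power2_norm_eq_inner) (simp add: mult_ac)
    also have "\<dots> = 2 * a * I * (2 * (a + 1) - real DIM('a))"
    proof -
      have "inverse (\<rho> x) * I * \<rho> x = I"
        using \<rho>0[OF x] by simp
      then have "4 * a * (a + 1) * (inverse (\<rho> x) * I) * \<rho> x = 4 * a * (a + 1) * I"
        by (simp only: mult.assoc)
      then show ?thesis
        by (simp add: algebra_simps)
    qed
    also have "0 \<le> \<dots>"
      using j I by (simp add: a_def)
    finally show ?thesis
      using C(2)[OF x] by (simp add: \<rho>_def)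
  qed
qed

text \<open>
  With the scale \<open>s\<close> as unit of length, the domain keeps distance \<open>\<kappa>\<close> from the exterior center, the
  region of improvement lies within \<open>2\<close> of it, and comparison takes place within \<open>3\<close>.
\<close>

definition decay_factor :: "nat \<Rightarrow> real \<Rightarrow> real"
  where "decay_factor k \<kappa> = 1 - (\<kappa>\<^sup>2) ^ k * (inverse (2\<^sup>2) ^ k - inverse (3\<^sup>2) ^ k)"

lemma decay_factor_bounds:
  assumes "0 < \<kappa>" "\<kappa> \<le> 1"
  shows "0 \<le> decay_factor (Suc j) \<kappa>" "decay_factor (Suc j) \<kappa> < 1"
proof -
  have "inverse (3\<^sup>2) ^ Suc j < (inverse (2\<^sup>2) ^ Suc j :: real)"
    by (intro power_strict_mono) auto
  moreover have "0 < (\<kappa>\<^sup>2) ^ Suc j" "(\<kappa>\<^sup>2) ^ Suc j \<le> 1"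
    using assms by (auto intro!: power_le_one simp del: power_Suc)
  moreover have "inverse (2\<^sup>2) ^ Suc j \<le> (1::real)" "0 \<le> (inverse (3\<^sup>2) ^ Suc j :: real)"
    by (auto intro!: power_le_one simp del: power_Suc)
  ultimately show "0 \<le> decay_factor (Suc j) \<kappa>" "decay_factor (Suc j) \<kappa> < 1"
    unfolding decay_factor_def by (smt (verit) mult_le_one mult_pos_pos)+
qed

text \<open>
  An exterior ball of radius \<open>\<kappa> s\<close> near \<open>p\<close> forces a subharmonic function
  that is nonpositive on the boundary to drop by a factor independent of \<open>s\<close> between the scales
  \<open>4 s\<close> and \<open>s\<close>. The comparison function is \<open>m\<close> on the sphere of radius \<open>3 s\<close> about the exterior
  center \<open>q\<close> and is lowered by a multiple of \<open>\<bar>x - q\<bar>\<^sup>-\<^sup>2\<^sup>k\<close>, which is subharmonic for large \<open>k\<close>.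
\<close>

lemma exterior_ball_decay:
  fixes p :: "'a::euclidean_space"
  assumes D: "open D" and v: "subharmonic_on D v" and \<kappa>: "0 < \<kappa>" and s: "0 < s"
    and q: "dist p q \<le> s" "ball q (\<kappa> * s) \<inter> D = {}"
    and m: "0 \<le> m" "\<And>x. x \<in> closure D \<Longrightarrow> dist p x \<le> 4 * s \<Longrightarrow> v x \<le> m"
    and bd: "\<And>x. x \<in> closure D \<Longrightarrow> x \<notin> D \<Longrightarrow> dist p x \<le> 4 * s \<Longrightarrow> v x \<le> 0"
    and x: "x \<in> D" "dist p x \<le> s"
  shows "v x \<le> decay_factor (Suc DIM('a)) \<kappa> * m"
proof -
  define k where "k = Suc DIM('a)"
  define \<Phi> where "\<Phi> = (\<lambda>x. inverse ((norm (x - q))\<^sup>2) ^ k)"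
  define A where "A = ((\<kappa> * s)\<^sup>2) ^ k"
  define B where "B = inverse ((3 * s)\<^sup>2) ^ k"
  define \<psi> where "\<psi> = (\<lambda>x. (m * (1 + A * B)) * 1 + (- (m * A)) * \<Phi> x)"
  define G where "G = D \<inter> ball q (3 * s)"
  have A: "0 < A"
    using \<kappa> s by (simp add: A_def)
  have qD: "ball q (\<kappa> * s) \<inter> closure D = {}"
    using q(2) open_Int_closure_eq_empty[of "ball q (\<kappa> * s)" D] by simp
  have "q \<in> ball q (\<kappa> * s)"
    using \<kappa> s by simp
  with qD have "q \<notin> closure D"
    by blast
  then have qn: "q \<notin> closure D" "q \<notin> D" "q \<notin> G"
    using closure_subset[of D] by (auto simp: G_def)
  have G: "open G" "G \<subseteq> D"
    using D by (auto simp: G_def)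
  have clG: "closure G \<subseteq> closure D" "closure G \<subseteq> cball q (3 * s)"
    using closure_mono[of G D] closure_mono[of G "ball q (3 * s)"] s by (auto simp: G_def)
  have near: "dist p y \<le> 4 * s" if "dist q y \<le> 3 * s" for y
    using that q(1) dist_triangle[of p y q] by linarith
  note \<Phi>2 = inverse_power_subharmonic[OF G(1) qn(3), of "DIM('a)", folded k_def, folded \<Phi>_def, simplified]
  have one: "C_on 2 G (\<lambda>x. 1)" "\<And>x. laplacian (\<lambda>x::'a. 1) x = 0"
    using harmonic_on_const[of UNIV 1] C_on_2_subset[of UNIV] by (auto simp: harmonic_on_def)
  have "v x \<le> \<psi> x"
  proof (rule subharmonic_onD[OF v G])
    show "continuous_on (closure G) \<psi>"
      unfolding \<psi>_def \<Phi>_def using qn clG by (intro continuous_intros) auto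
    show "C_on 2 G \<psi>"
      unfolding \<psi>_def by (rule C2_lincomb(1)[OF one(1) \<Phi>2(1) G(1)])
    show "laplacian \<psi> y \<le> 0" if "y \<in> G" for y
      unfolding \<psi>_def C2_lincomb(2)[OF one(1) \<Phi>2(1) G(1) that] one(2)
      using \<Phi>2(2)[OF that] A m(1) by simp
    show "v y \<le> \<psi> y" if "y \<in> frontier G" for y
    proof -
      have y: "y \<in> closure D" "dist q y \<le> 3 * s" "y \<notin> G"
        using that clG G(1) by (auto simp: frontier_def interior_open)
      have \<psi>y: "\<psi> y = m * (1 + A * B - A * \<Phi> y)"
        by (simp add: \<psi>_def algebra_simps)
      show ?thesis
      proof (cases "dist q y = 3 * s")
        case True
        then have "\<Phi> y = B"
          by (simp add: \<Phi>_def B_def dist_norm norm_minus_commute)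
        then have "\<psi> y = m"
          by (simp add: \<psi>y)
        then show ?thesis
          using m(2)[OF y(1) near[OF y(2)]] by simp
      next
        case False
        then have "y \<notin> D"
          using y by (auto simp: G_def)
        then have "v y \<le> 0"
          using bd[OF y(1) _ near[OF y(2)]] by simp
        moreover have "\<kappa> * s \<le> norm (y - q)"
          using qD y(1) by (force simp: dist_norm norm_minus_commute)
        then have "A * \<Phi> y \<le> ((norm (y - q))\<^sup>2) ^ k * \<Phi> y"
          unfolding A_def \<Phi>_def using \<kappa> s by (intro mult_right_mono power_mono) auto
        moreover have "((norm (y - q))\<^sup>2) ^ k * \<Phi> y = 1"
        proof -
          have "(norm (y - q))\<^sup>2 \<noteq> 0"
            using qn(1) y(1) by auto
          then show ?thesis
            unfolding \<Phi>_def power_mult_distrib[symmetric] by simp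
        qed
        moreover have "0 \<le> A * B"
          using A by (simp add: B_def)
        ultimately show ?thesis
          unfolding \<psi>y using m(1) by (smt (verit) mult_nonneg_nonneg)
      qed
    qed
    have "dist q x \<le> 2 * s"
      using x(2) q(1) dist_triangle[of q x p] by (simp add: dist_commute)
    then show "x \<in> G"
      using x(1) s by (simp add: G_def)
  qed
  also have "\<psi> x = m * (1 + A * B - A * \<Phi> x)"
    by (simp add: \<psi>_def algebra_simps)
  also have "\<dots> \<le> m * (1 + A * B - A * inverse ((2 * s)\<^sup>2) ^ k)"
  proof -
    have "norm (x - q) \<le> 2 * s"
      using x(2) q(1) dist_triangle[of q x p] by (simp add: dist_commute dist_norm norm_minus_commute)
    moreover have "0 < norm (x - q)"
      using x(1) qn by auto
    ultimately have "inverse ((2 * s)\<^sup>2) ^ k \<le> \<Phi> x"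
      unfolding \<Phi>_def by (intro power_mono le_imp_inverse_le) auto
    then show ?thesis
      using A m(1) by (intro mult_left_mono) auto
  qed
  also have "\<dots> = decay_factor k \<kappa> * m"
  proof -
    have A_eq: "A * inverse ((c * s)\<^sup>2) ^ k = (\<kappa>\<^sup>2) ^ k * inverse (c\<^sup>2) ^ k" for c
    proof -
      have "(\<kappa> * s)\<^sup>2 * inverse ((c * s)\<^sup>2) = \<kappa>\<^sup>2 * inverse (c\<^sup>2)"
        using s by (simp add: power_mult_distrib)
      from arg_cong[OF this, of "\<lambda>x. x ^ k"] show ?thesis
        by (simp only: A_def power_mult_distrib)
    qed
    have "1 + A * B - A * inverse ((2 * s)\<^sup>2) ^ k = decay_factor k \<kappa>"
      unfolding B_def A_eq decay_factor_def right_diff_distrib by linarith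
    then show ?thesis
      by (simp add: mult.commute)
  qed
  finally show ?thesis
    by (simp add: k_def)
qed

text \<open>The radius \<open>\<delta>\<close> does not depend on \<open>v\<close>, so the decay passes to the supremum of a family.\<close>

lemma boundary_decay:
  fixes p :: "'a::euclidean_space"
  assumes D: "open D" and \<kappa>: "0 < \<kappa>" "\<kappa> \<le> 1" and s\<^sub>0: "0 < s\<^sub>0"
    and ext: "\<And>s. 0 < s \<Longrightarrow> s \<le> s\<^sub>0 \<Longrightarrow> \<exists>q. dist p q \<le> s \<and> ball q (\<kappa> * s) \<inter> D = {}"
    and \<epsilon>: "0 < \<epsilon>"
  obtains \<delta> where "0 < \<delta>"
    "\<And>v x. \<lbrakk>subharmonic_on D v; \<And>x. x \<in> closure D \<Longrightarrow> v x \<le> 1;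
        \<And>x. x \<in> closure D \<Longrightarrow> x \<notin> D \<Longrightarrow> dist p x \<le> 4 * s\<^sub>0 \<Longrightarrow> v x \<le> 0; x \<in> D; dist p x \<le> \<delta>\<rbrakk> \<Longrightarrow> v x < \<epsilon>"
proof -
  define \<theta> where "\<theta> = decay_factor (Suc DIM('a)) \<kappa>"
  have \<theta>: "0 \<le> \<theta>" "\<theta> < 1"
    unfolding \<theta>_def by (rule decay_factor_bounds[OF \<kappa>])+
  then obtain n where n: "\<theta> ^ n < \<epsilon>"
    using real_arch_pow_inv[OF \<epsilon>] by blast
  have decay: "\<forall>x\<in>closure D. dist p x \<le> 4 * s\<^sub>0 / 4 ^ n \<longrightarrow> v x \<le> \<theta> ^ n"
    if v: "subharmonic_on D v" "\<And>x. x \<in> closure D \<Longrightarrow> v x \<le> 1"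
      "\<And>x. x \<in> closure D \<Longrightarrow> x \<notin> D \<Longrightarrow> dist p x \<le> 4 * s\<^sub>0 \<Longrightarrow> v x \<le> 0" for v n
  proof (induction n)
    case 0
    then show ?case using v(2) by simp
  next
    case (Suc n)
    define s where "s = s\<^sub>0 / 4 ^ n"
    have s: "0 < s" "s \<le> s\<^sub>0"
      using s\<^sub>0 by (auto simp: s_def field_simps)
    obtain q where q: "dist p q \<le> s" "ball q (\<kappa> * s) \<inter> D = {}"
      using ext[OF s] by blast
    show ?case
    proof (intro ballI impI)
      fix x assume x: "x \<in> closure D" "dist p x \<le> 4 * s\<^sub>0 / 4 ^ Suc n"
      then have xs: "dist p x \<le> s"
        by (simp add: s_def)
      show "v x \<le> \<theta> ^ Suc n"
      proof (cases "x \<in> D")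
        case True
        have "v x \<le> decay_factor (Suc DIM('a)) \<kappa> * \<theta> ^ n"
        proof (rule exterior_ball_decay[OF D v(1) \<kappa>(1) s(1) q _ _ _ True xs])
          show "v y \<le> \<theta> ^ n" if "y \<in> closure D" "dist p y \<le> 4 * s" for y
            using Suc that by (simp add: s_def)
          show "v y \<le> 0" if "y \<in> closure D" "y \<notin> D" "dist p y \<le> 4 * s" for y
            using v(3)[OF that(1,2)] that(3) s by simp
        qed (use \<theta> in simp)
        then show ?thesis
          by (simp add: \<theta>_def)
      next
        case False
        then have "v x \<le> 0"
          using v(3)[OF x(1)] xs s by simp
        then show ?thesis
          using \<theta> zero_le_power[of \<theta> "Suc n"] by linarith
      qed
    qed
  qed
  show ?thesis
  proof (rule that[of "4 * s\<^sub>0 / 4 ^ n"])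
    show "0 < 4 * s\<^sub>0 / 4 ^ n"
      using s\<^sub>0 by simp
    fix v x
    assume "subharmonic_on D v" "\<And>x. x \<in> closure D \<Longrightarrow> v x \<le> 1"
      "\<And>x. x \<in> closure D \<Longrightarrow> x \<notin> D \<Longrightarrow> dist p x \<le> 4 * s\<^sub>0 \<Longrightarrow> v x \<le> 0"
      and x: "x \<in> D" "dist p x \<le> 4 * s\<^sub>0 / 4 ^ n"
    from decay[OF this(1-3), of n] x closure_subset[of D] have "v x \<le> \<theta> ^ n"
      by blast
    with n show "v x < \<epsilon>" by simp
  qed
qed

section \<open>A harmonic function on a cylinder with flat lateral behaviour\<close>

text \<open>
  If \<open>\<omega>\<close> is near \<open>p\<close> the epigraph of an \<open>L\<close>-Lipschitz function in the direction \<open>\<nu>\<close>, then the ball of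
  radius \<open>\<kappa> s\<close> about \<open>p - s \<nu>\<close> stays below the graph as soon as \<open>\<kappa> (1 + L) \<le> 1\<close>.
\<close>

lemma lipschitz_exterior_balls:
  fixes \<omega> :: "'b::euclidean_space set"
  assumes "lipschitz_domain \<omega>" "p \<in> frontier \<omega>"
  obtains \<kappa> s\<^sub>1 where "0 < \<kappa>" "\<kappa> \<le> 1" "0 < s\<^sub>1"
    "\<And>s. 0 < s \<Longrightarrow> s \<le> s\<^sub>1 \<Longrightarrow> \<exists>q. dist p q \<le> s \<and> ball q (\<kappa> * s) \<inter> \<omega> = {}"
proof -
  obtain N \<nu> L g where N: "open N" "p \<in> N" and \<nu>: "norm \<nu> = 1"
    and L: "L-lipschitz_on {z. z \<bullet> \<nu> = 0} g"
    and \<omega>: "\<omega> \<inter> N = {y \<in> N. g (y - (y \<bullet> \<nu>) *\<^sub>R \<nu>) < y \<bullet> \<nu>}"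
    using assms unfolding lipschitz_domain_def by blast
  obtain \<rho> where \<rho>: "0 < \<rho>" "ball p \<rho> \<subseteq> N"
    using N open_contains_ball by blast
  have L0: "0 \<le> L"
    using L by (rule lipschitz_on_nonneg)
  define \<kappa> where "\<kappa> = 1 / (1 + L)"
  have \<kappa>: "0 < \<kappa>" "\<kappa> \<le> 1" "\<kappa> * (1 + L) = 1"
    using L0 by (auto simp: \<kappa>_def)
  define \<pi> where "\<pi> = (\<lambda>y. y - (y \<bullet> \<nu>) *\<^sub>R \<nu>)"
  have \<nu>\<nu>: "\<nu> \<bullet> \<nu> = 1"
    using \<nu> by (simp add: norm_eq_1)
  have mem: "y \<in> \<omega> \<longleftrightarrow> g (\<pi> y) < y \<bullet> \<nu>" if "y \<in> N" for y
  proof -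
    have "y \<in> \<omega> \<inter> N \<longleftrightarrow> y \<in> {y \<in> N. g (y - (y \<bullet> \<nu>) *\<^sub>R \<nu>) < y \<bullet> \<nu>}"
      by (simp only: \<omega>)
    then show ?thesis
      using that by (simp add: \<pi>_def)
  qed
  have "open \<omega>"
    using assms(1) by (simp add: lipschitz_domain_def)
  then have "p \<notin> \<omega>"
    using assms(2) by (simp add: frontier_def interior_open)
  then have gp: "p \<bullet> \<nu> \<le> g (\<pi> p)"
    using mem[OF N(2)] by simp
  show ?thesis
  proof (rule that[OF \<kappa>(1,2), of "\<rho> / 2"])
    show "0 < \<rho> / 2"
      using \<rho> by simp
    fix s assume s: "0 < s" "s \<le> \<rho> / 2"
    define q where "q = p - s *\<^sub>R \<nu>"
    have "y \<notin> \<omega>" if y: "dist q y < \<kappa> * s" for y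
    proof -
      have "\<kappa> * s \<le> s"
        using \<kappa> s by (simp add: mult_left_le_one_le)
      moreover have pq: "dist p q = s"
        using s \<nu> by (simp add: q_def dist_norm)
      ultimately have "dist p y < \<rho>"
        using y s dist_triangle[of p y q] by linarith
      then have yN: "y \<in> N"
        using \<rho> by auto
      define a where "a = y - q"
      have a: "norm a < \<kappa> * s"
        using y by (simp add: a_def dist_norm norm_minus_commute)
      have a\<nu>: "\<bar>a \<bullet> \<nu>\<bar> \<le> norm a"
        using Cauchy_Schwarz_ineq2[of a \<nu>] \<nu> by simp
      have \<pi>: "\<pi> y \<in> {z. z \<bullet> \<nu> = 0}" "\<pi> p \<in> {z. z \<bullet> \<nu> = 0}"
        by (auto simp: \<pi>_def inner_simps \<nu>\<nu>)
      have ya: "y = p - s *\<^sub>R \<nu> + a"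
        by (simp add: a_def q_def)
      have "\<pi> y - \<pi> p = a - (a \<bullet> \<nu>) *\<^sub>R \<nu>"
        unfolding \<pi>_def ya by (simp add: inner_simps \<nu>\<nu> algebra_simps)
      moreover have "(norm (a - (a \<bullet> \<nu>) *\<^sub>R \<nu>))\<^sup>2 = (norm a)\<^sup>2 - (a \<bullet> \<nu>)\<^sup>2"
        unfolding power2_norm_eq_inner by (simp add: inner_simps \<nu>\<nu> inner_commute power2_eq_square)
      then have "(norm (a - (a \<bullet> \<nu>) *\<^sub>R \<nu>))\<^sup>2 \<le> (norm a)\<^sup>2"
        by simp
      then have "norm (a - (a \<bullet> \<nu>) *\<^sub>R \<nu>) \<le> norm a"
        by (rule power2_le_imp_le) simp
      ultimately have "dist (\<pi> y) (\<pi> p) \<le> norm a"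
        by (simp add: dist_norm)
      then have "L * dist (\<pi> y) (\<pi> p) \<le> L * norm a"
        using L0 by (rule mult_left_mono)
      moreover have "dist (g (\<pi> y)) (g (\<pi> p)) \<le> L * dist (\<pi> y) (\<pi> p)"
        by (rule lipschitz_onD[OF L \<pi>])
      ultimately have "g (\<pi> p) - L * norm a \<le> g (\<pi> y)"
        by (simp add: dist_real_def)
      moreover have "y \<bullet> \<nu> = p \<bullet> \<nu> - s + a \<bullet> \<nu>"
        unfolding ya by (simp add: inner_simps \<nu>\<nu>)
      moreover have "norm a * (1 + L) \<le> s"
      proof -
        have "norm a * (1 + L) \<le> \<kappa> * s * (1 + L)"
          using a L0 by (intro mult_right_mono) auto
        also have "\<dots> = \<kappa> * (1 + L) * s"
          by (simp add: mult_ac)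
        finally show ?thesis
          using \<kappa>(3) by simp
      qed
      ultimately have "y \<bullet> \<nu> \<le> g (\<pi> y)"
        using gp a\<nu> by (simp add: algebra_simps)
      then show ?thesis
        using mem[OF yN] by simp
    qed
    moreover have "dist p q \<le> s"
      using s \<nu> by (simp add: q_def dist_norm)
    ultimately show "\<exists>q. dist p q \<le> s \<and> ball q (\<kappa> * s) \<inter> \<omega> = {}"
      by (intro exI[of _ q]) auto
  qed
qed

text \<open>
  The lateral zero boundary values are attained continuously, whatever happens at the two ends of
  the cylinder. The family of subharmonic competitors is nontrivial because it contains the positive
  part of the harmonic polynomial \<open>m t\<^sup>2 - \<bar>x - x\<^sub>0\<bar>\<^sup>2 + \<rho>\<^sup>2/4\<close>, where \<open>m\<close> is the dimension of \<open>\<omega>\<close>; the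
  height \<open>H\<close> is so small that this polynomial is negative on the lateral boundary.
\<close>

lemma cylinder_solution:
  fixes \<omega> :: "'b::euclidean_space set"
  assumes \<omega>: "lipschitz_domain \<omega>" and x\<^sub>0: "x\<^sub>0 \<in> \<omega>"
  obtains H :: real and u where "0 < H" "harmonic_on ({-H<..<H} \<times> \<omega>) u"
    "continuous_on ({-H<..<H} \<times> closure \<omega>) u"
    "\<And>t x. x \<in> frontier \<omega> \<Longrightarrow> u (t, x) = 0"
    "\<And>z. 0 \<le> u z" "\<And>z. u z \<le> 1" "0 < u (0, x\<^sub>0)"
proof -
  have op: "open \<omega>" and bd: "bounded \<omega>"
    using \<omega> by (auto simp: lipschitz_domain_def)
  obtain \<rho> where \<rho>: "0 < \<rho>" "ball x\<^sub>0 \<rho> \<subseteq> \<omega>"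
    using op x\<^sub>0 open_contains_ball by blast
  define m where "m = real DIM('b)"
  have m: "0 < m"
    by (simp add: m_def)
  define H where "H = \<rho> / (2 * sqrt m)"
  have H: "0 < H" "m * H\<^sup>2 = \<rho>\<^sup>2 / 4"
    using \<rho> m by (auto simp: H_def power_divide power_mult_distrib)
  define D where "D = {-H<..<H} \<times> \<omega>"
  have D: "open D" "bounded D"
    unfolding D_def using op bd by (auto intro: open_Times bounded_Times)
  have clD: "closure D = {-H..H} \<times> closure \<omega>"
    unfolding D_def closure_Times using H by simp
  have fr: "frontier \<omega> = closure \<omega> - \<omega>"
    using op by (simp add: frontier_def interior_open)
  define F where "F = {v. subharmonic_on D v \<and> (\<forall>x\<in>closure D. 0 \<le> v x \<and> v x \<le> 1) \<and>
      (\<forall>x\<in>closure D. snd x \<in> frontier \<omega> \<longrightarrow> v x = 0)}"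
  have lat: "v z = 0" if "v \<in> F" "z \<in> closure D" "snd z \<in> frontier \<omega>" for v z
    using that by (auto simp: F_def)
  define e where "e = (1::real, 0::'b)"
  have e: "e \<in> Basis"
    by (simp add: e_def Basis_prod_def)
  define q where "q = (\<lambda>z. (m + 1) * ((z \<bullet> e) * (z \<bullet> e)) + (- 1) * (norm (z - (0, x\<^sub>0)))\<^sup>2 + \<rho>\<^sup>2 / 4)"
  have q: "q (t, x) = m * t\<^sup>2 - (norm (x - x\<^sub>0))\<^sup>2 + \<rho>\<^sup>2 / 4" for t x
    by (simp add: q_def e_def norm_Pair power2_eq_square algebra_simps)
  have "harmonic_poly q"
  proof -
    have p1: "real_polynomial_function (\<lambda>z. (z \<bullet> e) * (z \<bullet> e))"
      by (intro real_polynomial_function.intros(4) polynomial_coord)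
    have "laplacian (\<lambda>z. (z \<bullet> e) * (z \<bullet> e)) x = 2" for x
    proof -
      have "laplacian (\<lambda>z. z \<bullet> e) x = 0"
        by (simp add: laplacian_def partial_deriv_coord partial_deriv_const)
      moreover have "(\<Sum>c\<in>Basis. (c \<bullet> e) * (c \<bullet> e)) = e \<bullet> e"
        by (subst (3) euclidean_inner) (simp add: inner_commute)
      ultimately show ?thesis
        using e by (simp add: laplacian_mult polynomial_coord partial_deriv_coord)
    qed
    note L1 = this
    have n: "real_polynomial_function (\<lambda>z. (norm (z - (0::real, x\<^sub>0)))\<^sup>2)"
      by (rule polynomial_norm_power2)
    note p2 = real_polynomial_function.intros(4)[OF real_polynomial_function.intros(2)[of "m + 1"] p1]
      real_polynomial_function.intros(4)[OF real_polynomial_function.intros(2)[of "- 1"] n]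
    have "laplacian q x = 0" for x
      unfolding q_def laplacian_add[OF real_polynomial_function.intros(3)[OF p2] real_polynomial_function.intros(2)]
        laplacian_add[OF p2] laplacian_cmult[OF p1] laplacian_cmult[OF polynomial_norm_power2]
        L1 laplacian_norm_power2 laplacian_const
      by (simp add: m_def)
    moreover have "real_polynomial_function q"
      unfolding q_def
      by (rule real_polynomial_function.intros(3)[OF real_polynomial_function.intros(3)[OF p2] real_polynomial_function.intros(2)])
    ultimately show ?thesis
      by (simp add: harmonic_poly_def)
  qed
  define v\<^sub>0 where "v\<^sub>0 = (\<lambda>z. max 0 ((1 / \<rho>\<^sup>2) * q z))"
  have v0F: "v\<^sub>0 \<in> F"
  proof -
    have hq: "harmonic_poly (\<lambda>z. (1 / \<rho>\<^sup>2) * q z)"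
      by (rule harmonic_poly_cmult[OF \<open>harmonic_poly q\<close>])
    then have "subharmonic_on D (\<lambda>z. (1 / \<rho>\<^sup>2) * q z)"
      by (intro harmonic_imp_subharmonic D harmonic_poly_harmonic_on polynomial_continuous)
        (auto simp: harmonic_poly_def)
    moreover have "subharmonic_on D (\<lambda>z. 0)"
      by (intro harmonic_imp_subharmonic D harmonic_on_const continuous_on_const)
    ultimately have "subharmonic_on D v\<^sub>0"
      unfolding v\<^sub>0_def by (rule_tac subharmonic_on_max)
    moreover have qb: "q (t, x) \<le> \<rho>\<^sup>2 / 2 - (norm (x - x\<^sub>0))\<^sup>2" if "(t, x) \<in> closure D" for t x
    proof -
      have "t\<^sup>2 \<le> H\<^sup>2"
        using that H by (auto simp: clD intro!: abs_le_square_iff[THEN iffD1])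
      then have "m * t\<^sup>2 \<le> \<rho>\<^sup>2 / 4"
        using H(2) m by (metis mult_le_cancel_left_pos)
      then show ?thesis
        by (simp add: q)
    qed
    moreover have "v\<^sub>0 z \<le> 1" if "z \<in> closure D" for z
    proof (cases z)
      case (Pair t x)
      have "q z \<le> \<rho>\<^sup>2"
        using qb[of t x] that zero_le_power2[of "norm (x - x\<^sub>0)"] zero_le_power2[of \<rho>]
        unfolding Pair by linarith
      then show ?thesis
        using \<rho> by (simp add: v\<^sub>0_def field_simps)
    qed
    moreover have "v\<^sub>0 z = 0" if "z \<in> closure D" "snd z \<in> frontier \<omega>" for z
    proof (cases z)
      case (Pair t x)
      have "x \<notin> ball x\<^sub>0 \<rho>"
        using that \<rho> Pair fr by auto
      then have "\<rho> \<le> norm (x - x\<^sub>0)"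
        by (simp add: dist_norm norm_minus_commute)
      then have "\<rho>\<^sup>2 \<le> (norm (x - x\<^sub>0))\<^sup>2"
        using \<rho> by (intro power_mono) auto
      then have "q z \<le> 0"
        using qb[of t x] that(1) zero_le_power2[of \<rho>] unfolding Pair by linarith
      then show ?thesis
        using \<rho> by (simp add: v\<^sub>0_def max_def divide_le_0_iff field_simps)
    qed
    ultimately show ?thesis
      by (auto simp: F_def v\<^sub>0_def)
  qed
  have clsub: "D \<subseteq> closure D"
    by (rule closure_subset)
  have PF: "perron_family D F"
    unfolding perron_family_def
  proof (intro conjI ballI allI impI)
    show "F \<noteq> {}"
      using v0F by blast
    fix v assume v: "v \<in> F"
    show "subharmonic_on D v"
      using v by (simp add: F_def)
    show "0 \<le> v x" "v x \<le> 1" if "x \<in> D" for x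
      using v that clsub by (auto simp: F_def)
    show "(\<lambda>x. max (v x) (w x)) \<in> F" if "w \<in> F" for w
      using v that by (auto simp: F_def le_max_iff_disj intro: subharmonic_on_max)
    fix z r h
    assume "0 < r \<and> cball z r \<subseteq> D \<and> continuous_on (cball z r) h \<and> harmonic_on (ball z r) h \<and>
        (\<forall>x\<in>sphere z r. h x = v x)"
    then have r: "0 < r" "cball z r \<subseteq> D"
      and h: "continuous_on (cball z r) h" "harmonic_on (ball z r) h" "\<And>x. x \<in> sphere z r \<Longrightarrow> h x = v x"
      by auto
    have vs: "subharmonic_on D v"
      using v by (simp add: F_def)
    have lift1: "subharmonic_on D (\<lambda>x. if x \<in> ball z r then h x else v x)"
      by (rule harmonic_lift(1)[OF vs D r h])
    have lift2: "v x \<le> h x" if "x \<in> ball z r" for x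
      by (rule harmonic_lift(2)[OF vs D r h that])
    have h1: "h x \<le> 1" if "x \<in> ball z r" for x
    proof -
      have "\<bar>h x\<bar> \<le> 1"
      proof (rule harmonic_bound[OF open_ball bounded_ball _ h(2)])
        show "\<bar>h y\<bar> \<le> 1" if "y \<in> frontier (ball z r)" for y
        proof -
          have y: "y \<in> sphere z r"
            using that r by (simp add: frontier_ball)
          then have "y \<in> closure D"
            using r(2) clsub sphere_cball[of z r] by blast
          then show ?thesis
            using h(3)[OF y] v by (auto simp: F_def)
        qed
      qed (use h(1) r that in auto)
      then show ?thesis by simp
    qed
    have ball: "ball z r \<subseteq> D"
      using r(2) ball_subset_cball[of z r] by blast
    have "0 \<le> h x" if "x \<in> ball z r" for x
      using lift2[OF that] v that ball clsub by (force simp: F_def)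
    moreover have "snd x \<notin> frontier \<omega>" if "x \<in> ball z r" for x
      using that ball by (auto simp: D_def fr)
    ultimately show "(\<lambda>x. if x \<in> ball z r then h x else v x) \<in> F"
      using lift1 h1 v by (auto simp: F_def)
  qed
  define s where "s = (\<lambda>z. SUP v\<in>F. v z)"
  define u where "u = (\<lambda>z. if z \<in> D then s z else 0)"
  have Fne: "F \<noteq> {}"
    using v0F by blast
  have F01: "0 \<le> v z" "v z \<le> 1" if "v \<in> F" "z \<in> D" for v z
    using that clsub by (auto simp: F_def)
  have upper: "v z \<le> s z" if "v \<in> F" "z \<in> D" for v z
    unfolding s_def
  proof (rule cSUP_upper[OF that(1)])
    show "bdd_above ((\<lambda>v. v z) ` F)"
      using F01(2)[OF _ that(2)] by (intro bdd_aboveI[of _ 1]) auto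
  qed
  have s_least: "s z \<le> M" if "\<And>v. v \<in> F \<Longrightarrow> v z \<le> M" for z M
    unfolding s_def by (rule cSUP_least[OF Fne that])
  have "harmonic_on D s"
    unfolding s_def by (rule perron_harmonic[OF D PF])
  then have hu: "harmonic_on D u"
    by (rule harmonic_on_cong[OF _ D(1)]) (simp add: u_def)
  show ?thesis
  proof (rule that[OF H(1)])
    show "harmonic_on ({-H<..<H} \<times> \<omega>) u"
      using hu by (simp add: D_def)
    show "u (t, x) = 0" if "x \<in> frontier \<omega>" for t x
      using that by (simp add: u_def D_def fr)
    show u0: "0 \<le> u z" for z
      using order_trans[OF F01(1)[OF v0F] upper[OF v0F], of z] by (simp add: u_def)
    show "u z \<le> 1" for z
      using s_least[of z 1] F01(2) by (auto simp: u_def)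
    have "(0, x\<^sub>0) \<in> D"
      using H x\<^sub>0 by (simp add: D_def)
    moreover have "0 < v\<^sub>0 (0, x\<^sub>0)"
      using \<rho> by (simp add: v\<^sub>0_def q)
    ultimately show "0 < u (0, x\<^sub>0)"
      using upper[OF v0F, of "(0, x\<^sub>0)"] by (simp add: u_def)
    show "continuous_on ({-H<..<H} \<times> closure \<omega>) u"
      unfolding continuous_on_eq_continuous_within
    proof
      fix p assume p: "p \<in> {-H<..<H} \<times> closure \<omega>"
      obtain t\<^sub>0 p' where pp: "p = (t\<^sub>0, p')"
        by fastforce
      show "continuous (at p within {-H<..<H} \<times> closure \<omega>) u"
      proof (cases "p \<in> D")
        case True
        have "continuous_on D u"
          using hu C_on_2_continuous by (auto simp: harmonic_on_def)
        then show ?thesis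
          using True D(1) by (simp add: continuous_on_eq_continuous_at continuous_at_imp_continuous_within)
      next
        case False
        then have p': "p' \<in> frontier \<omega>" "\<bar>t\<^sub>0\<bar> < H"
          using p by (auto simp: pp D_def fr)
        obtain \<kappa> s\<^sub>1 where \<kappa>: "0 < \<kappa>" "\<kappa> \<le> 1" and s1: "0 < s\<^sub>1"
          and ext: "\<And>s. 0 < s \<Longrightarrow> s \<le> s\<^sub>1 \<Longrightarrow> \<exists>q. dist p' q \<le> s \<and> ball q (\<kappa> * s) \<inter> \<omega> = {}"
          using lipschitz_exterior_balls[OF \<omega> p'(1)] by blast
        \<comment> \<open>the scales used must not reach the ends of the cylinder, where \<open>v\<close> need not be small\<close>
        define s\<^sub>0 where "s\<^sub>0 = min s\<^sub>1 ((H - \<bar>t\<^sub>0\<bar>) / 8)"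
        have s0: "0 < s\<^sub>0" "s\<^sub>0 \<le> s\<^sub>1" "4 * s\<^sub>0 < H - \<bar>t\<^sub>0\<bar>"
          using s1 p'(2) by (auto simp: s\<^sub>0_def min_def)
        have ext': "\<exists>q. dist p q \<le> s \<and> ball q (\<kappa> * s) \<inter> D = {}" if s: "0 < s" "s \<le> s\<^sub>0" for s
        proof -
          obtain q where q: "dist p' q \<le> s" "ball q (\<kappa> * s) \<inter> \<omega> = {}"
            using ext[of s] s s0 by auto
          have "(t, y) \<notin> D" if "dist (t\<^sub>0, q) (t, y) < \<kappa> * s" for t y
          proof -
            have "dist q y < \<kappa> * s"
              using dist_snd_le[of "(t\<^sub>0, q)" "(t, y)"] that by simp
            then show ?thesis
              using q(2) by (auto simp: D_def)
          qed
          then show ?thesis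
            using q(1) by (intro exI[of _ "(t\<^sub>0, q)"]) (auto simp: pp dist_Pair_Pair)
        qed
        have near: "snd z \<in> frontier \<omega>" if "z \<in> closure D" "z \<notin> D" "dist p z \<le> 4 * s\<^sub>0" for z
        proof -
          have "\<bar>fst z - t\<^sub>0\<bar> \<le> 4 * s\<^sub>0"
            using dist_fst_le[of p z] that(3) by (simp add: pp dist_real_def)
          then have "fst z \<in> {-H<..<H}"
            using s0(3) by auto
          then show ?thesis
            using that(2) that(1)[unfolded clD] by (cases z) (auto simp: D_def fr)
        qed
        have "u p = 0"
          using False by (simp add: u_def)
        show ?thesis
          unfolding continuous_within_eps_delta
        proof (intro allI impI)
          fix \<epsilon> :: real assume \<epsilon>: "0 < \<epsilon>"
          obtain \<delta> where \<delta>: "0 < \<delta>"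
            "\<And>v x. \<lbrakk>subharmonic_on D v; \<And>x. x \<in> closure D \<Longrightarrow> v x \<le> 1;
              \<And>x. x \<in> closure D \<Longrightarrow> x \<notin> D \<Longrightarrow> dist p x \<le> 4 * s\<^sub>0 \<Longrightarrow> v x \<le> 0; x \<in> D; dist p x \<le> \<delta>\<rbrakk>
              \<Longrightarrow> v x < \<epsilon> / 2"
            using boundary_decay[OF D(1) \<kappa> s0(1) ext', of "\<epsilon> / 2"] \<epsilon> by (metis half_gt_zero)
          have small: "v z \<le> \<epsilon> / 2" if v: "v \<in> F" and z: "z \<in> D" "dist p z \<le> \<delta>" for v z
          proof (rule less_imp_le, rule \<delta>(2)[OF _ _ _ z])
            show "subharmonic_on D v" "\<And>x. x \<in> closure D \<Longrightarrow> v x \<le> 1"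
              using v by (auto simp: F_def)
            show "v x \<le> 0" if "x \<in> closure D" "x \<notin> D" "dist p x \<le> 4 * s\<^sub>0" for x
              using lat[OF v that(1) near[OF that]] by simp
          qed
          show "\<exists>d>0. \<forall>z\<in>{-H<..<H} \<times> closure \<omega>. dist z p < d \<longrightarrow> dist (u z) (u p) < \<epsilon>"
          proof (intro exI[of _ \<delta>] conjI ballI impI)
            fix z assume "dist z p < \<delta>"
            then have "u z \<le> \<epsilon> / 2"
              using s_least[of z "\<epsilon> / 2"] small \<epsilon> by (auto simp: u_def dist_commute)
            then show "dist (u z) (u p) < \<epsilon>"
              using u0[of z] \<open>u p = 0\<close> \<epsilon> by (simp add: dist_real_def)
          qed (rule \<delta>)
        qed
      qed
    qed
  qed
qed

text \<open>
  A harmonic function on a slab of thickness \<open>d\<close> that vanishes at the bottom and on the lateral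
  boundary grows at most linearly in the axial direction, uniformly up to the lateral boundary.
\<close>

lemma slab_comparison:
  fixes \<omega> :: "'b::euclidean_space set"
  assumes \<omega>: "open \<omega>" "bounded \<omega>" and d: "0 < d" and M: "0 \<le> M"
    and \<phi>: "continuous_on ({0..d} \<times> closure \<omega>) \<phi>" "harmonic_on ({0<..<d} \<times> \<omega>) \<phi>"
    and bottom: "\<And>x. x \<in> closure \<omega> \<Longrightarrow> \<phi> (0, x) = 0"
    and lateral: "\<And>t x. 0 \<le> t \<Longrightarrow> t \<le> d \<Longrightarrow> x \<in> frontier \<omega> \<Longrightarrow> \<phi> (t, x) = 0"
    and top: "\<And>x. x \<in> closure \<omega> \<Longrightarrow> \<bar>\<phi> (d, x)\<bar> \<le> M"
    and t: "0 \<le> t" "t \<le> d" and x: "x \<in> \<omega>"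
  shows "\<bar>\<phi> (t, x)\<bar> \<le> M * t / d"
proof -
  define G where "G = {0<..<d} \<times> \<omega>"
  have G: "open G" "bounded G"
    unfolding G_def using \<omega> by (auto intro: open_Times bounded_Times)
  have clG: "closure G = {0..d} \<times> closure \<omega>"
    unfolding G_def closure_Times using d by simp
  define \<psi> where "\<psi> = (\<lambda>z::real \<times> 'b. (M / d) * (z \<bullet> (1, 0)))"
  have poly: "real_polynomial_function \<psi>"
    unfolding \<psi>_def by (intro real_polynomial_function.intros(2,4) polynomial_coord)
  have lap: "laplacian \<psi> z = 0" for z
    unfolding \<psi>_def laplacian_cmult[OF polynomial_coord]
    by (simp add: laplacian_def partial_deriv_coord partial_deriv_const)
  have fr: "\<bar>\<phi> z\<bar> \<le> \<psi> z" if "z \<in> frontier G" for z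
  proof (cases z)
    case (Pair s y)
    have sy: "0 \<le> s" "s \<le> d" "y \<in> closure \<omega>" "(s, y) \<notin> G"
      using that clG G(1) Pair by (auto simp: frontier_def interior_open)
    have \<psi>: "\<psi> z = M * s / d"
      by (simp add: \<psi>_def Pair)
    consider "s = 0" | "s = d" | "y \<in> frontier \<omega>"
      using sy \<omega>(1) by (auto simp: G_def frontier_def interior_open)
    then show ?thesis
    proof cases
      case 1
      then show ?thesis using bottom[OF sy(3)] by (simp add: Pair \<psi>_def)
    next
      case 2
      then show ?thesis using top[OF sy(3)] d by (simp add: Pair \<psi>_def)
    next
      case 3
      then show ?thesis using lateral[OF sy(1,2)] sy M d by (simp add: \<psi>) (simp add: Pair)
    qed
  qed
  have *: "\<phi>' (t, x) \<le> \<psi> (t, x)"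
    if \<phi>': "continuous_on (closure G) \<phi>'" "harmonic_on G \<phi>'" "\<And>z. z \<in> frontier G \<Longrightarrow> \<phi>' z \<le> \<psi> z"
      and "(t, x) \<in> G" for \<phi>'
    by (rule comparison_principle[OF G \<phi>'(1) _ \<phi>'(2) _ _ \<phi>'(3) that(4)])
      (use lap poly in \<open>auto intro: polynomial_C_on polynomial_continuous\<close>)
  consider "t = 0" | "t = d" | "(t, x) \<in> G"
    using t x by (cases "t = 0"; cases "t = d") (auto simp: G_def)
  then show ?thesis
  proof cases
    case 1
    then show ?thesis using bottom[of x] x closure_subset[of \<omega>] by auto
  next
    case 2
    then show ?thesis using top[of x] x closure_subset[of \<omega>] d by auto
  next
    case 3
    have "\<phi> (t, x) \<le> \<psi> (t, x)"
      using fr \<phi> 3 by (intro *) (auto simp: clG G_def[symmetric] abs_le_iff)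
    moreover have "(-1) * \<phi> (t, x) \<le> \<psi> (t, x)"
      using fr \<phi> 3 harmonic_on_cmult[OF \<phi>(2)[folded G_def] G(1), of "-1"]
      by (intro *) (auto simp: clG abs_le_iff intro!: continuous_intros)
    ultimately show ?thesis
      by (simp add: \<psi>_def)
  qed
qed

text \<open>
  Evenness in the axial variable \<open>t\<close> and the slab comparison, applied to first and then to
  second order differences in \<open>t\<close>, give \<open>\<bar>\<partial>\<^sub>t U\<bar> \<le> K \<bar>t\<bar>\<close> uniformly up to the lateral boundary.
\<close>

lemma flat_cylinder_solution:
  fixes \<omega> :: "'b::euclidean_space set"
  assumes \<omega>: "lipschitz_domain \<omega>"
  obtains H :: real and U K b y where "0 < H" "harmonic_on ({-H<..<H} \<times> \<omega>) U"
    "continuous_on ({-H<..<H} \<times> closure \<omega>) U"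
    "\<And>t x. x \<in> frontier \<omega> \<Longrightarrow> U (t, x) = 0" "\<And>z. \<bar>U z\<bar> \<le> 2"
    "0 \<le> K" "\<And>t x. \<bar>t\<bar> < H \<Longrightarrow> x \<in> \<omega> \<Longrightarrow> \<bar>partial_deriv (1, 0) U (t, x)\<bar> \<le> K * \<bar>t\<bar>"
    "b \<in> Basis" "y \<in> \<omega>" "partial_deriv (0, b) U (0, y) \<noteq> 0"
proof -
  have op: "open \<omega>" and bd: "bounded \<omega>" and "\<omega> \<noteq> {}"
    using \<omega> by (auto simp: lipschitz_domain_def)
  then obtain x\<^sub>0 where x0: "x\<^sub>0 \<in> \<omega>"
    by blast
  obtain H :: real and u where H: "0 < H" and u: "harmonic_on ({-H<..<H} \<times> \<omega>) u"
    "continuous_on ({-H<..<H} \<times> closure \<omega>) u" "\<And>t x. x \<in> frontier \<omega> \<Longrightarrow> u (t, x) = 0"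
    "\<And>z. 0 \<le> u z" "\<And>z. u z \<le> 1" "0 < u (0, x\<^sub>0)"
    by (rule cylinder_solution[OF \<omega> x0]) blast
  define e where "e = (1::real, 0::'b)"
  have e: "e \<in> Basis"
    by (simp add: e_def Basis_prod_def)
  have refl: "reflect e 0 (t, x) = (- t, x)" for t x
    by (simp add: reflect_def e_def)
  define U where "U = (\<lambda>z. 1 * u z + 1 * u (reflect e 0 z))"
  have U: "U (t, x) = u (t, x) + u (- t, x)" for t x
    by (simp add: U_def refl)
  have opH: "open ({-H<..<H} \<times> \<omega>)"
    using op by (auto intro: open_Times)
  have hU: "harmonic_on ({-H<..<H} \<times> \<omega>) U"
    unfolding U_def
    by (rule harmonic_on_lincomb[OF u(1) harmonic_on_reflect[OF u(1) e opH] opH]) (auto simp: refl)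
  have cU: "continuous_on ({-H<..<H} \<times> closure \<omega>) U"
    unfolding U_def
    by (intro continuous_on_add continuous_on_mult_left u(2) continuous_on_compose2[OF u(2) continuous_reflect])
      (auto simp: refl)
  have U0: "U (t, x) = 0" if "x \<in> frontier \<omega>" for t x
    using u(3)[OF that] by (simp add: U)
  have U02: "0 \<le> U z" "U z \<le> 2" for z
    using u(4)[of z] u(4)[of "reflect e 0 z"] u(5)[of z] u(5)[of "reflect e 0 z"] by (auto simp: U_def)
  define d where "d = H / 4"
  have d: "0 < d" "H = 4 * d"
    using H by (auto simp: d_def)
  \<comment> \<open>\<open>d = H/4\<close> leaves room for translating the slab of thickness \<open>d\<close> by up to \<open>2d\<close> both ways\<close>
  have shift_h: "harmonic_on ({0<..<d} \<times> \<omega>) (\<lambda>z. U (z + (a, 0)))" if "\<bar>a\<bar> \<le> 2 * d" for a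
    by (rule harmonic_on_translate[OF hU]) (use that d in auto)
  have shift_c: "continuous_on ({0..d} \<times> closure \<omega>) (\<lambda>z. U (z + (a, 0)))" if "\<bar>a\<bar> \<le> 2 * d" for a
    by (rule continuous_on_compose2[OF cU]) (use that d in \<open>auto intro!: continuous_intros\<close>)
  have opd: "open ({0<..<d} \<times> \<omega>)"
    using op by (auto intro: open_Times)
  have U_even: "U (- t, x) = U (t, x)" for t x
    by (simp add: U add.commute)
  have diff1: "\<bar>U (a + t, x) - U (a - t, x)\<bar> \<le> 2 * t / d"
    if a: "\<bar>a\<bar> \<le> d" and t: "0 \<le> t" "t \<le> d" and x: "x \<in> \<omega>" for a t x
  proof -
    define \<phi> where "\<phi> = (\<lambda>z. U (z + (a, 0)) - U (z + (- a, 0)))"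
    have \<phi>: "\<phi> (t, x) = U (a + t, x) - U (a - t, x)" for t x
      using U_even[of "t - a" x] by (simp add: \<phi>_def add.commute)
    have "\<bar>\<phi> (t, x)\<bar> \<le> 2 * t / d"
    proof (rule slab_comparison[OF op bd d(1) _ _ _ _ _ _ t x])
      show "continuous_on ({0..d} \<times> closure \<omega>) \<phi>" "harmonic_on ({0<..<d} \<times> \<omega>) \<phi>"
        unfolding \<phi>_def using a d
        by (auto intro!: continuous_on_diff shift_c harmonic_on_diff shift_h opd)
      show "\<bar>\<phi> (d, x)\<bar> \<le> 2" for x
        using U02[of "(a + d, x)"] U02[of "(a - d, x)"] by (simp add: \<phi>)
    qed (auto simp: \<phi> U0)
    then show ?thesis
      by (simp add: \<phi>)
  qed
  have diff2: "\<bar>U (t + \<sigma>, x) - U (t - \<sigma>, x)\<bar> \<le> 2 * (t / d\<^sup>2) * \<sigma>"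
    if \<sigma>: "0 \<le> \<sigma>" "\<sigma> \<le> d" and t: "0 \<le> t" "t \<le> d" and x: "x \<in> \<omega>" for \<sigma> t x
  proof -
    define \<phi> where "\<phi> = (\<lambda>z. U (z + (\<sigma>, 0)) - U (z + (- \<sigma>, 0)))"
    have \<phi>: "\<phi> (t, x) = U (t + \<sigma>, x) - U (t - \<sigma>, x)" for t x
      by (simp add: \<phi>_def)
    have "\<bar>\<phi> (t, x)\<bar> \<le> (2 * \<sigma> / d) * t / d"
    proof (rule slab_comparison[OF op bd d(1) _ _ _ _ _ _ t x])
      show "continuous_on ({0..d} \<times> closure \<omega>) \<phi>" "harmonic_on ({0<..<d} \<times> \<omega>) \<phi>"
        unfolding \<phi>_def using \<sigma> d
        by (auto intro!: continuous_on_diff shift_c harmonic_on_diff shift_h opd)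
      show "\<phi> (0, x) = 0" for x
        using U_even[of \<sigma> x] by (simp add: \<phi>)
      show "\<bar>\<phi> (d, x)\<bar> \<le> 2 * \<sigma> / d" if "x \<in> closure \<omega>" for x
      proof (cases "x \<in> \<omega>")
        case True
        then show ?thesis
          using diff1[of d \<sigma> x] \<sigma> d by (simp add: \<phi>)
      next
        case False
        then have "x \<in> frontier \<omega>"
          using that op by (simp add: frontier_def interior_open)
        then show ?thesis
          using \<sigma> d by (simp add: \<phi> U0)
      qed
    qed (use \<sigma> d in \<open>auto simp: \<phi> U0\<close>)
    then show ?thesis
      by (simp add: \<phi> power2_eq_square mult_ac)
  qed
  have sub: "{-d<..<d} \<times> \<omega> \<subseteq> {-H<..<H} \<times> \<omega>"
    using d by auto
  have deriv: "\<bar>partial_deriv e U (t, x)\<bar> \<le> (1 / d\<^sup>2) * \<bar>t\<bar>" if t: "\<bar>t\<bar> < d" and x: "x \<in> \<omega>" for t x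
  proof (rule has_pd_symmetric_bound[OF _ d(1)])
    show "has_pd e U (t, x) (partial_deriv e U (t, x))"
      using hU e t x d unfolding harmonic_on_def by (intro C_on_2_has_pd[where S = "{-H<..<H} \<times> \<omega>"]) auto
    fix \<sigma> :: real assume \<sigma>: "\<bar>\<sigma>\<bar> < d"
    have *: "\<bar>U (t + \<sigma>, x) - U (t - \<sigma>, x)\<bar> \<le> 2 * (\<bar>t\<bar> / d\<^sup>2) * \<bar>\<sigma>\<bar>"
      using diff2[of "\<bar>\<sigma>\<bar>" "\<bar>t\<bar>" x] \<sigma> t x U_even[of "t + \<sigma>" x] U_even[of "t - \<sigma>" x]
      by (cases "0 \<le> t"; cases "0 \<le> \<sigma>") (auto simp: abs_minus_commute)
    then show "\<bar>U ((t, x) + \<sigma> *\<^sub>R e) - U ((t, x) - \<sigma> *\<^sub>R e)\<bar> \<le> 2 * (1 / d\<^sup>2 * \<bar>t\<bar>) * \<bar>\<sigma>\<bar>"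
      by (simp add: e_def)
  qed
  \<comment> \<open>otherwise \<open>U\<close> would be constant on the segment from \<open>x\<^sub>0\<close>, where it is positive, to \<open>\<partial>\<omega>\<close>, where it is \<open>0\<close>\<close>
  obtain b :: 'b where b: "b \<in> Basis"
    using nonempty_Basis by blast
  have b': "(0, b) \<in> (Basis :: (real \<times> 'b) set)"
    using b by (simp add: Basis_prod_def)
  have "\<exists>y\<in>\<omega>. partial_deriv (0, b) U (0, y) \<noteq> 0"
  proof (rule ccontr)
    assume "\<not> ?thesis"
    then have zero: "partial_deriv (0, b) U (0, y) = 0" if "y \<in> \<omega>" for y
      using that by blast
    obtain l where l: "0 < l" "x\<^sub>0 + l *\<^sub>R b \<in> frontier \<omega>" "\<And>r. 0 \<le> r \<Longrightarrow> r < l \<Longrightarrow> x\<^sub>0 + r *\<^sub>R b \<in> interior \<omega>"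
      using ray_to_frontier[OF bd, of x\<^sub>0 b] x0 op b by (auto simp: interior_open nonzero_Basis)
    have in\<omega>: "x\<^sub>0 + r *\<^sub>R b \<in> \<omega>" if "0 \<le> r" "r < l" for r
      using l(3)[OF that] op by (simp add: interior_open)
    define f where "f = (\<lambda>r. U (0, x\<^sub>0 + r *\<^sub>R b))"
    have "f l = f 0"
    proof (rule DERIV_isconst_end[OF l(1)])
      have "x\<^sub>0 + r *\<^sub>R b \<in> closure \<omega>" if "0 \<le> r" "r \<le> l" for r
      proof (cases "r = l")
        case True
        then show ?thesis using l(2) by (simp add: frontier_def)
      next
        case False
        then show ?thesis using in\<omega>[of r] that closure_subset[of \<omega>] by auto
      qed
      then show "continuous_on {0..l} f"
        unfolding f_def using H
        by (intro continuous_on_compose2[OF cU]) (auto intro!: continuous_intros)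
      fix r assume r: "0 < r" "r < l"
      have "has_pd (0, b) U (0, x\<^sub>0 + r *\<^sub>R b) (partial_deriv (0, b) U (0, x\<^sub>0 + r *\<^sub>R b))"
        using hU b' in\<omega>[of r] r H unfolding harmonic_on_def
        by (intro C_on_2_has_pd[where S = "{-H<..<H} \<times> \<omega>"]) auto
      then have "has_pd (0, b) U ((0, x\<^sub>0) + r *\<^sub>R (0, b)) 0"
        using zero in\<omega>[of r] r by simp
      from has_pd_line[OF this] show "(f has_real_derivative 0) (at r)"
        by (simp add: f_def)
    qed
    moreover have "f l = 0"
      using U0[OF l(2)] by (simp add: f_def)
    moreover have "0 < f 0"
      using u(6) by (simp add: f_def U)
    ultimately show False by simp
  qed
  then obtain y where y: "y \<in> \<omega>" "partial_deriv (0, b) U (0, y) \<noteq> 0"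
    by blast
  show ?thesis
  proof (rule that[of d U "1 / d\<^sup>2" b y])
    show "harmonic_on ({-d<..<d} \<times> \<omega>) U"
      by (rule harmonic_on_subset[OF hU sub])
    show "continuous_on ({-d<..<d} \<times> closure \<omega>) U"
      by (rule continuous_on_subset[OF cU]) (use d in auto)
    show "\<bar>U z\<bar> \<le> 2" for z
      using U02[of z] by simp
    show "\<bar>partial_deriv (1, 0) U (t, x)\<bar> \<le> (1 / d\<^sup>2) * \<bar>t\<bar>" if "\<bar>t\<bar> < d" "x \<in> \<omega>" for t x
      using deriv[OF that] by (simp add: e_def)
  qed (use d U0 b y in auto)
qed

section \<open>Norms and weights\<close>

lemma L2_norm_upper:
  assumes S: "S \<in> sets lebesgue" "emeasure lebesgue S \<le> ennreal m" and m: "0 \<le> m" and K: "0 \<le> K"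
    and le: "\<And>x. x \<in> S \<Longrightarrow> norm (f x) \<le> K"
  shows "L2_norm S f \<le> ennreal (K * sqrt m)"
proof -
  define I where "I = (\<integral>\<^sup>+x\<in>S. ennreal ((norm (f x))\<^sup>2) \<partial>lebesgue)"
  have "I \<le> (\<integral>\<^sup>+x. ennreal (K\<^sup>2) * indicator S x \<partial>lebesgue)"
    unfolding I_def
    by (intro nn_integral_mono) (use le in \<open>auto simp: indicator_def power_mono intro!: ennreal_leI\<close>)
  also have "\<dots> = ennreal (K\<^sup>2) * emeasure lebesgue S"
    by (rule nn_integral_cmult_indicator[OF S(1)])
  also have "\<dots> \<le> ennreal (K\<^sup>2) * ennreal m"
    by (intro mult_left_mono S) auto
  also have "\<dots> = ennreal (K\<^sup>2 * m)"
    using m by (simp add: ennreal_mult)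
  finally have I: "I \<le> ennreal (K\<^sup>2 * m)" .
  then have "I \<noteq> \<infinity>"
    using neq_top_trans[of "ennreal (K\<^sup>2 * m)" I] by auto
  moreover have "enn2real I \<le> K\<^sup>2 * m"
    using I m by (simp add: enn2real_leI)
  then have "sqrt (enn2real I) \<le> K * sqrt m"
    using K by (metis real_sqrt_le_iff real_sqrt_mult real_sqrt_unique)
  ultimately show ?thesis
    unfolding L2_norm_def I_def[symmetric] Let_def by (auto intro: ennreal_leI)
qed

lemma L2_norm_lower:
  assumes T: "T \<in> sets lebesgue" "T \<subseteq> S" "ennreal m \<le> emeasure lebesgue T" and m: "0 \<le> m" and \<kappa>: "0 \<le> \<kappa>"
    and le: "\<And>x. x \<in> T \<Longrightarrow> \<kappa> \<le> norm (f x)"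
  shows "ennreal (\<kappa> * sqrt m) \<le> L2_norm S f"
proof -
  define I where "I = (\<integral>\<^sup>+x\<in>S. ennreal ((norm (f x))\<^sup>2) \<partial>lebesgue)"
  have "ennreal (\<kappa>\<^sup>2 * m) = ennreal (\<kappa>\<^sup>2) * ennreal m"
    using m by (simp add: ennreal_mult)
  also have "\<dots> \<le> ennreal (\<kappa>\<^sup>2) * emeasure lebesgue T"
    by (intro mult_left_mono T) auto
  also have "\<dots> = (\<integral>\<^sup>+x. ennreal (\<kappa>\<^sup>2) * indicator T x \<partial>lebesgue)"
    by (rule nn_integral_cmult_indicator[OF T(1), symmetric])
  also have "\<dots> \<le> I"
    unfolding I_def
    by (intro nn_integral_mono) (use le \<kappa> T(2) in \<open>auto simp: indicator_def power_mono intro!: ennreal_leI\<close>)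
  finally have I: "ennreal (\<kappa>\<^sup>2 * m) \<le> I" .
  show ?thesis
  proof (cases "I = \<infinity>")
    case True
    then show ?thesis
      by (simp add: L2_norm_def I_def[symmetric] Let_def)
  next
    case False
    then have "ennreal (\<kappa>\<^sup>2 * m) \<le> ennreal (enn2real I)"
      using I by (simp add: top.not_eq_extremum)
    then have "\<kappa>\<^sup>2 * m \<le> enn2real I"
      by (subst (asm) ennreal_le_iff) auto
    then have "\<kappa> * sqrt m \<le> sqrt (enn2real I)"
      using \<kappa> by (metis real_sqrt_le_iff real_sqrt_mult real_sqrt_unique)
    then show ?thesis
      using False by (simp add: L2_norm_def I_def[symmetric] Let_def ennreal_leI)
  qed
qed

lemma weight_mono:
  assumes "\<forall>i\<in>{1..k}. 0 \<le> c i" "\<forall>i\<in>{1..k}. 0 \<le> \<alpha> i" "0 \<le> s" "s \<le> t"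
  shows "weight k c \<alpha> s \<le> weight k c \<alpha> t"
  unfolding weight_def using assms by (intro sum_mono mult_left_mono powr_mono2) auto

lemma weight_nonneg: "\<forall>i\<in>{1..k}. 0 \<le> c i \<Longrightarrow> 0 \<le> weight k c \<alpha> s"
  unfolding weight_def by (intro sum_nonneg mult_nonneg_nonneg) auto

lemma weight_pos:
  assumes "\<forall>i\<in>{1..k}. 0 \<le> c i" "\<exists>i\<in>{1..k}. c i \<noteq> 0" "0 < s"
  shows "0 < weight k c \<alpha> s"
proof -
  obtain i where "i \<in> {1..k}" "c i \<noteq> 0"
    using assms(2) by blast
  then show ?thesis
    unfolding weight_def using assms(1,3)
    by (intro sum_pos2[of _ i]) (auto simp: less_le)
qed

text \<open>
  Both estimates are refuted by functions with \<open>\<parallel>w\<nabla>u\<parallel> \<ge> \<kappa> h\<^sup>1\<^sup>/\<^sup>2\<close>, \<open>\<parallel>wu\<parallel> \<le> A h\<^sup>1\<^sup>/\<^sup>2\<close>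
  and right-hand quantity at most \<open>B h\<^sup>3\<^sup>/\<^sup>2\<close>: dividing the estimate by \<open>h\<close> leaves
  \<open>\<kappa>\<^sup>2 \<le> C (A B h \<phi>(h) + B\<^sup>2 h\<^sup>2)\<close>, whose right side tends to zero.
\<close>

lemma no_smaller_factor:
  fixes \<phi> :: "real \<Rightarrow> real"
  assumes C: "0 < C" and lim: "((\<lambda>h. h * \<phi> h) \<longlongrightarrow> 0) (at_right 0)"
    and h\<^sub>1: "0 < h\<^sub>1" and \<phi>: "\<And>h. 0 < h \<Longrightarrow> h < h\<^sub>1 \<Longrightarrow> 0 < \<phi> h" and \<kappa>: "0 < \<kappa>" and AB: "0 \<le> A" "0 \<le> B"
    and est: "\<And>h. 0 < h \<Longrightarrow> h < h\<^sub>1 \<Longrightarrow> \<exists>L P Q. ennreal (\<kappa> * sqrt h) \<le> L \<and> P \<le> ennreal (A * sqrt h) \<and>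
      Q \<le> ennreal (B * h * sqrt h) \<and> L\<^sup>2 \<le> ennreal C * (ennreal (\<phi> h) * P * Q + Q\<^sup>2)"
  shows False
proof -
  have ineq: "\<kappa>\<^sup>2 \<le> C * (A * B * (h * \<phi> h) + B\<^sup>2 * h\<^sup>2)" if h: "0 < h" "h < h\<^sub>1" for h
  proof -
    obtain L P Q where L: "ennreal (\<kappa> * sqrt h) \<le> L" and P: "P \<le> ennreal (A * sqrt h)"
      and Q: "Q \<le> ennreal (B * h * sqrt h)" and LPQ: "L\<^sup>2 \<le> ennreal C * (ennreal (\<phi> h) * P * Q + Q\<^sup>2)"
      using est[OF h] by blast
    have "ennreal ((\<kappa> * sqrt h)\<^sup>2) = (ennreal (\<kappa> * sqrt h))\<^sup>2"
      using \<kappa> h by (simp add: ennreal_power)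
    also have "\<dots> \<le> L\<^sup>2"
      by (intro power_mono L) auto
    also have "\<dots> \<le> ennreal C * (ennreal (\<phi> h) * ennreal (A * sqrt h) * ennreal (B * h * sqrt h)
        + (ennreal (B * h * sqrt h))\<^sup>2)"
      by (rule order_trans[OF LPQ]) (intro mult_left_mono add_mono mult_mono power_mono P Q; simp)
    also have "\<dots> = ennreal (C * (\<phi> h * (A * sqrt h) * (B * h * sqrt h) + (B * h * sqrt h)\<^sup>2))"
    proof -
      have *: "ennreal C * (ennreal f * ennreal a * ennreal b + (ennreal b)\<^sup>2) = ennreal (C * (f * a * b + b\<^sup>2))"
        if "0 \<le> f" "0 \<le> a" "0 \<le> b" for f a b
        using that C by (simp add: ennreal_mult power2_eq_square)
      show ?thesis
        using C \<phi>[OF h] AB h by (intro *) auto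
    qed
    finally have "(\<kappa> * sqrt h)\<^sup>2 \<le> C * (\<phi> h * (A * sqrt h) * (B * h * sqrt h) + (B * h * sqrt h)\<^sup>2)"
      using C \<phi>[OF h] AB h by (subst (asm) ennreal_le_iff) auto
    moreover have "(\<kappa> * sqrt h)\<^sup>2 = h * \<kappa>\<^sup>2"
      using h by (simp add: power_mult_distrib)
    moreover have "C * (\<phi> h * (A * sqrt h) * (B * h * sqrt h) + (B * h * sqrt h)\<^sup>2)
        = h * (C * (A * B * (h * \<phi> h) + B\<^sup>2 * h\<^sup>2))"
    proof -
      have s: "sqrt h * sqrt h = h"
        using h by simp
      have eqs: "\<phi> h * (A * sqrt h) * (B * h * sqrt h) = (sqrt h * sqrt h) * (A * B * (h * \<phi> h))"
        "(B * h * sqrt h)\<^sup>2 = (sqrt h * sqrt h) * (B\<^sup>2 * h\<^sup>2)"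
        by (simp_all add: power2_eq_square mult_ac)
      show ?thesis
        unfolding eqs s by (simp add: algebra_simps)
    qed
    ultimately have "h * \<kappa>\<^sup>2 \<le> h * (C * (A * B * (h * \<phi> h) + B\<^sup>2 * h\<^sup>2))"
      by simp
    then show ?thesis
      using h(1) by simp
  qed
  have "((\<lambda>h::real. h) \<longlongrightarrow> 0) (at_right 0)"
    by (rule tendsto_ident_at)
  then have "((\<lambda>h. C * (A * B * (h * \<phi> h) + B\<^sup>2 * h\<^sup>2)) \<longlongrightarrow> C * (A * B * 0 + B\<^sup>2 * 0\<^sup>2)) (at_right 0)"
    by (intro tendsto_intros lim)
  moreover have "\<forall>\<^sub>F h in at_right 0. \<kappa>\<^sup>2 \<le> C * (A * B * (h * \<phi> h) + B\<^sup>2 * h\<^sup>2)"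
    using eventually_at_right_real[OF h\<^sub>1] by eventually_elim (use ineq in auto)
  ultimately have "\<kappa>\<^sup>2 \<le> C * (A * B * 0 + B\<^sup>2 * 0\<^sup>2)"
    by (rule tendsto_lowerbound) simp
  then show False
    using \<kappa> by simp
qed

section \<open>Sharpness of the gradient separation estimate\<close>

lemma emeasure_cylinder:
  fixes A :: "'b::euclidean_space set"
  assumes "open A" "bounded A" "0 < h"
  shows "cylinder A h \<in> sets lebesgue" "emeasure lebesgue (cylinder A h) = ennreal (h * measure lborel A)"
proof -
  have op: "open (cylinder A h)"
    unfolding cylinder_def using assms(1) by (auto intro: open_Times)
  then have B: "cylinder A h \<in> sets borel"
    by (rule borel_open)
  then show "cylinder A h \<in> sets lebesgue"
    by (simp add: sets_completionI_sets)
  have fin: "emeasure lborel A < \<infinity>"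
    by (rule emeasure_bounded_finite[OF assms(2)])
  have "emeasure lebesgue (cylinder A h) = emeasure lborel (cylinder A h)"
    using B by simp
  also have "\<dots> = emeasure (lborel \<Otimes>\<^sub>M lborel) ({0<..<h} \<times> A)"
    by (simp add: lborel_prod cylinder_def)
  also have "\<dots> = emeasure lborel {0<..<h} * emeasure lborel A"
    using assms(1) by (intro lborel.emeasure_pair_measure_Times) auto
  also have "\<dots> = ennreal h * ennreal (measure lborel A)"
    using assms(3) fin by (simp add: emeasure_eq_ennreal_measure)
  also have "\<dots> = ennreal (h * measure lborel A)"
    using assms(3) by (simp add: ennreal_mult)
  finally show "emeasure lebesgue (cylinder A h) = ennreal (h * measure lborel A)" .
qed

lemma partial_deriv_translate: "partial_deriv b (\<lambda>x. u (x + z)) x = partial_deriv b u (x + z)"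
  by (simp add: partial_deriv_def algebra_simps)

lemma partial_deriv_le_grad:
  assumes "b \<in> Basis" shows "\<bar>partial_deriv b u x\<bar> \<le> norm (grad u x)"
proof -
  have "grad u x \<bullet> b = partial_deriv b u x"
    unfolding grad_def using assms by (simp add: inner_sum_left inner_Basis if_distrib cong: if_cong)
  then show ?thesis
    using Basis_le_norm[OF assms, of "grad u x"] by simp
qed

text \<open>
  The plane of symmetry \<open>t = 0\<close> of \<open>U\<close> is moved to the middle of the cylinder, so that
  \<open>\<bar>u\<^sub>t\<bar> \<le> K h/2\<close> throughout, while near one point the gradient across stays away from zero. The
  lower bound for the weight there uses that \<open>\<Gamma>\<close> is closed and outside \<open>\<omega>\<close>.
\<close>

theorem gradient_separation_sharp:
  fixes \<omega> \<Gamma> :: "(real ^ 'm) set"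
  assumes \<omega>: "lipschitz_domain \<omega>" and \<Gamma>: "\<Gamma> \<subseteq> frontier \<omega>" "compact \<Gamma>" "\<Gamma> \<noteq> {}"
    and c: "\<forall>i\<in>{1..k}. 0 \<le> c i" "\<exists>i\<in>{1..k}. c i \<noteq> 0" and \<alpha>: "\<forall>i\<in>{1..k}. 0 \<le> \<alpha> i"
    and h\<^sub>0: "0 < h\<^sub>0" and C: "0 < C" and \<phi>: "\<forall>h\<in>{0<..<h\<^sub>0}. 0 < \<phi> h"
    and lim: "((\<lambda>h. h * \<phi> h) \<longlongrightarrow> 0) (at_right 0)"
    and est: "\<forall>h\<in>{0<..<h\<^sub>0}. gradient_separation_estimate \<omega> \<Gamma> k c \<alpha> C (\<phi> h) h"
  shows False
proof -
  have op: "open \<omega>" and bd: "bounded \<omega>"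
    using \<omega> by (auto simp: lipschitz_domain_def)
  obtain H :: real and U K b y where H: "0 < H" and hU: "harmonic_on ({-H<..<H} \<times> \<omega>) U"
    and cU: "continuous_on ({-H<..<H} \<times> closure \<omega>) U"
    and U0: "\<And>t x. x \<in> frontier \<omega> \<Longrightarrow> U (t, x) = 0" and U2: "\<And>z. \<bar>U z\<bar> \<le> 2"
    and K: "0 \<le> K" "\<And>t x. \<bar>t\<bar> < H \<Longrightarrow> x \<in> \<omega> \<Longrightarrow> \<bar>partial_deriv (1, 0) U (t, x)\<bar> \<le> K * \<bar>t\<bar>"
    and b: "b \<in> Basis" and y: "y \<in> \<omega>" "partial_deriv (0, b) U (0, y) \<noteq> 0"
    by (rule flat_cylinder_solution[OF \<omega>]) blast
  have b': "(0, b) \<in> (Basis :: (real \<times> (real ^ 'm)) set)"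
    using b by (simp add: Basis_prod_def)
  define DH where "DH = {-H<..<H} \<times> \<omega>"
  have DH: "open DH" "(0, y) \<in> DH"
    unfolding DH_def using op H y by (auto intro: open_Times)
  define g where "g = partial_deriv (0, b) U"
  have "continuous_on DH g"
    using hU b' C2_withD(2) unfolding harmonic_on_def C_on_2_C2_with DH_def g_def by blast
  then have "isCont g (0, y)"
    using DH by (simp add: continuous_on_eq_continuous_at)
  define \<gamma> where "\<gamma> = \<bar>g (0, y)\<bar> / 2"
  have \<gamma>: "0 < \<gamma>"
    using y by (simp add: \<gamma>_def g_def)
  obtain \<rho>\<^sub>1 where \<rho>1: "0 < \<rho>\<^sub>1" "\<And>z. dist z (0, y) < \<rho>\<^sub>1 \<Longrightarrow> dist (g z) (g (0, y)) < \<gamma>"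
    using \<open>isCont g (0, y)\<close> \<gamma> unfolding continuous_at_eps_delta by (metis dist_commute)
  have g_low: "\<gamma> \<le> \<bar>g z\<bar>" if "dist z (0, y) < \<rho>\<^sub>1" for z
    using \<rho>1(2)[OF that] unfolding \<gamma>_def dist_real_def by linarith
  obtain \<rho>\<^sub>2 where \<rho>2: "0 < \<rho>\<^sub>2" "ball y \<rho>\<^sub>2 \<subseteq> \<omega>"
    using op y open_contains_ball by blast
  have "y \<notin> \<Gamma>"
    using \<Gamma>(1) y op by (auto simp: frontier_def interior_open)
  define \<Delta> where "\<Delta> = infdist y \<Gamma>"
  have \<Delta>: "0 < \<Delta>"
    unfolding \<Delta>_def using \<Gamma> \<open>y \<notin> \<Gamma>\<close> compact_imp_closed infdist_pos_not_in_closed by blast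
  define \<rho> where "\<rho> = min (\<rho>\<^sub>1 / 2) (min \<rho>\<^sub>2 (\<Delta> / 2))"
  have \<rho>: "0 < \<rho>" "\<rho> \<le> \<rho>\<^sub>1 / 2" "\<rho> \<le> \<rho>\<^sub>2" "\<rho> \<le> \<Delta> / 2"
    using \<rho>1 \<rho>2 \<Delta> by (auto simp: \<rho>_def)
  obtain q\<^sub>0 where q0: "q\<^sub>0 \<in> \<Gamma>"
    using \<Gamma> by blast
  obtain R where R: "\<And>x. x \<in> \<omega> \<Longrightarrow> dist x q\<^sub>0 \<le> R"
    using bd bounded_any_center[of \<omega> q\<^sub>0] by (auto simp: dist_commute)
  have R0: "0 \<le> R"
    using R[OF y(1)] zero_le_dist[of y q\<^sub>0] by linarith
  define W where "W = weight k c \<alpha> R"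
  define w\<^sub>0 where "w\<^sub>0 = weight k c \<alpha> (\<Delta> / 2)"
  have W: "0 \<le> W"
    unfolding W_def by (rule weight_nonneg[OF c(1)])
  have w0: "0 < w\<^sub>0"
    unfolding w\<^sub>0_def using \<Delta> by (intro weight_pos c) simp
  have w_le: "cylinder_weight \<Gamma> k c \<alpha> h z \<le> W" if "z \<in> cylinder \<omega> h" for h z
  proof (cases z)
    case (Pair t x)
    then have "(t, q\<^sub>0) \<in> {0<..<h} \<times> \<Gamma>" "x \<in> \<omega>"
      using that q0 by (auto simp: cylinder_def)
    then have "infdist z ({0<..<h} \<times> \<Gamma>) \<le> R"
      using infdist_le2[of "(t, q\<^sub>0)" _ z R] R[of x] by (simp add: Pair dist_Pair_Pair)
    then show ?thesis
      unfolding cylinder_weight_def W_def by (intro weight_mono c \<alpha> infdist_nonneg)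
  qed
  have w_nn: "0 \<le> cylinder_weight \<Gamma> k c \<alpha> h z" for h z
    unfolding cylinder_weight_def by (rule weight_nonneg[OF c(1)])
  have w_ge: "w\<^sub>0 \<le> cylinder_weight \<Gamma> k c \<alpha> h z" if "z \<in> cylinder (ball y \<rho>) h" for h z
  proof (cases z)
    case (Pair t x)
    have ne: "{0<..<h} \<times> \<Gamma> \<noteq> {}"
      using that \<Gamma> by (auto simp: cylinder_def)
    have "\<Delta> / 2 \<le> dist z p" if p: "p \<in> {0<..<h} \<times> \<Gamma>" for p
    proof -
      have "\<Delta> \<le> dist y (snd p)"
        unfolding \<Delta>_def using p by (intro infdist_le) auto
      moreover have "dist y x < \<Delta> / 2"
        using \<open>z \<in> cylinder (ball y \<rho>) h\<close> \<rho> by (auto simp: cylinder_def Pair)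
      moreover have "dist x (snd p) \<le> dist z p"
        using dist_snd_le[of z p] by (simp add: Pair)
      ultimately show ?thesis
        using dist_triangle[of y "snd p" x] by linarith
    qed
    then have "\<Delta> / 2 \<le> infdist z ({0<..<h} \<times> \<Gamma>)"
      unfolding infdist_notempty[OF ne] by (intro cINF_greatest ne)
    then show ?thesis
      unfolding cylinder_weight_def w\<^sub>0_def using \<Delta> by (intro weight_mono c \<alpha>) auto
  qed
  define m where "m = measure lborel \<omega>"
  define m\<^sub>0 where "m\<^sub>0 = measure lborel (ball y \<rho>)"
  have m: "0 \<le> m"
    by (simp add: m_def)
  have m0: "0 < m\<^sub>0"
    unfolding m\<^sub>0_def using content_ball_pos[OF \<rho>(1), of y] by simp
  define h\<^sub>1 where "h\<^sub>1 = min h\<^sub>0 (min H \<rho>\<^sub>1)"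
  show False
  proof (rule no_smaller_factor[OF C lim, of h\<^sub>1 "w\<^sub>0 * \<gamma> * sqrt m\<^sub>0" "2 * W * sqrt m" "W * K / 2 * sqrt m"])
    show "0 < h\<^sub>1"
      using h\<^sub>0 H \<rho>1 by (simp add: h\<^sub>1_def)
    show "0 < \<phi> h" if "0 < h" "h < h\<^sub>1" for h
      using \<phi> that by (simp add: h\<^sub>1_def)
    fix h assume h: "0 < h" "h < h\<^sub>1"
    then have hs: "h < h\<^sub>0" "h < H" "h < \<rho>\<^sub>1"
      by (auto simp: h\<^sub>1_def)
    define \<Omega> where "\<Omega> = cylinder \<omega> h"
    define w where "w = cylinder_weight \<Gamma> k c \<alpha> h"
    define u where "u = (\<lambda>z. U (z + (- (h/2), 0)))"
    have cl\<Omega>: "closure \<Omega> = {0..h} \<times> closure \<omega>"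
      unfolding \<Omega>_def cylinder_def closure_Times using h by simp
    have hu: "harmonic_on \<Omega> u"
      unfolding u_def by (rule harmonic_on_translate[OF hU]) (use hs h in \<open>auto simp: \<Omega>_def cylinder_def\<close>)
    have cu: "continuous_on (closure \<Omega>) u"
      unfolding u_def cl\<Omega>
      by (rule continuous_on_compose2[OF cU]) (use hs h in \<open>auto intro!: continuous_intros\<close>)
    have u0: "\<forall>x\<in>{0<..<h} \<times> frontier \<omega>. u x = 0"
      using U0 by (auto simp: u_def)
    have ut: "\<bar>partial_deriv (1, 0) u z\<bar> \<le> K * (h / 2)" if "z \<in> \<Omega>" for z
    proof (cases z)
      case (Pair t x)
      have tx: "0 < t" "t < h" "x \<in> \<omega>"
        using that by (auto simp: Pair \<Omega>_def cylinder_def)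
      then have "\<bar>partial_deriv (1, 0) u z\<bar> \<le> K * \<bar>t - h / 2\<bar>"
        using K(2)[of "t - h / 2" x] hs by (simp add: u_def partial_deriv_translate Pair)
      also have "\<bar>t - h / 2\<bar> \<le> h / 2"
        using tx by linarith
      then have "K * \<bar>t - h / 2\<bar> \<le> K * (h / 2)"
        using K(1) by (rule mult_left_mono)
      finally show ?thesis .
    qed
    define L where "L = L2_norm \<Omega> (\<lambda>x. w x *\<^sub>R grad u x)"
    define P where "P = L2_norm \<Omega> (\<lambda>x. w x * u x)"
    define Q where "Q = L2_norm \<Omega> (\<lambda>x. w x * partial_deriv (1, 0) u x)"
    have "L\<^sup>2 \<le> ennreal C * (ennreal (\<phi> h) * P * Q + Q\<^sup>2)"
    proof -
      have "gradient_separation_estimate \<omega> \<Gamma> k c \<alpha> C (\<phi> h) h"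
        using est h hs by simp
      then show ?thesis
        using hu cu u0 unfolding gradient_separation_estimate_def Let_def harmonic_on_def
          \<Omega>_def[symmetric] w_def[symmetric] L_def P_def Q_def by blast
    qed
    moreover have "ennreal (w\<^sub>0 * \<gamma> * sqrt m\<^sub>0 * sqrt h) \<le> L"
    proof -
      have "ennreal (w\<^sub>0 * \<gamma> * sqrt (h * m\<^sub>0)) \<le> L"
        unfolding L_def
      proof (rule L2_norm_lower)
        show "cylinder (ball y \<rho>) h \<in> sets lebesgue" "ennreal (h * m\<^sub>0) \<le> emeasure lebesgue (cylinder (ball y \<rho>) h)"
          using emeasure_cylinder[OF open_ball bounded_ball h(1), of y \<rho>] by (auto simp: m\<^sub>0_def)
        show "cylinder (ball y \<rho>) h \<subseteq> \<Omega>"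
          using \<rho>2 \<rho> by (auto simp: \<Omega>_def cylinder_def subset_iff)
        fix z assume z: "z \<in> cylinder (ball y \<rho>) h"
        have "\<gamma> \<le> \<bar>g (z + (- (h/2), 0))\<bar>"
        proof (cases z)
          case (Pair t x)
          have tx: "0 < t" "t < h" "dist y x < \<rho>"
            using z by (auto simp: Pair cylinder_def)
          have "z + (- (h/2), 0) = (t - h / 2, x)"
            by (simp add: Pair)
          then have "dist (z + (- (h/2), 0)) (0, y) = sqrt ((dist (t - h / 2) 0)\<^sup>2 + (dist x y)\<^sup>2)"
            by (simp only: dist_Pair_Pair)
          also have "\<dots> \<le> dist (t - h / 2) 0 + dist x y"
            by (rule sqrt_sum_squares_le_sum) auto
          also have "\<dots> < \<rho>\<^sub>1"
          proof -
            have "\<bar>t - h / 2 - 0\<bar> < \<rho>\<^sub>1 / 2"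
              using tx(1,2) hs(3) by linarith
            then show ?thesis
              using tx(3) \<rho>(2) by (simp add: dist_real_def dist_commute)
          qed
          finally show ?thesis
            by (rule g_low)
        qed
        also have "\<dots> = \<bar>partial_deriv (0, b) u z\<bar>"
          by (simp add: g_def u_def partial_deriv_translate)
        also have "\<dots> \<le> norm (grad u z)"
          by (rule partial_deriv_le_grad[OF b'])
        finally have "w\<^sub>0 * \<gamma> \<le> w z * norm (grad u z)"
          using w_ge[OF z] w0 \<gamma> unfolding w_def by (intro mult_mono) auto
        then show "w\<^sub>0 * \<gamma> \<le> norm (w z *\<^sub>R grad u z)"
          using w_nn[of h z] by (simp add: w_def)
      qed (use h w0 \<gamma> m0 in auto)
      then show ?thesis
        by (simp add: real_sqrt_mult mult_ac)
    qed
    moreover have "P \<le> ennreal (2 * W * sqrt m * sqrt h)"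
    proof -
      have "P \<le> ennreal ((W * 2) * sqrt (h * m))"
        unfolding P_def
      proof (rule L2_norm_upper)
        show "norm (w z * u z) \<le> W * 2" if "z \<in> \<Omega>" for z
          using w_le[of z h] w_nn[of h z] U2[of "z + (- (h/2), 0)"] that W
          unfolding w_def u_def \<Omega>_def by (simp add: abs_mult mult_mono)
      qed (use emeasure_cylinder[OF op bd h(1)] h m W in \<open>auto simp: \<Omega>_def m_def\<close>)
      then show ?thesis
        by (simp add: real_sqrt_mult mult_ac)
    qed
    moreover have "Q \<le> ennreal (W * K / 2 * sqrt m * h * sqrt h)"
    proof -
      have "Q \<le> ennreal ((W * (K * (h / 2))) * sqrt (h * m))"
        unfolding Q_def
      proof (rule L2_norm_upper)
        show "norm (w z * partial_deriv (1, 0) u z) \<le> W * (K * (h / 2))" if "z \<in> \<Omega>" for z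
        proof -
          have "w z * \<bar>partial_deriv (1, 0) u z\<bar> \<le> W * (K * (h / 2))"
            using that unfolding w_def by (intro mult_mono w_le ut W) (auto simp: \<Omega>_def)
          then show ?thesis
            using w_nn[of h z] by (simp add: abs_mult w_def)
        qed
      qed (use emeasure_cylinder[OF op bd h(1)] h m W K in \<open>auto simp: \<Omega>_def m_def\<close>)
      then show ?thesis
        by (simp add: real_sqrt_mult mult_ac)
    qed
    ultimately show "\<exists>L P Q. ennreal (w\<^sub>0 * \<gamma> * sqrt m\<^sub>0 * sqrt h) \<le> L \<and> P \<le> ennreal (2 * W * sqrt m * sqrt h) \<and>
        Q \<le> ennreal (W * K / 2 * sqrt m * h * sqrt h) \<and> L\<^sup>2 \<le> ennreal C * (ennreal (\<phi> h) * P * Q + Q\<^sup>2)"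
      by blast
  qed (use w0 \<gamma> m0 m W K(1) in auto)
qed

section \<open>Sharpness of the Korn interpolation estimate\<close>

lemma compact_support_integrable:
  fixes f :: "'a::euclidean_space \<Rightarrow> real"
  assumes "continuous_on UNIV f" "compact K" "\<And>x. x \<notin> K \<Longrightarrow> f x = 0"
  shows "integrable lborel f"
proof -
  have "integrable lborel (\<lambda>x. indicator K x *\<^sub>R f x)"
    by (rule borel_integrable_compact[OF assms(2) continuous_on_subset[OF assms(1)]]) simp
  moreover have "(\<lambda>x. indicator K x *\<^sub>R f x) = f"
    using assms(3) by (intro ext) (auto simp: indicator_def)
  ultimately show ?thesis by simp
qed

lemma has_pd_support:
  assumes "has_pd b f x d" "closed K" "\<And>x. x \<notin> K \<Longrightarrow> f x = 0" "x \<notin> K"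
  shows "d = 0"
proof -
  have "has_pd b f x 0"
    by (rule has_pd_cong[OF _ _ _ has_pd_const[of b 0], of "- K"]) (use assms in auto)
  then show ?thesis
    using assms(1) partial_deriv_eqI by metis
qed

text \<open>
  The difference quotients of a compactly supported function have integral zero because Lebesgue
  measure is translation invariant; they converge boundedly to the derivative.
\<close>

lemma integral_partial_derivative_eq_0:
  fixes f :: "'a::euclidean_space \<Rightarrow> real"
  assumes f: "continuous_on UNIV f" "\<And>x. has_pd b f x (f' x)" and f': "continuous_on UNIV f'"
    and b: "b \<in> Basis" and K: "compact K" "\<And>x. x \<notin> K \<Longrightarrow> f x = 0"
  shows "integral\<^sup>L lborel f' = 0"
proof -
  have f'0: "f' x = 0" if "x \<notin> K" for x
    by (rule has_pd_support[OF f(2) compact_imp_closed[OF K(1)] K(2) that])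
  obtain R where R: "\<And>x. x \<in> K \<Longrightarrow> norm x \<le> R"
    using compact_imp_bounded[OF K(1)] bounded_iff by metis
  have "bounded (f' ` K)"
    by (intro compact_imp_bounded compact_continuous_image K continuous_on_subset[OF f']) simp
  then obtain M' where M': "\<And>x. x \<in> K \<Longrightarrow> \<bar>f' x\<bar> \<le> M'"
    unfolding bounded_iff by auto
  define M where "M = max 0 M'"
  have M: "\<bar>f' x\<bar> \<le> M" "0 \<le> M" for x
    using M'[of x] f'0[of x] by (cases "x \<in> K"; simp add: M_def)+
  define s where "s = (\<lambda>n x. (f (x + inverse (real (Suc n)) *\<^sub>R b) - f x) / inverse (real (Suc n)))"
  define w where "w = (\<lambda>x::'a. indicator (cball 0 (R + 1)) x *\<^sub>R M)"
  have meas: "f \<in> borel_measurable borel" "f' \<in> borel_measurable borel"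
    using f(1) f' by (auto intro: borel_measurable_continuous_onI)
  have int: "integrable lborel f"
    by (rule compact_support_integrable[OF f(1) K])
  have shift: "integrable lborel (\<lambda>x. f (x + c))" "integral\<^sup>L lborel (\<lambda>x. f (x + c)) = integral\<^sup>L lborel f" for c
  proof -
    have "integrable (distr lborel borel ((+) c)) f"
      using int by (simp add: lborel_distr_plus)
    then show "integrable lborel (\<lambda>x. f (x + c))"
      using meas by (subst (asm) integrable_distr_eq) (auto simp: add.commute)
    have "integral\<^sup>L (distr lborel borel ((+) c)) f = integral\<^sup>L lborel (\<lambda>x. f (c + x))"
      using meas by (intro integral_distr) auto
    then show "integral\<^sup>L lborel (\<lambda>x. f (x + c)) = integral\<^sup>L lborel f"
      by (simp add: lborel_distr_plus add.commute)
  qed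
  have zero: "integral\<^sup>L lborel (s n) = 0" for n
    unfolding s_def using shift[of "inverse (real (Suc n)) *\<^sub>R b"] int by simp
  have "(\<lambda>n. integral\<^sup>L lborel (s n)) \<longlonglongrightarrow> integral\<^sup>L lborel f'"
  proof (rule integral_dominated_convergence[where w = w])
    show "f' \<in> borel_measurable lborel"
      using meas by simp
    show "s n \<in> borel_measurable lborel" for n
    proof -
      have "continuous_on UNIV (s n)"
        unfolding s_def by (intro continuous_intros continuous_on_compose2[OF f(1)]) auto
      then show ?thesis
        by (auto intro: borel_measurable_continuous_onI)
    qed
    show "integrable lborel w"
      unfolding w_def by (rule borel_integrable_compact) auto
    show "AE x in lborel. (\<lambda>n. s n x) \<longlonglongrightarrow> f' x"
    proof (rule AE_I2)
      fix x
      have "((\<lambda>t. (f (x + t *\<^sub>R b) - f x) / t) \<longlongrightarrow> f' x) (at 0)"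
        using f(2)[of x] by (simp add: has_pd_def DERIV_def)
      moreover have "filterlim (\<lambda>n. inverse (real (Suc n))) (at 0) sequentially"
        unfolding filterlim_at using LIMSEQ_inverse_real_of_nat by auto
      ultimately show "(\<lambda>n. s n x) \<longlonglongrightarrow> f' x"
        unfolding s_def by (rule filterlim_compose)
    qed
    show "AE x in lborel. norm (s n x) \<le> w x" for n
    proof (rule AE_I2)
      fix x
      define t where "t = inverse (real (Suc n))"
      have t: "0 < t" "t \<le> 1"
        by (auto simp: t_def inverse_eq_divide)
      obtain \<xi> where \<xi>: "0 < \<xi>" "\<xi> < t" "f (x + t *\<^sub>R b) - f (x + 0 *\<^sub>R b) = (t - 0) * f' (x + \<xi> *\<^sub>R b)"
        using MVT2[of 0 t "\<lambda>t. f (x + t *\<^sub>R b)" "\<lambda>t. f' (x + t *\<^sub>R b)"] t has_pd_line[OF f(2)] by blast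
      have "s n x = (f (x + t *\<^sub>R b) - f x) / t"
        by (simp only: s_def t_def)
      with \<xi> t have s: "s n x = f' (x + \<xi> *\<^sub>R b)"
        by simp
      show "norm (s n x) \<le> w x"
      proof (cases "x \<in> cball 0 (R + 1)")
        case True
        then show ?thesis
          using M(1) by (simp add: s w_def)
      next
        case False
        have "norm (x + \<xi> *\<^sub>R b) \<ge> norm x - norm (\<xi> *\<^sub>R b)"
          using norm_triangle_ineq2[of x "- (\<xi> *\<^sub>R b)"] by simp
        moreover have "norm (\<xi> *\<^sub>R b) \<le> 1"
          using \<xi> t b by simp
        ultimately have "x + \<xi> *\<^sub>R b \<notin> K"
          using False R[of "x + \<xi> *\<^sub>R b"] by auto
        then show ?thesis
          using False f'0 by (simp add: s w_def)
      qed
    qed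
  qed
  then show ?thesis
    by (simp add: zero LIMSEQ_const_iff)
qed

lemma set_integral_support:
  fixes f :: "'a::euclidean_space \<Rightarrow> real"
  assumes "continuous_on UNIV f" "\<And>x. x \<notin> S \<Longrightarrow> f x = 0"
  shows "(LINT x:S|lebesgue. f x) = integral\<^sup>L lborel f"
proof -
  have "(\<lambda>x. indicator S x *\<^sub>R f x) = f"
    using assms(2) by (intro ext) (auto simp: indicator_def)
  then have "(LINT x:S|lebesgue. f x) = integral\<^sup>L lebesgue f"
    by (simp add: set_lebesgue_integral_def)
  also have "\<dots> = integral\<^sup>L lborel f"
    using assms(1) by (intro integral_completion) (auto intro: borel_measurable_continuous_onI)
  finally show ?thesis .
qed

lemma polynomial_integration_by_parts:
  fixes p :: "'a::euclidean_space \<Rightarrow> real"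
  assumes p: "real_polynomial_function p" and \<psi>: "test_function S \<psi>" and b: "b \<in> Basis"
  shows "(LINT x:S|lebesgue. p x * partial_deriv b \<psi> x) = - (LINT x:S|lebesgue. (grad p x \<bullet> b) * \<psi> x)"
proof -
  obtain K where K: "compact K" "K \<subseteq> S" "\<And>x. x \<notin> K \<Longrightarrow> \<psi> x = 0"
    using \<psi> unfolding test_function_def by blast
  have "C_on 1 UNIV \<psi>"
    using \<psi> unfolding test_function_def smooth_def by blast
  then have \<psi>c: "continuous_on UNIV \<psi>" "continuous_on UNIV (partial_deriv b \<psi>)"
    and \<psi>pd: "\<And>x. has_pd b \<psi> x (partial_deriv b \<psi> x)"
    using b by (auto simp: differentiable_has_pd)
  have \<psi>0: "partial_deriv b \<psi> x = 0" if "x \<notin> K" for x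
    by (rule has_pd_support[OF \<psi>pd compact_imp_closed[OF K(1)] K(3) that])
  have pc: "continuous_on UNIV p" "continuous_on UNIV (partial_deriv b p)"
    by (intro polynomial_continuous polynomial_partial_deriv p)+
  have grad: "grad p x \<bullet> b = partial_deriv b p x" for x
    unfolding grad_def using b by (simp add: inner_sum_left inner_Basis if_distrib cong: if_cong)
  have c: "continuous_on UNIV (\<lambda>x. p x * partial_deriv b \<psi> x)" "continuous_on UNIV (\<lambda>x. partial_deriv b p x * \<psi> x)"
    by (intro continuous_on_mult pc \<psi>c)+
  have "integral\<^sup>L lborel (\<lambda>x. partial_deriv b p x * \<psi> x + p x * partial_deriv b \<psi> x) = 0"
  proof (rule integral_partial_derivative_eq_0[OF _ has_pd_mult[OF polynomial_partial_deriv(2)[OF p] \<psi>pd] _ b K(1)])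
    show "continuous_on UNIV (\<lambda>x. p x * \<psi> x)"
      by (intro continuous_on_mult pc \<psi>c)
    show "continuous_on UNIV (\<lambda>x. partial_deriv b p x * \<psi> x + p x * partial_deriv b \<psi> x)"
      by (intro continuous_on_add c)
  qed (simp add: K)
  moreover have "integrable lborel (\<lambda>x. partial_deriv b p x * \<psi> x)" "integrable lborel (\<lambda>x. p x * partial_deriv b \<psi> x)"
    by (rule compact_support_integrable[OF c(2) K(1)], simp add: K)
      (rule compact_support_integrable[OF c(1) K(1)], simp add: \<psi>0)
  ultimately have "integral\<^sup>L lborel (\<lambda>x. p x * partial_deriv b \<psi> x) = - integral\<^sup>L lborel (\<lambda>x. partial_deriv b p x * \<psi> x)"
    by simp
  moreover have "(LINT x:S|lebesgue. p x * partial_deriv b \<psi> x) = integral\<^sup>L lborel (\<lambda>x. p x * partial_deriv b \<psi> x)"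
    by (rule set_integral_support[OF c(1)]) (use K \<psi>0 in auto)
  moreover have "(LINT x:S|lebesgue. partial_deriv b p x * \<psi> x) = integral\<^sup>L lborel (\<lambda>x. partial_deriv b p x * \<psi> x)"
    by (rule set_integral_support[OF c(2)]) (use K in auto)
  ultimately show ?thesis
    by (simp add: grad)
qed

lemma continuous_in_L2:
  fixes f :: "'a::euclidean_space \<Rightarrow> 'b::euclidean_space"
  assumes f: "continuous_on UNIV f" and S: "open S" "bounded S"
  shows "in_L2 S f"
proof -
  have B: "S \<in> sets borel"
    using S(1) by (rule borel_open)
  have m: "f \<in> borel_measurable borel"
    using f by (rule borel_measurable_continuous_onI)
  have "set_borel_measurable lebesgue S f"
    unfolding set_borel_measurable_def
    using B m by (intro measurable_completion) simp
  moreover have "L2_norm S f < \<infinity>"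
  proof -
    have "bounded (f ` closure S)"
      using S(2) by (intro compact_imp_bounded compact_continuous_image continuous_on_subset[OF f])
        (auto simp: compact_closure)
    then obtain K where K: "\<And>x. x \<in> closure S \<Longrightarrow> norm (f x) \<le> K"
      unfolding bounded_iff by blast
    have "emeasure lebesgue S = emeasure lborel S"
      using B by simp
    also have "\<dots> = ennreal (measure lborel S)"
      using emeasure_bounded_finite[OF S(2)] by (simp add: emeasure_eq_ennreal_measure)
    finally have "L2_norm S f \<le> ennreal (max 0 K * sqrt (measure lborel S))"
      using B K closure_subset[of S]
      by (intro L2_norm_upper) (auto simp: sets_completionI_sets intro: max.coboundedI2)
    then show ?thesis
      by (simp add: order.strict_trans1)
  qed
  ultimately show ?thesis
    by (simp add: in_L2_def)
qed

lemma polynomial_H1_grad: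
  fixes p :: "'a::euclidean_space \<Rightarrow> real"
  assumes p: "real_polynomial_function p" and S: "open S" "bounded S"
  shows "H1_grad S p (grad p)"
proof -
  have "continuous_on UNIV (grad p)"
    unfolding grad_def
    by (intro continuous_on_sum continuous_on_scaleR continuous_on_const polynomial_continuous polynomial_partial_deriv p)
  then show ?thesis
    unfolding H1_grad_def
    by (auto intro!: continuous_in_L2 polynomial_continuous p S polynomial_integration_by_parts)
qed

lemma L2_norm_zero: "L2_norm S (\<lambda>x. 0) = 0"
  by (simp add: L2_norm_def)

text \<open>A polynomial serves as the constant sequence of smooth approximations of itself.\<close>

lemma polynomial_has_zero_trace:
  fixes p :: "'a::euclidean_space \<Rightarrow> real"
  assumes p: "real_polynomial_function p" and S: "open S" "bounded S"
    and zero: "\<And>s. p (\<gamma> s) = 0"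
  shows "has_trace S p \<gamma> {0<..<h} (\<lambda>s. 0)"
  unfolding has_trace_def
proof (intro conjI exI allI)
  show "in_L2 {0<..<h} (\<lambda>s. 0::real)"
    by (rule continuous_in_L2) auto
  show "H1_grad S p (grad p)"
    by (rule polynomial_H1_grad[OF p S])
  show "smooth p"
    using polynomial_C_on[OF p] by (simp add: smooth_def)
qed (simp_all add: L2_norm_zero zero)

lemma rectangle_eq_box: "rectangle h a = box (vector [0, 0]) (vector [h, a])"
  by (auto simp: rectangle_def mem_box_cart forall_2)

lemma strip_measure:
  assumes "0 < h" "l \<le> a"
  defines "T \<equiv> box (vector [0, l]) (vector [h, a] :: real ^ 2)"
  shows "T \<in> sets lebesgue" "emeasure lebesgue T = ennreal (h * (a - l))"
proof -
  have B: "T \<in> sets borel"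
    by (simp add: T_def)
  then show "T \<in> sets lebesgue"
    by (simp add: sets_completionI_sets)
  have "emeasure lebesgue T = emeasure lborel T"
    using B by simp
  also have "\<dots> = emeasure lborel (cbox (vector [0, l]) (vector [h, a] :: real ^ 2))"
    unfolding T_def by (simp only: emeasure_lborel_box_eq emeasure_lborel_cbox_eq)
  also have "\<dots> = ennreal (measure lborel (cbox (vector [0, l]) (vector [h, a] :: real ^ 2)))"
    using emeasure_lborel_cbox_finite[of "vector [0, l]" "vector [h, a] :: real ^ 2"]
    by (simp add: emeasure_eq_ennreal_measure del: emeasure_lborel_cbox)
  also have "cbox (vector [0, l]) (vector [h, a] :: real ^ 2) \<noteq> {}"
    using assms by (auto simp: interval_ne_empty_cart forall_2)
  then have "measure lborel (cbox (vector [0, l]) (vector [h, a] :: real ^ 2)) = h * (a - l)"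
    by (simp add: content_cbox_cart UNIV_2)
  finally show "emeasure lebesgue T = ennreal (h * (a - l))" .
qed

lemma norm_axis_eq: "norm (axis i x) = norm x" for x :: "'a::real_inner"
  by (simp add: norm_eq_sqrt_inner inner_axis_axis)

lemma grad_component: "grad u x $ j = partial_deriv (axis j 1) u x" for x :: "real ^ 'n"
proof -
  have "axis j 1 \<in> (Basis :: (real ^ 'n) set)"
    by (simp add: axis_in_Basis_iff)
  then have "grad u x \<bullet> axis j 1 = partial_deriv (axis j 1) u x"
    unfolding grad_def by (simp add: inner_sum_left inner_Basis if_distrib cong: if_cong)
  then show ?thesis
    by (simp add: inner_axis)
qed

text \<open>
  The counterexample is a bending: \<open>u = f(y)\<close> and \<open>v = -(x - h/2) f'(y)\<close> make the
  off-diagonal strain vanish and leave only \<open>v\<^sub>y = -(x - h/2) f''(y)\<close>, of order \<open>h\<close>. The choice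
  \<open>f(y) = y (a - y)\<close> vanishes at both ends.
\<close>

theorem korn_interpolation_sharp:
  assumes a: "0 < a"
    and c: "\<forall>i\<in>{1..k}. 0 \<le> c i" "\<exists>i\<in>{1..k}. c i \<noteq> 0" and \<alpha>: "\<forall>i\<in>{1..k}. 0 \<le> \<alpha> i"
    and h\<^sub>0: "0 < h\<^sub>0" and C: "0 < C" and \<phi>: "\<forall>h\<in>{0<..<h\<^sub>0}. 0 < \<phi> h"
    and lim: "((\<lambda>h. h * \<phi> h) \<longlongrightarrow> 0) (at_right 0)"
    and est: "\<forall>h\<in>{0<..<h\<^sub>0}. korn_interpolation_estimate a k c \<alpha> C (\<phi> h) h"
  shows False
proof -
  define W where "W = weight k c \<alpha> a"
  define w\<^sub>0 where "w\<^sub>0 = weight k c \<alpha> (a / 8)"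
  have W: "0 \<le> W"
    unfolding W_def by (rule weight_nonneg[OF c(1)])
  have w0: "0 < w\<^sub>0"
    unfolding w\<^sub>0_def using a by (intro weight_pos c) simp
  show False
  proof (rule no_smaller_factor[OF C lim h\<^sub>0, of "w\<^sub>0 * (a / 2) * sqrt (a / 8)" "W * a\<^sup>2 * sqrt a" "W * sqrt a"])
    show "0 < \<phi> h" if "0 < h" "h < h\<^sub>0" for h
      using \<phi> that by simp
    fix h assume h: "0 < h" "h < h\<^sub>0"
    define R where "R = rectangle h a"
    have R: "open R" "bounded R"
      unfolding R_def rectangle_eq_box by (rule open_box, rule bounded_box)
    have R_meas: "R \<in> sets lebesgue" "emeasure lebesgue R = ennreal (h * a)"
      using strip_measure[of h 0 a] h a by (auto simp: R_def rectangle_eq_box)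
    define w where "w = rectangle_weight k c \<alpha>"
    define u where "u = (\<lambda>p::real ^ 2. (p \<bullet> axis 2 1) * (a - p \<bullet> axis 2 1))"
    define v where "v = (\<lambda>p::real ^ 2. (h / 2 - p \<bullet> axis 1 1) * (a - 2 * (p \<bullet> axis 2 1)))"
    define U where "U = (\<lambda>p. vector [u p, v p] :: real ^ 2)"
    define J where "J = (\<lambda>p. vector [grad u p, grad v p] :: real ^ 2 ^ 2)"
    have poly: "real_polynomial_function u" "real_polynomial_function v"
      unfolding u_def v_def
      by (intro real_polynomial_function.intros(2,4) real_polynomial_function_diff polynomial_coord)+
    have co: "has_pd b (\<lambda>p. p \<bullet> c) p (b \<bullet> c)" for b c p :: "real ^ 2"
      by (rule has_pd_linear[OF bounded_linear_inner_left])
    have pd_u: "partial_deriv b u p = (b \<bullet> axis 2 1) * (a - 2 * (p \<bullet> axis 2 1))" for b p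
      unfolding u_def
      by (rule partial_deriv_eqI, rule has_pd_eqI[OF has_pd_mult[OF co has_pd_diff[OF has_pd_const co]]])
        (simp add: algebra_simps)
    have pd_v: "partial_deriv b v p = - (b \<bullet> axis 1 1) * (a - 2 * (p \<bullet> axis 2 1)) - 2 * (h / 2 - p \<bullet> axis 1 1) * (b \<bullet> axis 2 1)"
      for b p
      unfolding v_def
      by (rule partial_deriv_eqI, rule has_pd_eqI[OF has_pd_mult[OF has_pd_diff[OF has_pd_const co]
            has_pd_diff[OF has_pd_const has_pd_cmult[OF co]]]])
        (simp add: algebra_simps)
    have J: "J p $ 1 $ 1 = 0" "J p $ 1 $ 2 = a - 2 * p $ 2" "J p $ 2 $ 1 = - (a - 2 * p $ 2)"
      "J p $ 2 $ 2 = 2 * p $ 1 - h" for p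
      unfolding J_def vector_2 grad_component pd_u pd_v inner_axis_axis inner_axis by (simp_all add: axis_def)
    have sym: "sym_part (J p) = axis 2 (axis 2 (2 * p $ 1 - h))" for p
      by (simp add: vec_eq_iff forall_2 sym_part_def transpose_def J axis_def)
    have H1: "H1_jacobian R U J"
      unfolding H1_jacobian_def forall_2
      by (auto simp: U_def J_def intro!: polynomial_H1_grad[OF poly(1) R] polynomial_H1_grad[OF poly(2) R])
    have "has_trace R (\<lambda>p. U p $ 1) (\<lambda>s. vector [s, 0]) {0<..<h} (\<lambda>s. 0)"
      "has_trace R (\<lambda>p. U p $ 1) (\<lambda>s. vector [s, a]) {0<..<h} (\<lambda>s. 0)"
      using polynomial_has_zero_trace[OF poly(1) R] by (auto simp: U_def u_def inner_axis)
    then have tr: "\<exists>g. has_trace R (\<lambda>p. U p $ 1) (\<lambda>s. vector [s, 0]) {0<..<h} g \<and>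
        has_trace R (\<lambda>p. U p $ 1) (\<lambda>s. vector [s, a]) {0<..<h} g"
      by blast
    have w_le: "w p \<le> W" "0 \<le> w p" if "p \<in> R" for p
      using that unfolding w_def rectangle_weight_def W_def R_def rectangle_def
      by (auto intro!: weight_mono c \<alpha> weight_nonneg)
    define L where "L = L2_norm R (\<lambda>p. w p *\<^sub>R J p)"
    define P where "P = L2_norm R (\<lambda>p. w p * U p $ 1)"
    define Q where "Q = L2_norm R (\<lambda>p. w p *\<^sub>R sym_part (J p))"
    have "L\<^sup>2 \<le> ennreal C * (ennreal (\<phi> h) * P * Q + Q\<^sup>2)"
    proof -
      have "korn_interpolation_estimate a k c \<alpha> C (\<phi> h) h"
        using est h by simp
      then show ?thesis
        using H1 tr unfolding korn_interpolation_estimate_def Let_def R_def[symmetric] w_def[symmetric] L_def P_def Q_def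
        by blast
    qed
    moreover have "ennreal (w\<^sub>0 * (a / 2) * sqrt (a / 8) * sqrt h) \<le> L"
    proof -
      define T where "T = box (vector [0, a / 8]) (vector [h, a / 4] :: real ^ 2)"
      have T: "p \<in> T \<longleftrightarrow> 0 < p $ 1 \<and> p $ 1 < h \<and> a / 8 < p $ 2 \<and> p $ 2 < a / 4" for p
        by (auto simp: T_def mem_box_cart forall_2)
      have "ennreal (w\<^sub>0 * (a / 2) * sqrt (h * (a / 8))) \<le> L"
        unfolding L_def
      proof (rule L2_norm_lower)
        show "T \<in> sets lebesgue" "ennreal (h * (a / 8)) \<le> emeasure lebesgue T"
          using strip_measure[of h "a / 8" "a / 4"] h a by (auto simp: T_def)
        show "T \<subseteq> R"
          using a by (auto simp: T R_def rectangle_def)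
        fix p assume p: "p \<in> T"
        have "a / 2 \<le> \<bar>J p $ 1 $ 2\<bar>"
          using p by (simp add: J T)
        also have "\<dots> \<le> norm (J p)"
          using Finite_Cartesian_Product.norm_nth_le[of "J p $ 1" 2] Finite_Cartesian_Product.norm_nth_le[of "J p" 1] by simp
        moreover have "w\<^sub>0 \<le> w p"
          using p a unfolding w_def rectangle_weight_def w\<^sub>0_def by (intro weight_mono c \<alpha>) (auto simp: T)
        ultimately have "w\<^sub>0 * (a / 2) \<le> w p * norm (J p)"
          using w0 a by (intro mult_mono) auto
        then show "w\<^sub>0 * (a / 2) \<le> norm (w p *\<^sub>R J p)"
          using \<open>w\<^sub>0 \<le> w p\<close> w0 by simp
      qed (use h a w0 in auto)
      then show ?thesis
        by (simp add: real_sqrt_mult real_sqrt_divide mult_ac)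
    qed
    moreover have "P \<le> ennreal (W * a\<^sup>2 * sqrt a * sqrt h)"
    proof -
      have "P \<le> ennreal ((W * a\<^sup>2) * sqrt (h * a))"
        unfolding P_def
      proof (rule L2_norm_upper)
        fix p assume p: "p \<in> R"
        have y: "0 < p $ 2" "p $ 2 < a"
          using p by (auto simp: R_def rectangle_def)
        then have "\<bar>U p $ 1\<bar> \<le> a * a"
          by (auto simp: U_def u_def inner_axis abs_mult intro!: mult_mono)
        then show "norm (w p * U p $ 1) \<le> W * a\<^sup>2"
          using w_le[OF p] W by (simp add: abs_mult power2_eq_square mult_mono)
      qed (use R_meas h a W in auto)
      then show ?thesis
        by (simp add: real_sqrt_mult mult_ac)
    qed
    moreover have "Q \<le> ennreal (W * sqrt a * h * sqrt h)"
    proof -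
      have "Q \<le> ennreal ((W * h) * sqrt (h * a))"
        unfolding Q_def
      proof (rule L2_norm_upper)
        fix p assume p: "p \<in> R"
        then have "norm (sym_part (J p)) \<le> h"
          by (simp add: sym norm_axis_eq R_def rectangle_def abs_le_iff)
        then show "norm (w p *\<^sub>R sym_part (J p)) \<le> W * h"
          using w_le[OF p] W by (simp add: mult_mono)
      qed (use R_meas h a W in auto)
      then show ?thesis
        by (simp add: real_sqrt_mult mult_ac)
    qed
    ultimately show "\<exists>L P Q. ennreal (w\<^sub>0 * (a / 2) * sqrt (a / 8) * sqrt h) \<le> L \<and>
        P \<le> ennreal (W * a\<^sup>2 * sqrt a * sqrt h) \<and> Q \<le> ennreal (W * sqrt a * h * sqrt h) \<and>
        L\<^sup>2 \<le> ennreal C * (ennreal (\<phi> h) * P * Q + Q\<^sup>2)"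
      by blast
  qed (use w0 W a in auto)
qed

section \<open>Optimality of the factor 1/h\<close>

theorem theorem2p3:
  shows
    "(\<forall>(n::nat) (\<omega> :: (real ^ 'm) set) \<Gamma>\<^sub>1 \<Gamma>\<^sub>2 (k::nat) (c :: nat \<Rightarrow> real) (\<alpha> :: nat \<Rightarrow> real).
        2 \<le> n \<and> CARD('m) = n - 1 \<and>
        lipschitz_domain \<omega> \<and>
        frontier \<omega> = \<Gamma>\<^sub>1 \<union> \<Gamma>\<^sub>2 \<and> \<Gamma>\<^sub>1 \<inter> \<Gamma>\<^sub>2 = {} \<and>
        (\<exists>d::nat. d \<le> n - 1 \<and> int d simplex \<Gamma>\<^sub>1) \<and>
        ray_condition \<omega> \<Gamma>\<^sub>1 \<Gamma>\<^sub>2 \<and>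
        (\<forall>i\<in>{1..k}. 0 \<le> c i) \<and> (\<exists>i\<in>{1..k}. c i \<noteq> 0) \<and>
        (\<forall>i\<in>{1..k}. 0 \<le> \<alpha> i \<and> \<alpha> i < 1/2) \<and>
        ((\<exists>\<beta>. 0 \<le> \<beta> \<and> \<beta> < 1/2 \<and> 1 > 4 * real n * \<beta> / (1 - 2 * \<beta>)\<^sup>2 \<and> (\<forall>i\<in>{1..k}. \<alpha> i \<le> \<beta>)) \<or>
         (n = 2 \<and> (\<exists>a b. a < b \<and> \<omega> = box (vec a) (vec b)))) \<longrightarrow>
        \<not> (\<exists>h\<^sub>0 C \<phi>. 0 < h\<^sub>0 \<and> 0 < C \<and> (\<forall>h\<in>{0<..<h\<^sub>0}. 0 < \<phi> h) \<and>
             ((\<lambda>h. h * \<phi> h) \<longlongrightarrow> 0) (at_right 0) \<and>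
             (\<forall>h\<in>{0<..<h\<^sub>0}. gradient_separation_estimate \<omega> \<Gamma>\<^sub>1 k c \<alpha> C (\<phi> h) h)))
     \<and>
     (\<forall>(a::real) (k::nat) (c :: nat \<Rightarrow> real) (\<alpha> :: nat \<Rightarrow> real).
        0 < a \<and>
        (\<forall>i\<in>{1..k}. 0 \<le> c i) \<and> (\<exists>i\<in>{1..k}. c i \<noteq> 0) \<and>
        (\<forall>i\<in>{1..k}. 0 \<le> \<alpha> i \<and> \<alpha> i < 1/2) \<longrightarrow>
        \<not> (\<exists>h\<^sub>0 C \<phi>. 0 < h\<^sub>0 \<and> 0 < C \<and> (\<forall>h\<in>{0<..<h\<^sub>0}. 0 < \<phi> h) \<and>
             ((\<lambda>h. h * \<phi> h) \<longlongrightarrow> 0) (at_right 0) \<and>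
             (\<forall>h\<in>{0<..<h\<^sub>0}. korn_interpolation_estimate a k c \<alpha> C (\<phi> h) h)))"
proof (intro conjI allI impI notI; elim exE conjE)
  fix n d :: nat and \<omega> \<Gamma>\<^sub>1 \<Gamma>\<^sub>2 :: "(real ^ 'm) set" and k :: nat and c \<alpha> :: "nat \<Rightarrow> real"
    and h\<^sub>0 C :: real and \<phi> :: "real \<Rightarrow> real"
  assume d: "int d simplex \<Gamma>\<^sub>1" and "lipschitz_domain \<omega>" and f: "frontier \<omega> = \<Gamma>\<^sub>1 \<union> \<Gamma>\<^sub>2"
    and "\<forall>i\<in>{1..k}. 0 \<le> c i" "\<exists>i\<in>{1..k}. c i \<noteq> 0" "\<forall>i\<in>{1..k}. 0 \<le> \<alpha> i \<and> \<alpha> i < 1/2"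
    and "0 < h\<^sub>0" "0 < C" "\<forall>h\<in>{0<..<h\<^sub>0}. 0 < \<phi> h" "((\<lambda>h. h * \<phi> h) \<longlongrightarrow> 0) (at_right 0)"
    and "\<forall>h\<in>{0<..<h\<^sub>0}. gradient_separation_estimate \<omega> \<Gamma>\<^sub>1 k c \<alpha> C (\<phi> h) h"
  moreover have "\<Gamma>\<^sub>1 \<noteq> {}"
    using d by (auto simp: simplex_def)
  ultimately show False
    using compact_simplex[OF d] by (intro gradient_separation_sharp[of \<omega> \<Gamma>\<^sub>1 k c \<alpha> h\<^sub>0 C \<phi>]) auto
next
  fix a :: real and k :: nat and c \<alpha> :: "nat \<Rightarrow> real" and h\<^sub>0 C :: real and \<phi> :: "real \<Rightarrow> real"
  assume "0 < a" "\<forall>i\<in>{1..k}. 0 \<le> c i" "\<exists>i\<in>{1..k}. c i \<noteq> 0" "\<forall>i\<in>{1..k}. 0 \<le> \<alpha> i \<and> \<alpha> i < 1/2"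
    and "0 < h\<^sub>0" "0 < C" "\<forall>h\<in>{0<..<h\<^sub>0}. 0 < \<phi> h" "((\<lambda>h. h * \<phi> h) \<longlongrightarrow> 0) (at_right 0)"
    and "\<forall>h\<in>{0<..<h\<^sub>0}. korn_interpolation_estimate a k c \<alpha> C (\<phi> h) h"
  then show False
    by (intro korn_interpolation_sharp[of a k c \<alpha> h\<^sub>0 C \<phi>]) auto
qed

end
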